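(* Let $\Omega=\Omega_1\cup\Omega_2\cup\Omega_3\subset\mathbb{R}^2$ be the "stadium" domain given by $$\Omega_1=\{x=(x_1,x_2)\in\mathbb{R}^2 : |x-(1,0)|<1,\ x_1\ge 1\},\quad \Omega_2=(-1,1)\times(-1,1),\quad \Omega_3=\{x=(x_1,x_2)\in\mathbb{R}^2 : |x-(-1,0)|<1,\ x_1\le -1\}.$$ In the regime $\varepsilon\ll\eta\ll 1$ (that is, for parameters $\varepsilon,\eta>0$ with $\eta\to0$ and $\varepsilon/\eta\to 0$), there exist $C^1$ vector fields $m_{\varepsilon,\eta}:\Omega\to S^2$ satisfying the tangency condition $m_{\varepsilon,\eta}'\cdot\nu=0$ on $\partial\Omega$ and $$E_{\varepsilon,\eta}(m_{\varepsilon,\eta})\le 2\pi|\log\varepsilon|+\frac{2\pi+o(1)}{\eta|\log\eta|}\qquad\text{as }\eta\downarrow 0,$$ where $o(1)$ denotes a quantity tending to $0$ as $\eta\downarrow0$ in this regime.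
   Context: For $m=(m_1,m_2,m_3):\Omega\to S^2$ (the unit sphere of $\mathbb{R}^3$) write $m'=(m_1,m_2)$ for the in-plane component; $\nu$ is the outer unit normal to $\partial\Omega$; $\nabla=(\partial_{x_1},\partial_{x_2})$. Boundary values are understood in the sense of traces (finite energy gives $m\in H^1(\Omega)$). For $\varepsilon,\eta>0$ the energy is $$E_{\varepsilon,\eta}(m)=\int_\Omega|\nabla m|^2\,dx+\frac1{\varepsilon^2}\int_\Omega m_3^2\,dx+\frac1\eta\int_{\mathbb{R}^2}\big||\nabla|^{-1/2}(\nabla\cdot m')\big|^2\,dx,$$ where $m'$ is extended by $0$ outside $\Omega$, $\nabla\cdot m'$ is the distributional divergence in $\mathbb{R}^2$ of this extension, and $$\int_{\mathbb{R}^2}\big||\nabla|^{-1/2}(\nabla\cdot m')\big|^2dx:=\int_{\mathbb{R}^2}\frac1{|\xi|}|\mathcal{F}(\nabla\cdot m')(\xi)|^2\,d\xi,$$ with $\mathcal{F}$ the unitary Fourier transform $\mathcal{F}f(\xi)=\frac1{2\pi}\int_{\mathbb{R}^2}e^{-i\xi\cdot x}f(x)\,dx$. *)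

theory Defs
  imports "HOL-Analysis.Analysis"
begin

section \<open>Differentiability and traces\<close>

text \<open>Meant for open \<open>S\<close>.\<close>
definition C1_on :: "'a::euclidean_space set \<Rightarrow> ('a \<Rightarrow> 'b::euclidean_space) \<Rightarrow> bool" where
  "C1_on S f \<longleftrightarrow> (\<forall>x\<in>S. f differentiable (at x)) \<and>
     (\<forall>v. continuous_on S (\<lambda>x. frechet_derivative f (at x) v))"

definition grad_sq :: "('a::euclidean_space \<Rightarrow> 'b::euclidean_space) \<Rightarrow> 'a \<Rightarrow> real" where
  "grad_sq f x = (\<Sum>e\<in>Basis. (norm (frechet_derivative f (at x) e))\<^sup>2)"

text \<open>
  The trace operator is the continuous extension, from \<open>H\<^sup>1(\<Omega>)\<close> to \<open>L\<^sup>2(\<partial>\<Omega>)\<close>, of the restriction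
  to the boundary of functions that are \<open>C\<^sup>1\<close> up to the boundary (i.e. on a neighbourhood of the
  closure).  Here \<open>\<sigma>\<close> is the surface measure of the boundary.  The definition is only meant for \<open>u\<close>
  that is \<open>C\<^sup>1\<close> in the open set \<open>\<Omega>\<close>, for which the weak gradient is the classical one.
\<close>
definition has_trace ::
  "'a::euclidean_space measure \<Rightarrow> 'a set \<Rightarrow> ('a \<Rightarrow> 'b::euclidean_space) \<Rightarrow> ('a \<Rightarrow> 'b) \<Rightarrow> bool" where
  "has_trace \<sigma> \<Omega> u g \<longleftrightarrow> g \<in> borel_measurable borel \<and>
     (\<exists>U w. (\<forall>k::nat. open (U k) \<and> closure \<Omega> \<subseteq> U k \<and> C1_on (U k) (w k)) \<and>
        (\<lambda>k. \<integral>\<^sup>+x\<in>\<Omega>. ennreal ((norm (w k x - u x))\<^sup>2 + grad_sq (\<lambda>y. w k y - u y) x) \<partial>lborel)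
          \<longlonglongrightarrow> 0 \<and>
        (\<lambda>k. \<integral>\<^sup>+x\<in>frontier \<Omega>. ennreal ((norm (w k x - g x))\<^sup>2) \<partial>\<sigma>) \<longlonglongrightarrow> 0)"

section \<open>The energy\<close>

definition inplane :: "real^3 \<Rightarrow> real^2" where
  "inplane p = vector [p $ 1, p $ 2]"

text \<open>
  The distributional divergence of \<open>v\<close> as a functional on test functions:
  \<open>\<langle>\<nabla>\<cdot>v, \<phi>\<rangle> = - \<integral> v \<cdot> \<nabla>\<phi>\<close>, the integrand being the derivative of \<open>\<phi>\<close> in direction \<open>v\<close>.  If \<open>v\<close> is
  bounded and vanishes outside a bounded set, this distribution has compact support and may be
  paired with every smooth \<open>\<phi>\<close>.
\<close>
definition distr_div :: "(real^2 \<Rightarrow> real^2) \<Rightarrow> (real^2 \<Rightarrow> complex) \<Rightarrow> complex" where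
  "distr_div v \<phi> = - (LINT x|lborel. frechet_derivative \<phi> (at x) (v x))"

text \<open>
  Unitary Fourier transform of a compactly supported distribution \<open>T\<close> on the plane: the function
  \<open>\<xi> \<mapsto> (2\<pi>)\<^sup>-\<^sup>1 \<langle>T, e\<^sup>-\<^sup>i\<^sup>\<xi>\<^sup>\<cdot>\<^sup>x\<rangle>\<close>.
\<close>
definition fourier_distr :: "((real^2 \<Rightarrow> complex) \<Rightarrow> complex) \<Rightarrow> real^2 \<Rightarrow> complex" where
  "fourier_distr T \<xi> = T (\<lambda>x. cis (- (\<xi> \<bullet> x))) / (2 * pi)"

definition Hmhalf_sq :: "((real^2 \<Rightarrow> complex) \<Rightarrow> complex) \<Rightarrow> ennreal" where
  "Hmhalf_sq T = (\<integral>\<^sup>+\<xi>. ennreal (1 / norm \<xi> * (cmod (fourier_distr T \<xi>))\<^sup>2) \<partial>lborel)"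

text \<open>Only the values of \<open>m\<close> in the open set \<open>\<Omega>\<close> matter; the value \<open>\<infinity>\<close> is possible.\<close>
definition energy :: "(real^2) set \<Rightarrow> real \<Rightarrow> real \<Rightarrow> (real^2 \<Rightarrow> real^3) \<Rightarrow> ennreal" where
  "energy \<Omega> \<epsilon> \<eta> m =
     (\<integral>\<^sup>+x\<in>\<Omega>. ennreal (grad_sq m x) \<partial>lborel)
     + ennreal (1 / \<epsilon>\<^sup>2) * (\<integral>\<^sup>+x\<in>\<Omega>. ennreal ((m x $ 3)\<^sup>2) \<partial>lborel)
     + ennreal (1 / \<eta>) * Hmhalf_sq (distr_div (\<lambda>x. indicator \<Omega> x *\<^sub>R inplane (m x)))"

lemma fourier_distr_div:
  "fourier_distr (distr_div v) \<xi> =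
     \<i> / (2 * pi) * (LINT x|lborel. cis (- (\<xi> \<bullet> x)) * complex_of_real (\<xi> \<bullet> v x))"
proof -
  have d: "((\<lambda>x. cis (- (\<xi> \<bullet> x))) has_derivative
      (\<lambda>h. - \<i> * (cis (- (\<xi> \<bullet> x)) * complex_of_real (\<xi> \<bullet> h)))) (at x)" for x :: "real^2"
  proof -
    have "((\<lambda>x. - \<i> * complex_of_real (\<xi> \<bullet> x)) has_derivative
        (\<lambda>h. - \<i> * complex_of_real (\<xi> \<bullet> h))) (at x)"
      by (auto intro!: derivative_eq_intros)
    moreover have "(exp has_derivative (*) (exp (- \<i> * complex_of_real (\<xi> \<bullet> x))))
        (at (- \<i> * complex_of_real (\<xi> \<bullet> x)))"
      using DERIV_exp by (simp add: has_field_derivative_def)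
    ultimately have "((\<lambda>x. exp (- \<i> * complex_of_real (\<xi> \<bullet> x))) has_derivative
        (\<lambda>h. exp (- \<i> * complex_of_real (\<xi> \<bullet> x)) * (- \<i> * complex_of_real (\<xi> \<bullet> h)))) (at x)"
      by (rule has_derivative_compose)
    then show ?thesis by (simp add: cis_conv_exp mult.left_commute)
  qed
  have "distr_div v (\<lambda>x. cis (- (\<xi> \<bullet> x))) =
      - (LINT x|lborel. - \<i> * (cis (- (\<xi> \<bullet> x)) * complex_of_real (\<xi> \<bullet> v x)))"
    unfolding distr_div_def by (simp add: frechet_derivative_at[OF d, symmetric])
  also have "\<dots> = \<i> * (LINT x|lborel. cis (- (\<xi> \<bullet> x)) * complex_of_real (\<xi> \<bullet> v x))"
    by simp
  finally show ?thesis
    unfolding fourier_distr_def by simp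
qed

section \<open>The stadium and its boundary\<close>

definition stadium :: "(real^2) set" where
  "stadium =
     {x. norm (x - vector [1, 0]) < 1 \<and> 1 \<le> x $ 1} \<union>
     {x. -1 < x $ 1 \<and> x $ 1 < 1 \<and> -1 < x $ 2 \<and> x $ 2 < 1} \<union>
     {x. norm (x - vector [-1, 0]) < 1 \<and> x $ 1 \<le> -1}"

text \<open>
  On the boundary this is the outer unit normal: the vector from the nearest point of the segment
  \<open>[-1, 1] \<times> {0}\<close> to \<open>x\<close>.
\<close>
definition stadium_normal :: "real^2 \<Rightarrow> real^2" where
  "stadium_normal x = vector [x $ 1 - max (-1) (min 1 (x $ 1)), x $ 2]"

text \<open>Counterclockwise arc-length parametrisation of the boundary, starting at \<open>(1, -1)\<close>.\<close>
definition stadium_curve :: "real \<Rightarrow> real^2" where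
  "stadium_curve s =
     (if s \<le> pi then vector [1 + sin s, - cos s]
      else if s \<le> pi + 2 then vector [1 - (s - pi), 1]
      else if s \<le> 2 * pi + 2 then vector [- 1 + sin (s - 2), - cos (s - 2)]
      else vector [- 1 + (s - (2 * pi + 2)), -1])"

definition stadium_arclength :: "(real^2) measure" where
  "stadium_arclength =
     distr (restrict_space lborel {0..<2 * pi + 4}) borel stadium_curve"

lemma norm_2: "norm (x :: real^2) = sqrt ((x $ 1)\<^sup>2 + (x $ 2)\<^sup>2)"
  by (simp add: norm_vec_def L2_set_def sum_2)

lemma inner_2: "(x :: real^2) \<bullet> y = x $ 1 * y $ 1 + x $ 2 * y $ 2"
  by (simp add: inner_vec_def sum_2)

lemma stadium_eq: "stadium = {x. norm (stadium_normal x) < 1}"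
proof (intro set_eqI)
  fix x :: "real^2"
  consider "x $ 1 \<ge> 1" | "x $ 1 \<le> -1" | "-1 < x $ 1 \<and> x $ 1 < 1" by linarith
  then show "x \<in> stadium \<longleftrightarrow> x \<in> {x. norm (stadium_normal x) < 1}"
  proof cases
    case 1
    then show ?thesis
      by (auto simp: stadium_def stadium_normal_def norm_2 max_def min_def)
  next
    case 2
    then have "x $ 1 - max (-1) (min 1 (x $ 1)) = x $ 1 + 1" by linarith
    with 2 show ?thesis
      by (auto simp: stadium_def stadium_normal_def norm_2)
  next
    case 3
    then have "x $ 1 - max (-1) (min 1 (x $ 1)) = 0" by linarith
    with 3 show ?thesis
      by (auto simp: stadium_def stadium_normal_def norm_2 abs_square_less_1)
  qed
qed

lemma vector_2_axis: "(vector [a, b] :: real^2) = a *\<^sub>R axis 1 1 + b *\<^sub>R axis 2 1"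
  by (simp add: vec_eq_iff forall_2 axis_def)

lemma continuous_stadium_normal: "continuous_on S stadium_normal"
  unfolding stadium_normal_def[abs_def] vector_2_axis by (intro continuous_intros)

lemma open_stadium: "open stadium"
  unfolding stadium_eq
  by (intro open_Collect_less continuous_intros continuous_stadium_normal)

lemma stadium_normal_shift:
  assumes "0 \<le> 1 + t"
  shows "stadium_normal (x + t *\<^sub>R stadium_normal x) = (1 + t) *\<^sub>R stadium_normal x"
proof -
  consider "x $ 1 \<ge> 1" | "x $ 1 \<le> -1" | "-1 < x $ 1 \<and> x $ 1 < 1" by linarith
  then show ?thesis
  proof cases
    case 1
    then have "0 \<le> (1 + t) * (x $ 1 - 1)" using assms by simp
    then have "1 \<le> x $ 1 + t * (x $ 1 - 1)" by (simp add: algebra_simps)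
    with 1 show ?thesis
      by (auto simp: stadium_normal_def vec_eq_iff forall_2 max_def min_def algebra_simps)
  next
    case 2
    then have "0 \<le> (1 + t) * (- 1 - x $ 1)" using assms by simp
    then have "x $ 1 + t * (x $ 1 + 1) \<le> -1" by (simp add: algebra_simps)
    with 2 show ?thesis
      by (auto simp: stadium_normal_def vec_eq_iff forall_2 max_def min_def algebra_simps)
  next
    case 3
    then show ?thesis
      by (auto simp: stadium_normal_def vec_eq_iff forall_2 max_def min_def algebra_simps)
  qed
qed

lemma frontier_stadium: "frontier stadium = {x. norm (stadium_normal x) = 1}"
proof
  have "closed {x. norm (stadium_normal x) \<le> 1}"
    by (intro closed_Collect_le continuous_intros continuous_stadium_normal)
  then have "closure stadium \<subseteq> {x. norm (stadium_normal x) \<le> 1}"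
    by (intro closure_minimal) (auto simp: stadium_eq)
  then show "frontier stadium \<subseteq> {x. norm (stadium_normal x) = 1}"
    using interior_open[OF open_stadium] by (auto simp: frontier_def stadium_eq)
next
  show "{x. norm (stadium_normal x) = 1} \<subseteq> frontier stadium"
  proof
    fix x assume "x \<in> {x. norm (stadium_normal x) = 1}"
    then have x: "norm (stadium_normal x) = 1" by simp
    have lim: "((\<lambda>t. x + t *\<^sub>R stadium_normal x) \<longlongrightarrow> x + 0 *\<^sub>R stadium_normal x) (at_left 0)"
      by (intro tendsto_intros)
    have "eventually (\<lambda>t. x + t *\<^sub>R stadium_normal x \<in> stadium) (at_left 0)"
      unfolding eventually_at_left_field
      by (rule exI[of _ "-1"]) (auto simp: stadium_eq stadium_normal_shift x)
    then have "eventually (\<lambda>t. x + t *\<^sub>R stadium_normal x \<in> closure stadium) (at_left 0)"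
      by (rule eventually_mono) (use closure_subset in blast)
    with lim have "x + 0 *\<^sub>R stadium_normal x \<in> closure stadium"
      by (intro Lim_in_closed_set[OF closed_closure]) (auto simp: trivial_limit_at_left_real)
    then have "x \<in> closure stadium" by simp
    moreover have "x \<notin> stadium" using x by (simp add: stadium_eq)
    ultimately show "x \<in> frontier stadium"
      using interior_open[OF open_stadium] by (simp add: frontier_def)
  qed
qed

text \<open>
  Justification of \<open>stadium_normal\<close>: it is a continuous unit vector field on the boundary, it points
  out of the stadium, and it spans the normal cone (the stadium is convex).
\<close>
lemma norm_stadium_normal: "x \<in> frontier stadium \<Longrightarrow> norm (stadium_normal x) = 1"
  by (simp add: frontier_stadium)

lemma stadium_normal_outer:
  assumes x: "x \<in> frontier stadium" and y: "y \<in> stadium"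
  shows "(y - x) \<bullet> stadium_normal x < 0"
proof -
  define p where "p z = z - stadium_normal z" for z :: "real^2"
  have nx: "norm (stadium_normal x) = 1" using x by (simp add: frontier_stadium)
  have ny: "norm (stadium_normal y) < 1" using y by (simp add: stadium_eq)
  have pn: "(p y - p x) \<bullet> stadium_normal x \<le> 0"
    unfolding p_def stadium_normal_def inner_2
    by (auto simp: max_def min_def mult_nonneg_nonpos mult_nonneg_nonneg mult_nonpos_nonneg mult_nonpos_nonpos)
  have "stadium_normal y \<bullet> stadium_normal x \<le> norm (stadium_normal y) * norm (stadium_normal x)"
    by (rule norm_cauchy_schwarz)
  also have "\<dots> < 1" using nx ny by simp
  finally have "stadium_normal y \<bullet> stadium_normal x < 1" .
  moreover have "stadium_normal x \<bullet> stadium_normal x = 1"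
    using nx by (simp add: dot_square_norm)
  moreover have "y - x = (p y - p x) + stadium_normal y - stadium_normal x"
    by (simp add: p_def)
  ultimately show ?thesis
    using pn by (simp add: inner_diff_left inner_add_left)
qed

lemma stadium_curve_measurable: "stadium_curve \<in> borel_measurable borel"
proof -
  have v: "(\<lambda>s. vector [f s, g s] :: real^2) \<in> borel_measurable borel"
    if "continuous_on UNIV f" "continuous_on UNIV g" for f g :: "real \<Rightarrow> real"
    unfolding vector_2_axis
    by (intro borel_measurable_continuous_onI continuous_intros that)
  show ?thesis
    unfolding stadium_curve_def
    by (intro measurable_If v continuous_intros) measurable
qed

lemma stadium_curve_frontier:
  assumes "s \<in> {0..<2 * pi + 4}"
  shows "stadium_curve s \<in> frontier stadium"
proof -
  have [simp]: "sin s \<ge> 0" if "s \<le> pi"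
    using that assms by (intro sin_ge_zero) auto
  have s2: "sin (s - 2) \<le> 0" if "pi + 2 < s" "s \<le> 2 * pi + 2"
  proof -
    have "0 \<le> sin (s - 2 - pi)" using that by (intro sin_ge_zero) auto
    then show ?thesis by simp
  qed
  have c2: "(cos (s - 2))\<^sup>2 = 1" if "sin (s - 2) = 0"
    using that by (simp add: cos_squared_eq)
  show ?thesis
    using assms s2 c2
    by (auto simp: frontier_stadium stadium_curve_def stadium_normal_def norm_2 max_def min_def)
qed

section \<open>The asymptotic regime\<close>

text \<open>Pairs \<open>(\<epsilon>, \<eta>)\<close> of positive parameters with \<open>\<eta> \<rightarrow> 0\<close> and \<open>\<epsilon>/\<eta> \<rightarrow> 0\<close>.\<close>
definition regime :: "(real \<times> real) filter" where
  "regime = inf (filtercomap (\<lambda>(\<epsilon>, \<eta>). \<eta>) (at_right 0)) (filtercomap (\<lambda>(\<epsilon>, \<eta>). \<epsilon> / \<eta>) (at_right 0))"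

lemma eventually_regime:
  "eventually P regime \<longleftrightarrow>
     (\<exists>\<delta>>0. \<forall>\<epsilon> \<eta>. 0 < \<eta> \<longrightarrow> \<eta> < \<delta> \<longrightarrow> 0 < \<epsilon> \<longrightarrow> \<epsilon> / \<eta> < \<delta> \<longrightarrow> P (\<epsilon>, \<eta>))"
proof
  assume "eventually P regime"
  then obtain Q R where Q: "eventually Q (filtercomap (\<lambda>(\<epsilon>, \<eta>). \<eta>) (at_right 0))"
    and R: "eventually R (filtercomap (\<lambda>(\<epsilon>, \<eta>). \<epsilon> / \<eta>) (at_right 0))"
    and P: "\<And>x. Q x \<and> R x \<Longrightarrow> P x"
    unfolding regime_def eventually_inf by blast
  from Q obtain Q' d where "d > 0" "\<And>y. 0 < y \<Longrightarrow> y < d \<Longrightarrow> Q' y"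
    "\<And>x. Q' (case x of (\<epsilon>, \<eta>) \<Rightarrow> \<eta>) \<Longrightarrow> Q x"
    unfolding eventually_filtercomap eventually_at_right_field by blast
  then have Qd: "\<And>\<epsilon> \<eta>. 0 < \<eta> \<Longrightarrow> \<eta> < d \<Longrightarrow> Q (\<epsilon>, \<eta>)" by simp
  from R obtain R' e where "e > 0" "\<And>y. 0 < y \<Longrightarrow> y < e \<Longrightarrow> R' y"
    "\<And>x. R' (case x of (\<epsilon>, \<eta>) \<Rightarrow> \<epsilon> / \<eta>) \<Longrightarrow> R x"
    unfolding eventually_filtercomap eventually_at_right_field by blast
  then have Re: "\<And>\<epsilon> \<eta>. 0 < \<epsilon> / \<eta> \<Longrightarrow> \<epsilon> / \<eta> < e \<Longrightarrow> R (\<epsilon>, \<eta>)" by simp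
  show "\<exists>\<delta>>0. \<forall>\<epsilon> \<eta>. 0 < \<eta> \<longrightarrow> \<eta> < \<delta> \<longrightarrow> 0 < \<epsilon> \<longrightarrow> \<epsilon> / \<eta> < \<delta> \<longrightarrow> P (\<epsilon>, \<eta>)"
    by (intro exI[of _ "min d e"]) (use \<open>d > 0\<close> \<open>e > 0\<close> P Qd Re in auto)
next
  assume "\<exists>\<delta>>0. \<forall>\<epsilon> \<eta>. 0 < \<eta> \<longrightarrow> \<eta> < \<delta> \<longrightarrow> 0 < \<epsilon> \<longrightarrow> \<epsilon> / \<eta> < \<delta> \<longrightarrow> P (\<epsilon>, \<eta>)"
  then obtain d where d: "d > 0"
    "\<And>\<epsilon> \<eta>. 0 < \<eta> \<Longrightarrow> \<eta> < d \<Longrightarrow> 0 < \<epsilon> \<Longrightarrow> \<epsilon> / \<eta> < d \<Longrightarrow> P (\<epsilon>, \<eta>)" by blast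
  note eventually_filtercomapI' = eventually_mono[OF eventually_filtercomapI]
  have ev: "eventually (\<lambda>y. 0 < y \<and> y < d) (at_right (0::real))"
    unfolding eventually_at_right_field using d(1) by blast
  have "eventually (\<lambda>x. 0 < snd x \<and> snd x < d) (filtercomap (\<lambda>(\<epsilon>, \<eta>). \<eta>) (at_right 0))"
    by (rule eventually_filtercomapI'[OF ev]) auto
  moreover have "eventually (\<lambda>x. 0 < fst x / snd x \<and> fst x / snd x < d)
      (filtercomap (\<lambda>(\<epsilon>, \<eta>). \<epsilon> / \<eta>) (at_right 0))"
    by (rule eventually_filtercomapI'[OF ev]) auto
  ultimately show "eventually P regime"
    unfolding regime_def eventually_inf
    by (intro exI conjI) (assumption, assumption, auto simp: zero_less_divide_iff intro: d(2))
qed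

end

theory Submission
  imports Defs "HOL-Probability.Probability" "HOL-Real_Asymp.Real_Asymp"
begin

text \<open>
  The competitor is the Landau state of the stadium.  Up to normalisation and a vortex core of radius
  \<open>\<epsilon>\<close>, its in-plane part is \<open>(-x\<^sub>2, q)\<close> where \<open>q\<close> is the median of \<open>x\<^sub>1 - 1\<close>, \<open>Q(x\<^sub>2)\<close> and
  \<open>x\<^sub>1 + 1\<close>, with the corners of the median smoothed.  Where \<open>q = x\<^sub>1 \<plusminus> 1\<close> this is a rotation about a
  point of \<open>{-1, 1} \<times> {0}\<close> and has no divergence; where \<open>q = Q(x\<^sub>2)\<close> it is a Neel wall along the segment
  \<open>[-1, 1] \<times> {0}\<close> with second component \<open>v(x\<^sub>2)\<close>.  At \<open>(1, 0)\<close> we have \<open>q = Q(0) > 0\<close>, so the only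
  zero is a vortex at \<open>(-1, 0)\<close>, which costs \<open>2\<pi> |log \<epsilon>| + O(1)\<close>.

  The profile satisfies \<open>|v'(t)| \<le> 1 / (\<Lambda> |t|)\<close> with \<open>\<Lambda> = |log \<eta>| (1 + o(1))\<close>, so the charge density \<open>f\<close>
  is odd in \<open>x\<^sub>2\<close> with \<open>|f| \<le> A / |x\<^sub>2|\<close>, \<open>A = (1 + o(1)) / |log \<eta>|\<close>, and total mass \<open>4 + o(1)\<close>.  The
  stray field energy is a Coulomb energy, and for such densities a Schur test bounds it by
  \<open>(\<pi> A / 2) \<integral>|f| = (2\<pi> + o(1)) / |log \<eta>|\<close>; the constant comes from
  \<open>\<integral> log |(1 + u) / (1 - u)| du / u = \<pi>\<^sup>2\<close>.  The wall width \<open>\<delta> = \<eta> log\<^sup>2 \<eta>\<close> makes the remaining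
  exchange energy \<open>O(1 / \<delta>)\<close> negligible against \<open>1 / (\<eta> |log \<eta>|)\<close>.
\<close>

section \<open>Gaussian integrals and the logarithmic kernel\<close>

text \<open>The Schur test bounds the energy by the supremum of |t f(t)| times the total charge.
  Across the wall the charge is v', where v runs from 0 to 1 and back, so v' proportional to 1/t,
  hence a logarithmic v, is the natural profile; it has to be truncated at the scale \<delta>. Then
  Q is forced: the normalised field (-x2, Q) depends on x2 alone and has second component v, so its
  divergence is v'. The obstacle is exact tangency. It needs Q to vanish at x2 = 1 and x2 = -1 and
  the field to be a rotation near the caps, and a mollification of uniform width would destroy both.
  The smoothing width therefore tends to 0 at the horizontal sides. As a consequence the field is
  shown to be C^1 inside and continuous up to the boundary; its trace comes from dilations, and the
  absence of surface charge from cutoffs combined with a bound |m' . n| \<le> C (1 - |n|^2) that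
  holds throughout the stadium. The condition \<epsilon> \<le> \<delta>/2 keeps the core inside the
  rotation about (-1, 0), where the divergence is 0 even in the core.\<close>

lemma nn_integral_gaussian_half_line:
  fixes r :: real
  assumes "r > 0"
  shows "(\<integral>\<^sup>+\<tau>. ennreal (exp (- (\<tau>\<^sup>2 * r\<^sup>2))) * indicator {0..} \<tau> \<partial>lborel) = ennreal (sqrt pi / (2 * r))"
proof -
  have "ennreal (sqrt pi / 2) = (\<integral>\<^sup>+x. ennreal (indicator {0..} x *\<^sub>R exp (- x\<^sup>2)) \<partial>lborel)"
    using gaussian_moment_0 unfolding has_bochner_integral_iff
    by (subst nn_integral_eq_integral) auto
  also have "\<dots> = (\<integral>\<^sup>+x. ennreal (exp (- x\<^sup>2)) * indicator {0..} x \<partial>lborel)"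
    by (intro nn_integral_cong) (auto simp: indicator_def)
  also have "\<dots> = ennreal r * (\<integral>\<^sup>+\<tau>. ennreal (exp (- (0 + r * \<tau>)\<^sup>2)) * indicator {0..} (0 + r * \<tau>) \<partial>lborel)"
    using assms by (subst nn_integral_real_affine[where c = r and t = 0]) auto
  also have "\<dots> = ennreal r * (\<integral>\<^sup>+\<tau>. ennreal (exp (- (\<tau>\<^sup>2 * r\<^sup>2))) * indicator {0..} \<tau> \<partial>lborel)"
    using assms by (intro arg_cong2[of _ _ _ _ "(*)"] nn_integral_cong refl)
      (auto simp: indicator_def zero_le_mult_iff power_mult_distrib mult.commute)
  finally have e: "ennreal (sqrt pi / 2) = ennreal r *
    (\<integral>\<^sup>+\<tau>. ennreal (exp (- (\<tau>\<^sup>2 * r\<^sup>2))) * indicator {0..} \<tau> \<partial>lborel)" (is "_ = _ * ?J") .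
  have "ennreal (sqrt pi / (2 * r)) = ennreal (1 / r) * ennreal (sqrt pi / 2)"
    using assms by (subst ennreal_mult[symmetric]) (auto simp: field_simps)
  also have "\<dots> = (ennreal (1 / r) * ennreal r) * ?J"
    by (simp add: e mult.assoc)
  also have "ennreal (1 / r) * ennreal r = 1"
    using assms by (subst ennreal_mult[symmetric]) auto
  finally show ?thesis by simp
qed

text \<open>The integrand is the \<tau>-derivative of exp(-(c/\<tau>)^2)/c and also minus the
  c-derivative of exp(-(c/\<tau>)^2)/\<tau>. The first reading evaluates the integral here, the
  second introduces it in \<open>frullani_gaussian\<close>.\<close>

lemma nn_integral_exp_inverse_square:
  fixes c :: real
  assumes c: "c > 0"
  shows "(\<integral>\<^sup>+\<tau>. ennreal (2 * c / \<tau> ^ 3 * exp (- (c / \<tau>)\<^sup>2)) * indicator {0..} \<tau> \<partial>lborel) = ennreal (1 / c)"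
proof -
  define F where "F = (\<lambda>\<tau>::real. if \<tau> \<le> 0 then 0 else exp (- (c / \<tau>)\<^sup>2) / c)"
  have D: "(F has_real_derivative 2 * c / \<tau> ^ 3 * exp (- (c / \<tau>)\<^sup>2)) (at \<tau>)" if "\<tau> > 0" for \<tau>
  proof -
    have "((\<lambda>\<tau>. exp (- (c / \<tau>)\<^sup>2) / c) has_real_derivative 2 * c / \<tau> ^ 3 * exp (- (c / \<tau>)\<^sup>2)) (at \<tau>)"
      using that c by (auto intro!: derivative_eq_intros simp: field_simps power2_eq_square power3_eq_cube)
    moreover have "eventually (\<lambda>x. x \<in> {0<..}) (nhds \<tau>)"
      using that by (intro eventually_nhds_in_open) auto
    then have "eventually (\<lambda>x. F x = exp (- (c / x)\<^sup>2) / c) (nhds \<tau>)"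
      by (rule eventually_mono) (auto simp: F_def)
    ultimately show ?thesis
      by (subst DERIV_cong_ev[OF refl _ refl])
  qed
  \<comment> \<open>The fundamental theorem on the closed half line asks for a derivative at 0 too.
    The integrand is 0 there by division by zero, and \<open>F\<close> is flat at 0 from both
    sides.\<close>
  have D0: "(F has_real_derivative 0) (at 0)"
  proof -
    have "((\<lambda>h. (F (0 + h) - F 0) / h) \<longlongrightarrow> 0) (at_right 0)"
    proof -
      have "((\<lambda>h. exp (- (c / h)\<^sup>2) / c / h) \<longlongrightarrow> 0) (at_right 0)" using c by real_asymp
      then show ?thesis
        by (rule Lim_transform_eventually)
          (auto simp: F_def eventually_at_filter)
    qed
    moreover have "((\<lambda>h. (F (0 + h) - F 0) / h) \<longlongrightarrow> 0) (at_left 0)"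
      by (rule Lim_transform_eventually[OF tendsto_const]) (auto simp: F_def eventually_at_filter)
    ultimately show ?thesis
      unfolding DERIV_def by (simp add: filterlim_at_split)
  qed
  have "(F \<longlongrightarrow> 1 / c) at_top"
  proof -
    have "((\<lambda>\<tau>. exp (- (c / \<tau>)\<^sup>2) / c) \<longlongrightarrow> 1 / c) at_top" using c by (real_asymp simp: field_simps)
    moreover have "eventually (\<lambda>\<tau>. exp (- (c / \<tau>)\<^sup>2) / c = F \<tau>) at_top"
      using eventually_gt_at_top[of 0] by (rule eventually_mono) (auto simp: F_def)
    ultimately show ?thesis
      by (rule Lim_transform_eventually)
  qed
  then have "(\<integral>\<^sup>+\<tau>. ennreal (2 * c / \<tau> ^ 3 * exp (- (c / \<tau>)\<^sup>2)) * indicator {0..} \<tau> \<partial>lborel) = ennreal (1 / c - F 0)"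
  proof (intro nn_integral_FTC_atLeast)
    fix \<tau> :: real assume "0 \<le> \<tau>"
    then show "(F has_real_derivative 2 * c / \<tau> ^ 3 * exp (- (c / \<tau>)\<^sup>2)) (at \<tau>)"
      using D[of \<tau>] D0 by (cases "\<tau> = 0") auto
  qed (use c in auto)
  then show ?thesis by (simp add: F_def)
qed

text \<open>Frullani's integral: the difference is an integral over c in [a, b], and after Tonelli
  the inner \<tau>-integral is 1/c.\<close>

lemma frullani_gaussian:
  fixes a b :: real
  assumes ab: "0 < a" "a \<le> b"
  shows "(\<integral>\<^sup>+\<tau>. ennreal ((exp (- (a / \<tau>)\<^sup>2) - exp (- (b / \<tau>)\<^sup>2)) / \<tau>) * indicator {0<..} \<tau> \<partial>lborel) = ennreal (ln (b / a))"
proof -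
  let ?h = "\<lambda>c \<tau>. ennreal (2 * c / \<tau> ^ 3 * exp (- (c / \<tau>)\<^sup>2)) * indicator {0..} \<tau>"
  let ?d = "\<lambda>\<tau>. ennreal ((exp (- (a / \<tau>)\<^sup>2) - exp (- (b / \<tau>)\<^sup>2)) / \<tau>) * indicator {0<..} \<tau>"
  have *: "?d \<tau> =
      (\<integral>\<^sup>+c. ?h c \<tau> * indicator {a..b} c \<partial>lborel)" for \<tau>
  proof (cases "\<tau> > 0")
    case True
    have "(\<integral>\<^sup>+c. ennreal (2 * c / \<tau> ^ 3 * exp (- (c / \<tau>)\<^sup>2)) * indicator {a..b} c \<partial>lborel) =
      ennreal ((- exp (- (b / \<tau>)\<^sup>2) / \<tau>) - (- exp (- (a / \<tau>)\<^sup>2) / \<tau>))"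
      using True ab
      by (intro nn_integral_FTC_Icc)
        (auto intro!: derivative_eq_intros simp: field_simps power2_eq_square power3_eq_cube)
    then show ?thesis using True by (simp add: diff_divide_distrib)
  next
    case False
    then show ?thesis by (cases "\<tau> = 0") (auto simp: indicator_def)
  qed
  have "(\<integral>\<^sup>+\<tau>. ?d \<tau> \<partial>lborel) =
    (\<integral>\<^sup>+c. (\<integral>\<^sup>+\<tau>. ?h c \<tau> * indicator {a..b} c \<partial>lborel) \<partial>lborel)"
    unfolding * by (rule lborel_pair.Fubini') measurable
  also have "\<dots> = (\<integral>\<^sup>+c. ennreal (1 / c) * indicator {a..b} c \<partial>lborel)"
  proof (intro nn_integral_cong)
    fix c :: real
    show "(\<integral>\<^sup>+\<tau>. ?h c \<tau> * indicator {a..b} c \<partial>lborel)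
      = ennreal (1 / c) * indicator {a..b} c"
      using ab nn_integral_exp_inverse_square[of c] by (auto simp: indicator_def)
  qed
  also have "\<dots> = ennreal (ln b - ln a)"
    using ab by (intro nn_integral_FTC_Icc) (auto intro!: derivative_eq_intros simp: field_simps)
  finally show ?thesis using ab by (simp add: ln_div)
qed

text \<open>The Basel sum minus its even terms, which make up a quarter of it.\<close>

lemma sums_inverse_odd_squares: "(\<lambda>n. 1 / (2 * real n + 1)\<^sup>2) sums (pi\<^sup>2 / 8)"
proof -
  define f where "f = (\<lambda>n. 1 / (real n + 1)\<^sup>2)"
  have f: "f sums (pi\<^sup>2 / 6)"
    using inverse_squares_sums by (simp add: f_def add.commute)
  have "(\<lambda>n. \<Sum>i\<in>{n * 2..<n * 2 + 2}. f i) sums (pi\<^sup>2 / 6)"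
    by (rule sums_group[OF f]) simp
  moreover have "{n * 2..<n * 2 + 2} = {2 * n, 2 * n + 1}" for n :: nat by auto
  ultimately have "(\<lambda>n. f (2 * n) + f (2 * n + 1)) sums (pi\<^sup>2 / 6)" by (simp add: mult.commute)
  moreover have "(\<lambda>n. f (2 * n + 1)) sums (pi\<^sup>2 / 6 / 4)"
    using sums_divide[OF f, of 4]
    by (rule sums_cong[THEN iffD1, rotated]) (auto simp: f_def field_simps power2_eq_square)
  ultimately have "(\<lambda>n. f (2 * n) + f (2 * n + 1) - f (2 * n + 1)) sums (pi\<^sup>2 / 6 - pi\<^sup>2 / 6 / 4)"
    by (rule sums_diff)
  then show ?thesis by (simp add: f_def)
qed

lemma ln_quotient_series:
  fixes u :: real
  assumes "0 \<le> u" "u < 1"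
  shows "(\<lambda>k. 2 * u ^ (2 * k + 1) / real (2 * k + 1)) sums ln ((1 + u) / (1 - u))"
proof -
  have "((1 + u) / (1 - u) - 1) / ((1 + u) / (1 - u) + 1) = u"
    using assms by (simp add: field_simps)
  then show ?thesis using ln_series_quadratic[of "(1 + u) / (1 - u)"] assms by simp
qed

text \<open>The logarithmic potential of a line charge and its mirror image, against the Schur
  weight 1/|t|, in the scaled variable u = t/s.\<close>

definition log_kernel :: "real \<Rightarrow> real" where
  "log_kernel u = \<bar>ln (\<bar>1 + u\<bar> / \<bar>1 - u\<bar>)\<bar> / \<bar>u\<bar>"

text \<open>The logarithm is 2 artanh u for u < 1 and 2 artanh (1/u) for u > 1, expanded in powers
  of u and of 1/u. Equality fails at u = 1, where both indicators are active and the series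
  diverges.\<close>

lemma log_kernel_le_series:
  assumes u: "u \<ge> 0"
  shows "ennreal (log_kernel u) \<le>
    (\<Sum>k. ennreal (2 / real (2 * k + 1)) * (ennreal (u ^ (2 * k)) * indicator {0..1} u
        + ennreal (1 / u ^ (2 * k + 2)) * indicator {1..} u))"
proof -
  consider "u = 0 \<or> u = 1" | "0 < u" "u < 1" | "u > 1" using u by linarith
  then show ?thesis
  proof cases
    \<comment> \<open>The conventions for division by zero and \<open>ln 0\<close> make the kernel 0
      at both points.\<close>
    case 1
    then show ?thesis by (auto simp: log_kernel_def)
  next
    case 2
    have "(\<lambda>k. 2 * u ^ (2 * k + 1) / real (2 * k + 1) / u) sums (ln ((1 + u) / (1 - u)) / u)"
      using 2 by (intro sums_divide ln_quotient_series) auto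
    also have "(\<lambda>k. 2 * u ^ (2 * k + 1) / real (2 * k + 1) / u) = (\<lambda>k. 2 / real (2 * k + 1) * u ^ (2 * k))"
      using 2 by (intro ext) (simp del: of_nat_add of_nat_mult of_nat_Suc)
    finally have s: "(\<lambda>k. 2 / real (2 * k + 1) * u ^ (2 * k)) sums (ln ((1 + u) / (1 - u)) / u)" .
    have "log_kernel u = ln ((1 + u) / (1 - u)) / u"
      using 2 by (auto simp: log_kernel_def field_simps)
    then have "ennreal (log_kernel u) = (\<Sum>k. ennreal (2 / real (2 * k + 1) * u ^ (2 * k)))"
      using 2 by (subst suminf_ennreal_eq[OF _ s]) auto
    also have "\<dots> = (\<Sum>k. ennreal (2 / real (2 * k + 1)) * ennreal (u ^ (2 * k)))"
      using 2 by (intro suminf_cong ennreal_mult) auto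
    finally show ?thesis using 2 by simp
  next
    case 3
    have eq: "(1 + 1 / u) / (1 - 1 / u) = (1 + u) / (u - 1)"
      using 3 by (simp add: field_simps)
    have "(\<lambda>k. 2 * (1 / u) ^ (2 * k + 1) / real (2 * k + 1) / u) sums (ln ((1 + u) / (u - 1)) / u)"
      using 3 ln_quotient_series[of "1 / u"] unfolding eq by (intro sums_divide) auto
    also have "(\<lambda>k. 2 * (1 / u) ^ (2 * k + 1) / real (2 * k + 1) / u) = (\<lambda>k. 2 / real (2 * k + 1) * (1 / u ^ (2 * k + 2)))"
      using 3 by (auto simp: field_simps power_one_over)
    finally have s: "(\<lambda>k. 2 / real (2 * k + 1) * (1 / u ^ (2 * k + 2))) sums (ln ((1 + u) / (u - 1)) / u)" .
    have "log_kernel u = ln ((1 + u) / (u - 1)) / u"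
      using 3 by (auto simp: log_kernel_def field_simps)
    then have "ennreal (log_kernel u) = (\<Sum>k. ennreal (2 / real (2 * k + 1) * (1 / u ^ (2 * k + 2))))"
      using 3 by (subst suminf_ennreal_eq[OF _ s]) auto
    also have "\<dots> = (\<Sum>k. ennreal (2 / real (2 * k + 1)) * ennreal (1 / u ^ (2 * k + 2)))"
      using 3 by (intro suminf_cong ennreal_mult) auto
    finally show ?thesis using 3 by simp
  qed
qed

lemma nn_integral_even:
  assumes [measurable]: "f \<in> borel_measurable borel" and ev: "\<And>x::real. f (- x) = f x"
  shows "(\<integral>\<^sup>+x. f x \<partial>lborel) = 2 * (\<integral>\<^sup>+x. f x * indicator {0..} x \<partial>lborel)"
proof -
  have "AE x in lborel. x \<noteq> (0::real)" by (rule AE_lborel_singleton)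
  then have "(\<integral>\<^sup>+x. f x \<partial>lborel) = (\<integral>\<^sup>+x. f x * indicator {0..} x + f x * indicator {..0} x \<partial>lborel)"
    by (intro nn_integral_cong_AE) (auto simp: indicator_def)
  also have "\<dots> = (\<integral>\<^sup>+x. f x * indicator {0..} x \<partial>lborel) + (\<integral>\<^sup>+x. f x * indicator {..0} x \<partial>lborel)"
    by (rule nn_integral_add) auto
  also have "(\<integral>\<^sup>+x. f x * indicator {..0} x \<partial>lborel) = (\<integral>\<^sup>+x. f x * indicator {0..} x \<partial>lborel)"
    by (subst nn_integral_real_affine[where c = "-1" and t = 0]) (auto simp: ev indicator_def intro!: nn_integral_cong)
  finally show ?thesis by (simp add: mult_2)
qed

text \<open>The k-th term contributes 2/(2k+1)^2 on [0, 1] and as much on [1, \<infinity>). The half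
  line thus gives 4 times \<open>sums_inverse_odd_squares\<close>, that is pi^2/2, and evenness
  doubles it.\<close>

lemma nn_integral_log_kernel: "(\<integral>\<^sup>+u. ennreal (log_kernel u) \<partial>lborel) \<le> ennreal (pi\<^sup>2)"
proof -
  let ?h = "\<lambda>k u::real. ennreal (u ^ (2 * k)) * indicator {0..1} u"
  let ?g = "\<lambda>k u::real. ennreal (1 / u ^ (2 * k + 2)) * indicator {1..} u"
  let ?c = "\<lambda>k. ennreal (2 / real (2 * k + 1))"
  have p1: "(\<integral>\<^sup>+u. ?h k u \<partial>lborel) = ennreal (1 / real (2 * k + 1))" for k
  proof -
    have "(\<integral>\<^sup>+u. ?h k u \<partial>lborel) =
        ennreal (1 ^ (2 * k + 1) / real (2 * k + 1) - 0 ^ (2 * k + 1) / real (2 * k + 1))"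
      by (intro nn_integral_FTC_Icc) (auto intro!: derivative_eq_intros simp del: power_Suc)
    then show ?thesis by simp
  qed
  have p2: "(\<integral>\<^sup>+u. ?g k u \<partial>lborel) = ennreal (1 / real (2 * k + 1))" for k
  proof -
    have lim: "((\<lambda>u::real. - 1 / (real (2 * k + 1) * u ^ (2 * k + 1))) \<longlongrightarrow> 0) at_top"
      by (intro tendsto_divide_0[OF tendsto_const] filterlim_at_top_imp_at_infinity
          filterlim_tendsto_pos_mult_at_top[OF tendsto_const] filterlim_pow_at_top filterlim_ident) auto
    have "((\<lambda>u. - 1 / (real (2 * k + 1) * u ^ (2 * k + 1))) has_real_derivative (1 / u ^ (2 * k + 2))) (at u)"
      if "1 \<le> u" for u :: real
    proof -
      have "((\<lambda>u. - 1 / (real (2 * k + 1) * u ^ Suc (2 * k))) has_real_derivative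
        real (2 * k + 1) * (real (Suc (2 * k)) * u ^ (2 * k)) / (real (2 * k + 1) * u ^ Suc (2 * k))\<^sup>2) (at u)"
        using that by (auto intro!: derivative_eq_intros simp: power2_eq_square simp del: power_Suc of_nat_Suc)
      also have "real (2 * k + 1) * (real (Suc (2 * k)) * u ^ (2 * k)) / (real (2 * k + 1) * u ^ Suc (2 * k))\<^sup>2 =
        1 / u ^ (2 * k + 2)"
        using that by (simp add: power_mult_distrib power2_eq_square del: of_nat_Suc)
      finally show ?thesis by simp
    qed
    then have "(\<integral>\<^sup>+u. ?g k u \<partial>lborel) =
        ennreal (0 - (- 1 / (real (2 * k + 1) * 1 ^ (2 * k + 1))))"
      using lim by (intro nn_integral_FTC_atLeast) auto
    then show ?thesis by simp
  qed
  have "(\<integral>\<^sup>+u. ennreal (log_kernel u) * indicator {0..} u \<partial>lborel) \<le>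
    (\<integral>\<^sup>+u. (\<Sum>k. ?c k * (?h k u
        + ?g k u)) \<partial>lborel)"
    using log_kernel_le_series by (intro nn_integral_mono) (auto simp: indicator_def)
  also have "\<dots> = (\<Sum>k. \<integral>\<^sup>+u. ?c k * (?h k u
        + ?g k u) \<partial>lborel)"
    by (intro nn_integral_suminf) measurable
  also have "\<dots> = (\<Sum>k. ennreal (4 * (1 / (2 * real k + 1)\<^sup>2)))"
  proof (intro suminf_cong)
    fix k
    have "(\<integral>\<^sup>+u. ?c k * (?h k u
        + ?g k u) \<partial>lborel)
      = ?c k * (ennreal (1 / real (2 * k + 1)) + ennreal (1 / real (2 * k + 1)))"
      unfolding p1[symmetric] p2[symmetric, simplified]
      apply (subst nn_integral_cmult) apply measurable
      apply (subst nn_integral_add)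
      apply (auto simp: p1 p2 simp del: power_Suc)
      using p1 p2 by simp
    also have "\<dots> = ennreal (4 * (1 / (2 * real k + 1)\<^sup>2))"
      by (simp add: ennreal_plus[symmetric] ennreal_mult[symmetric] power2_eq_square add.commute del: ennreal_plus)
    finally show "(\<integral>\<^sup>+u. ?c k * (?h k u
        + ?g k u) \<partial>lborel) = ennreal (4 * (1 / (2 * real k + 1)\<^sup>2))" .
  qed
  also have "\<dots> = ennreal (4 * (pi\<^sup>2 / 8))"
    by (intro suminf_ennreal_eq sums_mult sums_inverse_odd_squares) auto
  finally have h: "(\<integral>\<^sup>+u. ennreal (log_kernel u) * indicator {0..} u \<partial>lborel) \<le> ennreal (pi\<^sup>2 / 2)"
    by simp
  have ev: "log_kernel (- u) = log_kernel u" for u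
  proof (cases "u = 1 \<or> u = -1")
    case False
    then have "ln (\<bar>1 - u\<bar> / \<bar>1 + u\<bar>) = - ln (\<bar>1 + u\<bar> / \<bar>1 - u\<bar>)"
      by (subst (1 2) ln_div) auto
    then show ?thesis by (simp add: log_kernel_def)
  qed (auto simp: log_kernel_def)
  have "(\<integral>\<^sup>+u. ennreal (log_kernel u) \<partial>lborel) = 2 * (\<integral>\<^sup>+u. ennreal (log_kernel u) * indicator {0..} u \<partial>lborel)"
    by (intro nn_integral_even) (simp_all only: ev, simp add: log_kernel_def)
  also have "\<dots> \<le> 2 * ennreal (pi\<^sup>2 / 2)" by (intro mult_left_mono h) auto
  also have "\<dots> = ennreal (2 * (pi\<^sup>2 / 2))" by (subst ennreal_mult) auto
  finally show ?thesis by simp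
qed

text \<open>Substitution t = s u. The weight 1/|t| makes the integral invariant under scaling, so
  the bound is uniform in s, which is what the Schur test requires.\<close>

lemma nn_integral_log_kernel_scaled:
  assumes s: "s \<noteq> (0::real)"
  shows "(\<integral>\<^sup>+t. ennreal (\<bar>ln (\<bar>s + t\<bar> / \<bar>s - t\<bar>)\<bar> / \<bar>t\<bar>) \<partial>lborel) \<le> ennreal (pi\<^sup>2)"
proof -
  have "(\<integral>\<^sup>+t. ennreal (\<bar>ln (\<bar>s + t\<bar> / \<bar>s - t\<bar>)\<bar> / \<bar>t\<bar>) \<partial>lborel) =
    ennreal \<bar>s\<bar> * (\<integral>\<^sup>+u. ennreal (\<bar>ln (\<bar>s + (0 + s * u)\<bar> / \<bar>s - (0 + s * u)\<bar>)\<bar> / \<bar>0 + s * u\<bar>) \<partial>lborel)"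
    using s by (subst nn_integral_real_affine[where c = s and t = 0]) auto
  also have "\<dots> = (\<integral>\<^sup>+u. ennreal \<bar>s\<bar> * ennreal (\<bar>ln (\<bar>s + (0 + s * u)\<bar> / \<bar>s - (0 + s * u)\<bar>)\<bar> / \<bar>0 + s * u\<bar>) \<partial>lborel)"
    by (subst nn_integral_cmult) auto
  also have "\<dots> = (\<integral>\<^sup>+u. ennreal (log_kernel u) \<partial>lborel)"
  proof (intro nn_integral_cong)
    fix u :: real
    have "s + s * u = s * (1 + u)" "s - s * u = s * (1 - u)" by (auto simp: algebra_simps)
    then show "ennreal \<bar>s\<bar> * ennreal (\<bar>ln (\<bar>s + (0 + s * u)\<bar> / \<bar>s - (0 + s * u)\<bar>)\<bar> / \<bar>0 + s * u\<bar>) = ennreal (log_kernel u)"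
      using s by (simp add: ennreal_mult[symmetric] abs_mult log_kernel_def)
  qed
  finally show ?thesis using nn_integral_log_kernel by simp
qed

section \<open>The plane as a product, and the Fourier transform of Gaussians\<close>

lemma Basis_real2: "(Basis :: (real^2) set) = {axis 1 1, axis 2 1}"
  by (auto simp: Basis_vec_def UNIV_2)

lemma axis_12_neq: "(axis 1 1 :: real^2) \<noteq> axis 2 1"
  by (simp add: axis_eq_axis)

lemma vec2_measurable [measurable]:
  "f \<in> borel_measurable M \<Longrightarrow> g \<in> borel_measurable M \<Longrightarrow> (\<lambda>x. vector [f x, g x] :: real^2) \<in> borel_measurable M"
  unfolding vector_2_axis
  by (intro borel_measurable_add borel_measurable_scaleR borel_measurable_const)

lemma component_measurable [measurable]:
  "f \<in> borel_measurable M \<Longrightarrow> (\<lambda>x. (f x :: real^2) $ i) \<in> borel_measurable M"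
  by (rule measurable_compose[of _ _ borel]) (auto intro!: borel_measurable_continuous_onI continuous_intros)

lemma cis_measurable [measurable]:
  "f \<in> borel_measurable M \<Longrightarrow> (\<lambda>x. cis (f x)) \<in> borel_measurable M"
  by (rule measurable_compose[of _ _ borel]) (auto intro!: borel_measurable_continuous_onI continuous_intros)

text \<open>\<open>real^2\<close> is a function type over a two-element index type rather than a
  product, so iterated integrals are transported along \<open>vector [a, b]\<close>. The two
  measures agree on boxes.\<close>

lemma lborel_real2: "(lborel :: (real^2) measure) = distr (lborel \<Otimes>\<^sub>M lborel) borel (\<lambda>p. vector [fst p, snd p])"
proof (rule lborel_eqI)
  fix l u :: "real^2"
  assume a: "\<And>b. b \<in> Basis \<Longrightarrow> l \<bullet> b \<le> u \<bullet> b"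
  have le: "l $ 1 \<le> u $ 1" "l $ 2 \<le> u $ 2"
    using a[of "axis 1 1"] a[of "axis 2 1"] by (auto simp: Basis_real2 inner_axis)
  have "(\<lambda>p. vector [fst p, snd p] :: real^2) -` box l u \<inter> space (lborel \<Otimes>\<^sub>M lborel)
     = {l $ 1<..<u $ 1} \<times> {l $ 2<..<u $ 2}"
    by (auto simp: mem_box Basis_real2 inner_axis space_pair_measure)
  then show "emeasure (distr (lborel \<Otimes>\<^sub>M lborel) borel (\<lambda>p. vector [fst p, snd p] :: real^2)) (box l u) = (\<Prod>b\<in>Basis. (u - l) \<bullet> b)"
    using le by (simp add: emeasure_distr lborel.emeasure_pair_measure_Times Basis_real2 axis_12_neq inner_axis
       inner_diff_left ennreal_mult)
qed simp

lemma nn_integral_real2: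
  assumes [measurable]: "f \<in> borel_measurable borel"
  shows "(\<integral>\<^sup>+x. f x \<partial>lborel) = (\<integral>\<^sup>+a. \<integral>\<^sup>+b. f (vector [a, b] :: real^2) \<partial>lborel \<partial>lborel)"
  by (subst lborel_real2, subst nn_integral_distr) (auto simp: lborel.nn_integral_fst[symmetric])

lemma nn_integral_real2':
  assumes [measurable]: "f \<in> borel_measurable borel"
  shows "(\<integral>\<^sup>+x. f x \<partial>lborel) = (\<integral>\<^sup>+b. \<integral>\<^sup>+a. f (vector [a, b] :: real^2) \<partial>lborel \<partial>lborel)"
  unfolding nn_integral_real2[OF assms] by (rule lborel_pair.Fubini') measurable

lemma integrable_real2:
  fixes f :: "real^2 \<Rightarrow> 'b::{banach, second_countable_topology}"
  assumes "integrable lborel f"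
  shows "integrable (lborel \<Otimes>\<^sub>M lborel) (\<lambda>p. f (vector [fst p, snd p]))"
  using assms by (subst (asm) lborel_real2, subst (asm) integrable_distr_eq) auto

lemma integral_real2:
  fixes f :: "real^2 \<Rightarrow> 'b::{banach, second_countable_topology}"
  assumes "integrable lborel f"
  shows "(LINT x|lborel. f x) = (LINT a|lborel. LINT b|lborel. f (vector [a, b]))"
proof -
  have [measurable]: "f \<in> borel_measurable borel" using assms by auto
  show ?thesis
    using integrable_real2[OF assms]
    by (subst lborel_real2, subst integral_distr)
      (auto simp: lborel_pair.integral_fst'[symmetric])
qed

lemma integral_real2':
  fixes f :: "real^2 \<Rightarrow> 'b::{banach, second_countable_topology}"
  assumes "integrable lborel f"
  shows "(LINT x|lborel. f x) = (LINT b|lborel. LINT a|lborel. f (vector [a, b]))"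
  unfolding integral_real2[OF assms] using integrable_real2[OF assms]
  by (intro lborel_pair.Fubini_integral[symmetric]) (simp add: case_prod_beta')

lemma integrable_times_pair:
  fixes f :: "'a::euclidean_space \<Rightarrow> real" and g :: "'b::euclidean_space \<Rightarrow> real"
  assumes f: "integrable lborel f" and g: "integrable lborel g"
  shows "integrable (lborel \<Otimes>\<^sub>M lborel) (\<lambda>(x, y). f x * g y)"
proof -
  have [measurable]: "f \<in> borel_measurable borel" "g \<in> borel_measurable borel" using assms by auto
  show ?thesis
  proof (rule lborel_pair.Fubini_integrable)
    show "integrable lborel (\<lambda>x. LINT y|lborel. norm (case (x, y) of (x, y) \<Rightarrow> f x * g y))"
      using f by (simp add: abs_mult)
    show "AE x in lborel. integrable lborel (\<lambda>y. case (x, y) of (x, y) \<Rightarrow> f x * g y)"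
      using g by simp
  qed measurable
qed

lemma Fubini_bounded_by_product:
  fixes f :: "'a::euclidean_space \<Rightarrow> real" and g :: "'b::euclidean_space \<Rightarrow> real"
    and h :: "'a \<Rightarrow> 'b \<Rightarrow> complex"
  assumes f: "integrable lborel f" and g: "integrable lborel g"
    and h: "(\<lambda>(x, y). h x y) \<in> borel_measurable (lborel \<Otimes>\<^sub>M lborel)"
    and le: "\<And>x y. norm (h x y) \<le> f x * g y"
  shows "(LINT y|lborel. LINT x|lborel. h x y) = (LINT x|lborel. LINT y|lborel. h x y)"
proof (rule lborel_pair.Fubini_integral)
  have "norm (case p of (x, y) \<Rightarrow> h x y) \<le> norm (case p of (x, y) \<Rightarrow> f x * g y)" for p
    using le[of "fst p" "snd p"] by (auto simp: case_prod_beta)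
  then show "integrable (lborel \<Otimes>\<^sub>M lborel) (\<lambda>(x, y). h x y)"
    by (intro Bochner_Integration.integrable_bound[OF integrable_times_pair[OF f g] h]) auto
qed

text \<open>This is the characteristic function of the standard normal distribution in the variable
  sqrt 2 \<tau> a.\<close>

lemma gaussian_fourier:
  fixes \<tau> z :: real
  assumes \<tau>: "\<tau> > 0"
  shows "has_bochner_integral lborel (\<lambda>a. complex_of_real (exp (- (\<tau> * a)\<^sup>2)) * cis (- (a * z)))
    (complex_of_real (sqrt pi / \<tau> * exp (- (z / (2 * \<tau>))\<^sup>2)))"
proof -
  let ?e = "\<lambda>a. complex_of_real (exp (- (\<tau> * a)\<^sup>2))"
  let ?b = "complex_of_real (exp (- (- (1 / (sqrt 2 * \<tau>) * z))\<^sup>2 / 2))"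
  let ?s = "complex_of_real (sqrt (2 * pi))"
  let ?c = "1 / (sqrt 2 * \<tau>)"
  have c: "?c \<noteq> 0" "\<bar>?c\<bar> = ?c" using \<tau> by auto
  let ?g = "\<lambda>x. complex_of_real (std_normal_density x) * cis (- (?c * z) * x)"
  have "integrable std_normal_distribution (\<lambda>x. cis (- (?c * z) * x))"
    by (rule finite_measure.integrable_const_bound[where B = 1])
       (auto simp: prob_space.finite_measure prob_space_normal_density)
  then have int: "integrable lborel ?g"
    by (subst (asm) integrable_density) (auto simp: scaleR_conv_of_real)
  have "char std_normal_distribution (- (?c * z)) = (LINT x|lborel. ?g x)"
    unfolding char_def
    by (subst integral_density) (auto simp: scaleR_conv_of_real cis_conv_exp mult_ac)
  then have "(LINT x|lborel. ?g x) = ?b"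
    by (simp add: char_std_normal_distribution)
  with int have "has_bochner_integral lborel ?g (?b)"
    by (simp add: has_bochner_integral_iff)
  then have "has_bochner_integral lborel (\<lambda>a. ?g (0 + (sqrt 2 * \<tau>) * a)) (?b /\<^sub>R \<bar>sqrt 2 * \<tau>\<bar>)"
    using \<tau> by (subst (asm) lborel_has_bochner_integral_real_affine_iff[where c = "sqrt 2 * \<tau>" and t = 0]) auto
  then have "has_bochner_integral lborel (\<lambda>a. ?s * ?g (0 + (sqrt 2 * \<tau>) * a))
     (?s * (?b /\<^sub>R \<bar>sqrt 2 * \<tau>\<bar>))"
    by (rule has_bochner_integral_mult_right)
  moreover have "?s * ?g (0 + (sqrt 2 * \<tau>) * a) = ?e a * cis (- (a * z))" for a
  proof -
    have "sqrt (2 * pi) * std_normal_density (sqrt 2 * \<tau> * a) = exp (- (\<tau> * a)\<^sup>2)"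
      by (simp add: std_normal_density_def power_mult_distrib real_sqrt_mult)
    then have "?s * complex_of_real (std_normal_density (sqrt 2 * \<tau> * a)) = ?e a"
      by (simp only: of_real_mult[symmetric])
    moreover have "- (?c * z) * (sqrt 2 * \<tau> * a) = - (a * z)" using \<tau> by simp
    ultimately show ?thesis by (simp only: add_0 mult.assoc[symmetric])
  qed
  moreover have "?s * (?b /\<^sub>R \<bar>sqrt 2 * \<tau>\<bar>) =
     complex_of_real (sqrt pi / \<tau> * exp (- (z / (2 * \<tau>))\<^sup>2))"
  proof -
    have "(- (?c * z))\<^sup>2 / 2 = (z / (2 * \<tau>))\<^sup>2"
      using \<tau> by (simp add: power_divide power_mult_distrib)
    then have "- (- (?c * z))\<^sup>2 / 2 = - (z / (2 * \<tau>))\<^sup>2" by simp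
    then show ?thesis
      using \<tau> by (simp add: scaleR_conv_of_real real_sqrt_mult field_simps)
  qed
  ultimately show ?thesis by simp
qed

lemma integrable_gaussian_real2:
  fixes \<tau> :: real
  assumes \<tau>: "\<tau> > 0"
  shows "integrable lborel (\<lambda>\<xi>::real^2. exp (- (\<tau> * norm \<xi>)\<^sup>2))"
proof (rule integrableI_nonneg)
  have g: "(\<integral>\<^sup>+a. ennreal (exp (- (\<tau> * a)\<^sup>2)) \<partial>lborel) < \<infinity>"
  proof -
    have "integrable lborel (\<lambda>a. norm (complex_of_real (exp (- (\<tau> * a)\<^sup>2)) * cis (- (a * 0))))"
      using gaussian_fourier[OF \<tau>, of 0] by (intro integrable_norm) (auto simp: has_bochner_integral_iff)
    then have "integrable lborel (\<lambda>a. exp (- (\<tau> * a)\<^sup>2))" by simp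
    then show ?thesis by (simp add: integrable_iff_bounded)
  qed
  have "(\<integral>\<^sup>+(\<xi>::real^2). ennreal (exp (- (\<tau> * norm \<xi>)\<^sup>2)) \<partial>lborel) =
     (\<integral>\<^sup>+a. \<integral>\<^sup>+b. ennreal (exp (- (\<tau> * a)\<^sup>2)) * ennreal (exp (- (\<tau> * b)\<^sup>2)) \<partial>lborel \<partial>lborel)"
    by (subst nn_integral_real2)
      (auto simp: norm_2 power_mult_distrib distrib_left exp_add[symmetric] ennreal_mult[symmetric] intro!: nn_integral_cong)
  also have "\<dots> = (\<integral>\<^sup>+a. ennreal (exp (- (\<tau> * a)\<^sup>2)) \<partial>lborel) * (\<integral>\<^sup>+b. ennreal (exp (- (\<tau> * b)\<^sup>2)) \<partial>lborel)"
    by (simp add: nn_integral_cmult nn_integral_multc)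
  also have "\<dots> < \<infinity>" using g by (simp add: ennreal_mult_less_top)
  finally show "(\<integral>\<^sup>+(\<xi>::real^2). ennreal (exp (- (\<tau> * norm \<xi>)\<^sup>2)) \<partial>lborel) < \<infinity>" .
qed auto

lemma gaussian_fourier_real2:
  fixes \<tau> :: real and z :: "real^2"
  assumes \<tau>: "\<tau> > 0"
  shows "(LINT \<xi>|lborel. complex_of_real (exp (- (\<tau> * norm \<xi>)\<^sup>2)) * cis (- (\<xi> \<bullet> z)))
    = complex_of_real (pi / \<tau>\<^sup>2 * exp (- (norm z / (2 * \<tau>))\<^sup>2))"
proof -
  let ?e = "\<lambda>a. complex_of_real (exp (- (\<tau> * a)\<^sup>2))"
  let ?g = "\<lambda>w. exp (- (w / (2 * \<tau>))\<^sup>2)"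
  have i: "integrable lborel (\<lambda>\<xi>::real^2. ?e (norm \<xi>) * cis (- (\<xi> \<bullet> z)))"
    by (rule Bochner_Integration.integrable_bound[OF integrable_gaussian_real2[OF \<tau>]]) (auto simp: norm_mult)
  have G: "(LINT a|lborel. ?e a * cis (- (a * w))) = complex_of_real (sqrt pi / \<tau> * ?g (w))" for w
    using gaussian_fourier[OF \<tau>, of w] by (simp add: has_bochner_integral_iff)
  have "(LINT \<xi>|lborel. ?e (norm \<xi>) * cis (- (\<xi> \<bullet> z))) =
    (LINT a|lborel. LINT b|lborel. (?e a * cis (- (a * z $ 1))) *
       (?e b * cis (- (b * z $ 2))))"
    unfolding integral_real2[OF i]
  proof (intro Bochner_Integration.integral_cong refl)
    fix a b :: real
    have "(\<tau> * norm (vector [a, b] :: real^2))\<^sup>2 = (\<tau> * a)\<^sup>2 + (\<tau> * b)\<^sup>2"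
      by (simp add: norm_2 power_mult_distrib distrib_left)
    then show "complex_of_real (exp (- (\<tau> * norm (vector [a, b] :: real^2))\<^sup>2)) * cis (- (vector [a, b] \<bullet> z)) =
        (?e a * cis (- (a * z $ 1))) *
       (?e b * cis (- (b * z $ 2)))"
      by (simp add: inner_2 exp_diff exp_minus exp_add field_simps) (simp add: cis_mult)
  qed
  also have "\<dots> = complex_of_real (sqrt pi / \<tau> * ?g (z $ 1)) * complex_of_real (sqrt pi / \<tau> * ?g (z $ 2))"
    by (simp only: integral_mult_right_zero integral_mult_left_zero G)
  also have "\<dots> = complex_of_real (pi / \<tau>\<^sup>2 * ?g (norm z))"
  proof -
    have "(norm z / (2 * \<tau>))\<^sup>2 = (z $ 1 / (2 * \<tau>))\<^sup>2 + (z $ 2 / (2 * \<tau>))\<^sup>2"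
      by (simp add: norm_2 power_divide add_divide_distrib)
    then have "?g (norm z) = ?g (z $ 1) * ?g (z $ 2)"
      by (simp add: exp_add[symmetric])
    moreover have "sqrt pi / \<tau> * (sqrt pi / \<tau>) = pi / \<tau>\<^sup>2" by (simp add: power2_eq_square)
    ultimately have "sqrt pi / \<tau> * ?g (z $ 1) * (sqrt pi / \<tau> * ?g (z $ 2)) = pi / \<tau>\<^sup>2 * ?g (norm z)"
      by (simp add: mult_ac)
    then show ?thesis by (simp only: of_real_mult[symmetric])
  qed
  finally show ?thesis .
qed

section \<open>Coulomb energy of odd densities\<close>

lemma cnj_measurable [measurable]:
  "f \<in> borel_measurable M \<Longrightarrow> (\<lambda>x. cnj (f x)) \<in> borel_measurable M"
  by (rule measurable_compose[of _ _ borel]) (auto intro!: borel_measurable_continuous_onI continuous_intros)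

text \<open>Parseval with a Gaussian regulator. Since 1/|\<xi>| is not integrable over the plane,
  Fubini cannot be applied to it directly for integrable \<open>f\<close>. The Gaussian weight makes
  every exchange absolutely convergent, and its transform is again a Gaussian, in x - y.\<close>

lemma gaussian_weighted_fourier:
  fixes f :: "real^2 \<Rightarrow> real" and \<tau> :: real
  assumes f: "integrable lborel f" and \<tau>: "\<tau> > 0"
  defines "\<Phi> \<equiv> \<lambda>\<xi>. (LINT x|lborel. cis (- (\<xi> \<bullet> x)) * complex_of_real (f x))"
  shows "(\<integral>\<^sup>+\<xi>. ennreal (exp (- (\<tau> * norm \<xi>)\<^sup>2) * (cmod (\<Phi> \<xi>))\<^sup>2) \<partial>lborel) =
     ennreal (pi / \<tau>\<^sup>2 * (LINT x|lborel. f x * (LINT y|lborel. f y * exp (- (norm (x - y) / (2 * \<tau>))\<^sup>2))))"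
proof -
  let ?g = "\<lambda>z::real^2. exp (- (norm z / (2 * \<tau>))\<^sup>2)"
  let ?p = "\<lambda>\<xi> x. cis (- (\<xi> \<bullet> x)) * complex_of_real (f x)"
  let ?n = "\<lambda>\<xi> y. cis (\<xi> \<bullet> y) * complex_of_real (f y)"
  have [measurable]: "f \<in> borel_measurable borel" using f by auto
  define e where "e = (\<lambda>\<xi>::real^2. exp (- (\<tau> * norm \<xi>)\<^sup>2))"
  have [measurable]: "e \<in> borel_measurable borel" unfolding e_def by measurable
  have e0: "e \<xi> \<ge> 0" for \<xi> by (simp add: e_def)
  have ei: "integrable lborel e" unfolding e_def by (rule integrable_gaussian_real2[OF \<tau>])
  define C where "C = (LINT x|lborel. \<bar>f x\<bar>)"
  have [measurable]: "\<Phi> \<in> borel_measurable borel"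
    unfolding \<Phi>_def by measurable
  have \<Phi>C: "cmod (\<Phi> \<xi>) \<le> C" for \<xi>
  proof -
    have "cmod (\<Phi> \<xi>) \<le> (LINT x|lborel. norm (?p \<xi> x))"
      unfolding \<Phi>_def by (rule integral_norm_bound)
    then show ?thesis by (simp add: norm_mult C_def)
  qed
  have C0: "C \<ge> 0" unfolding C_def by simp
  have cnj: "cnj (\<Phi> \<xi>) = (LINT x|lborel. cis (\<xi> \<bullet> x) * complex_of_real (f x))" for \<xi>
  proof -
    have "cnj (\<Phi> \<xi>) = (LINT x|lborel. cnj (?p \<xi> x))"
      by (simp only: \<Phi>_def Bochner_Integration.integral_cnj)
    then show ?thesis by (simp only: complex_cnj_mult cis_cnj complex_cnj_complex_of_real minus_minus)
  qed
  have ie: "integrable lborel (\<lambda>\<xi>. e \<xi> * (cmod (\<Phi> \<xi>))\<^sup>2)"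
  proof (rule Bochner_Integration.integrable_bound[OF integrable_mult_right[OF ei, of "C\<^sup>2"]])
    show "AE \<xi> in lborel. norm (e \<xi> * (cmod (\<Phi> \<xi>))\<^sup>2) \<le> norm (C\<^sup>2 * e \<xi>)"
      using \<Phi>C e0 by (intro AE_I2) (auto simp: abs_mult mult.commute intro!: mult_left_mono power_mono)
  qed measurable
  have "complex_of_real (LINT \<xi>|lborel. e \<xi> * (cmod (\<Phi> \<xi>))\<^sup>2) = (LINT \<xi>|lborel. complex_of_real (e \<xi> * (cmod (\<Phi> \<xi>))\<^sup>2))"
    by (simp only: integral_complex_of_real)
  \<comment> \<open>The two factors of |\<Phi>|^2 are expanded one at a time:
    \<open>cnj (\<Phi> \<xi>)\<close> first stays as a bounded factor, so that each exchange
    involves two variables only.\<close>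
  also have "\<dots> = (LINT \<xi>|lborel. LINT x|lborel. complex_of_real (e \<xi>) * cnj (\<Phi> \<xi>) * (?p \<xi> x))"
  proof (intro Bochner_Integration.integral_cong refl)
    fix \<xi> :: "real^2"
    have "complex_of_real (e \<xi> * (cmod (\<Phi> \<xi>))\<^sup>2) = complex_of_real (e \<xi>) * cnj (\<Phi> \<xi>) * \<Phi> \<xi>"
      by (simp only: of_real_mult complex_norm_square) (simp add: mult_ac)
    also have "\<dots> = (LINT x|lborel. complex_of_real (e \<xi>) * cnj (\<Phi> \<xi>) * (?p \<xi> x))"
      by (simp only: integral_mult_right_zero) (simp add: \<Phi>_def)
    finally show "complex_of_real (e \<xi> * (cmod (\<Phi> \<xi>))\<^sup>2) = \<dots>" .
  qed
  also have "\<dots> = (LINT x|lborel. LINT \<xi>|lborel. complex_of_real (e \<xi>) * cnj (\<Phi> \<xi>) * (?p \<xi> x))"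
  proof (rule Fubini_bounded_by_product[where f = "\<lambda>x. C * \<bar>f x\<bar>" and g = e])
    show "norm (complex_of_real (e \<xi>) * cnj (\<Phi> \<xi>) * (?p \<xi> x)) \<le> C * \<bar>f x\<bar> * e \<xi>" for \<xi> x
      using mult_right_mono[OF \<Phi>C[of \<xi>], of "e \<xi> * \<bar>f x\<bar>"] e0[of \<xi>] by (simp add: norm_mult mult_ac)
  qed ((use f ei in simp)+, measurable)
  also have "\<dots> = (LINT x|lborel. complex_of_real (f x) * (LINT y|lborel. complex_of_real (f y) * complex_of_real (pi / \<tau>\<^sup>2 * ?g (x - y))))"
  proof (intro Bochner_Integration.integral_cong refl)
    fix x :: "real^2"
    have "(LINT \<xi>|lborel. complex_of_real (e \<xi>) * cnj (\<Phi> \<xi>) * (?p \<xi> x)) =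
      (LINT \<xi>|lborel. complex_of_real (f x) * (LINT y|lborel. complex_of_real (e \<xi>) * cis (- (\<xi> \<bullet> x)) * (?n \<xi> y)))"
    proof (rule Bochner_Integration.integral_cong[OF refl])
      fix \<xi> :: "real^2"
      show "complex_of_real (e \<xi>) * cnj (\<Phi> \<xi>) * (?p \<xi> x) =
        complex_of_real (f x) * (LINT y|lborel. complex_of_real (e \<xi>) * cis (- (\<xi> \<bullet> x)) * (?n \<xi> y))"
        unfolding cnj by (simp only: integral_mult_right_zero) (simp only: mult_ac)
    qed
    also have "\<dots> = complex_of_real (f x) * (LINT \<xi>|lborel. LINT y|lborel. complex_of_real (e \<xi>) * cis (- (\<xi> \<bullet> x)) * (?n \<xi> y))"
      by simp
    also have "(LINT \<xi>|lborel. LINT y|lborel. complex_of_real (e \<xi>) * cis (- (\<xi> \<bullet> x)) * (?n \<xi> y)) =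
       (LINT y|lborel. LINT \<xi>|lborel. complex_of_real (e \<xi>) * cis (- (\<xi> \<bullet> x)) * (?n \<xi> y))"
    proof (rule Fubini_bounded_by_product[where f = "\<lambda>x. \<bar>f x\<bar>" and g = e])
      show "norm (complex_of_real (e \<xi>) * cis (- (\<xi> \<bullet> x)) * (?n \<xi> y)) \<le> \<bar>f y\<bar> * e \<xi>" for \<xi> y
        using e0[of \<xi>] by (simp add: norm_mult mult_ac)
    qed ((use f ei in simp)+, measurable)
    also have "\<dots> = (LINT y|lborel. complex_of_real (f y) * complex_of_real (pi / \<tau>\<^sup>2 * ?g (x - y)))"
    proof (intro Bochner_Integration.integral_cong refl)
      fix y :: "real^2"
      have "(LINT \<xi>|lborel. complex_of_real (e \<xi>) * cis (- (\<xi> \<bullet> x)) * (?n \<xi> y)) =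
         (LINT \<xi>|lborel. complex_of_real (f y) * (complex_of_real (exp (- (\<tau> * norm \<xi>)\<^sup>2)) * cis (- (\<xi> \<bullet> (x - y)))))"
        by (intro Bochner_Integration.integral_cong refl)
          (simp add: e_def inner_diff_right cis_mult mult_ac) 
      also have "\<dots> = complex_of_real (f y) * complex_of_real (pi / \<tau>\<^sup>2 * ?g (x - y))"
        by (simp only: integral_mult_right_zero gaussian_fourier_real2[OF \<tau>])
      finally show "(LINT \<xi>|lborel. complex_of_real (e \<xi>) * cis (- (\<xi> \<bullet> x)) * (?n \<xi> y)) = \<dots>" .
    qed
    finally show "(LINT \<xi>|lborel. complex_of_real (e \<xi>) * cnj (\<Phi> \<xi>) * (?p \<xi> x)) = 
       complex_of_real (f x) * (LINT y|lborel. complex_of_real (f y) * complex_of_real (pi / \<tau>\<^sup>2 * ?g (x - y)))" .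
  qed
  also have "\<dots> = complex_of_real (LINT x|lborel. f x * (LINT y|lborel. f y * (pi / \<tau>\<^sup>2 * ?g (x - y))))"
    by (simp only: of_real_mult[symmetric] integral_complex_of_real)
  also have "(LINT x|lborel. f x * (LINT y|lborel. f y * (pi / \<tau>\<^sup>2 * ?g (x - y)))) =
    (LINT x|lborel. pi / \<tau>\<^sup>2 * (f x * (LINT y|lborel. f y * ?g (x - y))))"
  proof (intro Bochner_Integration.integral_cong refl)
    fix x
    have "(LINT y|lborel. f y * (pi / \<tau>\<^sup>2 * ?g (x - y))) =
       (LINT y|lborel. pi / \<tau>\<^sup>2 * (f y * ?g (x - y)))"
      by (intro Bochner_Integration.integral_cong refl) (simp add: mult_ac)
    then show "f x * (LINT y|lborel. f y * (pi / \<tau>\<^sup>2 * ?g (x - y))) =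
       pi / \<tau>\<^sup>2 * (f x * (LINT y|lborel. f y * ?g (x - y)))"
      by (simp only: integral_mult_right_zero) (simp add: mult_ac)
  qed
  also have "\<dots> = pi / \<tau>\<^sup>2 * (LINT x|lborel. f x * (LINT y|lborel. f y * ?g (x - y)))"
    by (simp only: integral_mult_right_zero)
  finally have "(LINT \<xi>|lborel. e \<xi> * (cmod (\<Phi> \<xi>))\<^sup>2) = \<dots>"
    by (simp only: of_real_eq_iff)
  moreover have "(\<integral>\<^sup>+\<xi>. ennreal (e \<xi> * (cmod (\<Phi> \<xi>))\<^sup>2) \<partial>lborel) = ennreal (LINT \<xi>|lborel. e \<xi> * (cmod (\<Phi> \<xi>))\<^sup>2)"
    using ie e0 by (intro nn_integral_eq_integral) auto
  ultimately show ?thesis by (simp add: e_def)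
qed

definition reflect2 :: "real^2 \<Rightarrow> real^2" where
  "reflect2 x = vector [x $ 1, - (x $ 2)]"

lemma reflect2_measurable [measurable]: "reflect2 \<in> borel_measurable borel"
  unfolding reflect2_def by measurable

lemma integral_reflect2:
  fixes f :: "real^2 \<Rightarrow> real"
  assumes f: "integrable lborel f" and f': "integrable lborel (\<lambda>x. f (reflect2 x))"
  shows "(LINT x|lborel. f (reflect2 x)) = (LINT x|lborel. f x)"
  unfolding integral_real2[OF f] integral_real2[OF f']
proof (rule Bochner_Integration.integral_cong[OF refl])
  fix a :: real
  show "(LINT b|lborel. f (reflect2 (vector [a, b]))) = (LINT b|lborel. f (vector [a, b]))"
    by (subst (2) lborel_integral_real_affine[where c = "-1" and t = 0]) (auto simp: reflect2_def)
qed

lemma nn_integral_gaussian_line: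
  fixes \<tau> s :: real
  assumes \<tau>: "\<tau> > 0"
  shows "(\<integral>\<^sup>+a. ennreal (exp (- ((s - a) / (2 * \<tau>))\<^sup>2)) \<partial>lborel) = ennreal (2 * \<tau> * sqrt pi)"
proof -
  have h: "has_bochner_integral lborel (\<lambda>a. complex_of_real (exp (- (1 * a)\<^sup>2)) * cis (- (a * 0)))
    (complex_of_real (sqrt pi / 1 * exp (- (0 / (2 * 1))\<^sup>2)))"
    by (rule gaussian_fourier) simp
  then have "integrable lborel (\<lambda>a. complex_of_real (exp (- a\<^sup>2)))"
    "complex_of_real (LINT a|lborel. exp (- a\<^sup>2)) = complex_of_real (sqrt pi)"
    by (simp_all add: has_bochner_integral_iff)
  then have i: "integrable lborel (\<lambda>a::real. exp (- a\<^sup>2))" "(LINT a|lborel. exp (- a\<^sup>2)) = sqrt pi"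
    by (simp_all only: complex_of_real_integrable_eq of_real_eq_iff)
  have "(\<integral>\<^sup>+a. ennreal (exp (- ((s - a) / (2 * \<tau>))\<^sup>2)) \<partial>lborel) =
    ennreal (2 * \<tau>) * (\<integral>\<^sup>+a. ennreal (exp (- ((s - (s + (- 2 * \<tau>) * a)) / (2 * \<tau>))\<^sup>2)) \<partial>lborel)"
    using \<tau> by (subst nn_integral_real_affine[where c = "- 2 * \<tau>" and t = s]) auto
  also have "(\<integral>\<^sup>+a. ennreal (exp (- ((s - (s + (- 2 * \<tau>) * a)) / (2 * \<tau>))\<^sup>2)) \<partial>lborel) = (\<integral>\<^sup>+a. ennreal (exp (- a\<^sup>2)) \<partial>lborel)"
    using \<tau> by (intro nn_integral_cong) simp
  also have "\<dots> = ennreal (sqrt pi)"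
    using i by (subst nn_integral_eq_integral) auto
  finally show ?thesis using \<tau> by (simp add: ennreal_mult)
qed

text \<open>Averaging the integral with its image under \<open>reflect2\<close> replaces the
  Gaussian by half the difference of its values at y and at the mirror point of y. This difference
  factorises: the first coordinate integrates to 2 \<tau> sqrt pi, and in the second one the bound
  A/|t| is inserted.\<close>

lemma odd_gaussian_potential:
  fixes f :: "real^2 \<Rightarrow> real" and \<tau> A :: real
  assumes f: "integrable lborel f" and \<tau>: "\<tau> > 0" and A: "A \<ge> 0"
    and odd: "\<And>x. f (reflect2 x) = - f x"
    and le: "\<And>x. \<bar>f x\<bar> \<le> A / \<bar>x $ 2\<bar>"
  shows "ennreal \<bar>LINT y|lborel. f y * exp (- (norm (x - y) / (2 * \<tau>))\<^sup>2)\<bar> \<le>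
    ennreal (A * \<tau> * sqrt pi) * (\<integral>\<^sup>+t. ennreal (\<bar>exp (- ((x $ 2 - t) / (2 * \<tau>))\<^sup>2) - exp (- ((x $ 2 + t) / (2 * \<tau>))\<^sup>2)\<bar> / \<bar>t\<bar>) \<partial>lborel)"
proof -
  let ?h = "\<lambda>s. exp (- (s / (2 * \<tau>))\<^sup>2)"
  have [measurable]: "f \<in> borel_measurable borel" using f by auto
  define G where "G = (\<lambda>x y::real^2. exp (- (norm (x - y) / (2 * \<tau>))\<^sup>2))"
  define E where "E = (\<lambda>t. \<bar>?h (x $ 2 - t) - ?h (x $ 2 + t)\<bar>)"
  have [measurable]: "G x \<in> borel_measurable borel" unfolding G_def by measurable
  have i1: "integrable lborel (\<lambda>y. f y * G x y)"
    by (rule Bochner_Integration.integrable_bound[OF f]) (auto simp: G_def abs_mult mult_left_le)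
  have i2: "integrable lborel (\<lambda>y. f y * G x (reflect2 y))"
    by (rule Bochner_Integration.integrable_bound[OF f]) (auto simp: G_def abs_mult mult_left_le)
  have i2': "integrable lborel (\<lambda>y. f (reflect2 y) * G x (reflect2 y))"
    using i2 by (simp add: odd)
  have key: "ennreal (norm (f y * (G x y - G x (reflect2 y)))) \<le> ennreal (?h (x $ 1 - y $ 1)) * ennreal (A / \<bar>y $ 2\<bar> * E (y $ 2))" for y
  proof -
    have sp: "?h (norm w) = ?h (w $ 1) * ?h (w $ 2)" for w :: "real^2"
      by (simp add: exp_add[symmetric] norm_2 power_divide add_divide_distrib)
    have "\<bar>G x y - G x (reflect2 y)\<bar> = ?h (x $ 1 - y $ 1) * E (y $ 2)"
      by (simp add: G_def sp reflect2_def E_def right_diff_distrib[symmetric] abs_mult)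
    then have "norm (f y * (G x y - G x (reflect2 y))) \<le> (A / \<bar>y $ 2\<bar>) * (?h (x $ 1 - y $ 1) * E (y $ 2))"
      unfolding real_norm_def abs_mult using le[of y] by (simp only:) (intro mult_right_mono, auto simp: E_def)
    then show ?thesis
      using A by (subst ennreal_mult[symmetric]) (auto simp: E_def mult_ac intro!: ennreal_leI)
  qed
  have "(LINT y|lborel. f y * G x y) = (LINT y|lborel. f (reflect2 y) * G x (reflect2 y))"
    using integral_reflect2[OF i1 i2'] by simp
  then have "(LINT y|lborel. f y * G x y) + (LINT y|lborel. f y * G x y) = (LINT y|lborel. f y * G x y) + (LINT y|lborel. - (f y * G x (reflect2 y)))"
    by (simp add: odd)
  also have "\<dots> = (LINT y|lborel. f y * (G x y - G x (reflect2 y)))"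
    using i1 i2 by (subst Bochner_Integration.integral_add[symmetric]) (auto simp: algebra_simps)
  finally have "(LINT y|lborel. f y * G x y) = (LINT y|lborel. f y * (G x y - G x (reflect2 y))) / 2" by simp
  also have "ennreal \<bar>\<dots>\<bar> = ennreal (1 / 2) * ennreal (norm (LINT y|lborel. f y * (G x y - G x (reflect2 y))))"
    by (subst ennreal_mult[symmetric]) auto
  also have "\<dots> \<le> ennreal (1 / 2) * (\<integral>\<^sup>+y. ennreal (norm (f y * (G x y - G x (reflect2 y)))) \<partial>lborel)"
  proof (intro mult_left_mono integral_norm_bound_ennreal)
    show "integrable lborel (\<lambda>y. f y * (G x y - G x (reflect2 y)))"
      using i1 i2 by (simp add: right_diff_distrib)
  qed auto
  also have "\<dots> \<le> ennreal (1 / 2) * (\<integral>\<^sup>+(y::real^2). ennreal (?h (x $ 1 - y $ 1)) * ennreal (A / \<bar>y $ 2\<bar> * E (y $ 2)) \<partial>lborel)"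
    by (intro mult_left_mono nn_integral_mono key) auto
  also have "(\<integral>\<^sup>+(y::real^2). ennreal (?h (x $ 1 - y $ 1)) * ennreal (A / \<bar>y $ 2\<bar> * E (y $ 2)) \<partial>lborel) =
     (\<integral>\<^sup>+t. \<integral>\<^sup>+a. ennreal (?h (x $ 1 - a)) * ennreal (A / \<bar>t\<bar> * E t) \<partial>lborel \<partial>lborel)"
    by (subst nn_integral_real2') (auto simp: E_def)
  also have "\<dots> = (\<integral>\<^sup>+t. ennreal (2 * \<tau> * sqrt pi) * ennreal (A / \<bar>t\<bar> * E t) \<partial>lborel)"
    by (simp add: nn_integral_multc nn_integral_gaussian_line[OF \<tau>])
  also have "\<dots> = (\<integral>\<^sup>+t. ennreal (2 * \<tau> * sqrt pi * A) * ennreal (E t / \<bar>t\<bar>) \<partial>lborel)"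
    using A \<tau> by (intro nn_integral_cong) (simp add: ennreal_mult[symmetric] E_def mult_ac)
  also have "\<dots> = ennreal (2 * \<tau> * sqrt pi * A) * (\<integral>\<^sup>+t. ennreal (E t / \<bar>t\<bar>) \<partial>lborel)"
    by (rule nn_integral_cmult) (simp add: E_def)
  also have "ennreal (1 / 2) * \<dots> = ennreal (A * \<tau> * sqrt pi) * (\<integral>\<^sup>+t. ennreal (E t / \<bar>t\<bar>) \<partial>lborel)"
    using A \<tau> by (subst mult.assoc[symmetric], subst ennreal_mult[symmetric]) (auto simp: mult_ac)
  finally show ?thesis by (simp add: G_def E_def)
qed

text \<open>For \<tau> > 0 the sign of the difference does not depend on \<tau>, so the absolute
  value can be resolved before applying Frullani; the factors 1/2 cancel in the quotient.\<close>

lemma nn_integral_gaussian_difference: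
  fixes s t :: real
  assumes "s \<noteq> t" "s \<noteq> - t"
  shows "(\<integral>\<^sup>+\<tau>. ennreal (\<bar>exp (- ((s - t) / (2 * \<tau>))\<^sup>2) - exp (- ((s + t) / (2 * \<tau>))\<^sup>2)\<bar> / \<tau>) * indicator {0<..} \<tau> \<partial>lborel)
    = ennreal \<bar>ln (\<bar>s + t\<bar> / \<bar>s - t\<bar>)\<bar>"
proof -
  let ?h = "\<lambda>s \<tau>. exp (- (s / (2 * \<tau>))\<^sup>2)"
  let ?k = "\<lambda>s \<tau>. exp (- (\<bar>s\<bar> / 2 / \<tau>)\<^sup>2)"
  have *: "(\<integral>\<^sup>+\<tau>. ennreal (\<bar>?h u \<tau> - ?h w \<tau>\<bar> / \<tau>) * indicator {0<..} \<tau> \<partial>lborel)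
    = ennreal \<bar>ln (\<bar>w\<bar> / \<bar>u\<bar>)\<bar>" if "u \<noteq> 0" "w \<noteq> 0" "\<bar>u\<bar> \<le> \<bar>w\<bar>" for u w :: real
  proof -
    have e: "?h u \<tau> = ?k u \<tau>" for u \<tau> :: real
      by (simp add: power_divide power_mult_distrib)
    have "(\<integral>\<^sup>+\<tau>. ennreal (\<bar>?h u \<tau> - ?h w \<tau>\<bar> / \<tau>) * indicator {0<..} \<tau> \<partial>lborel)
      = (\<integral>\<^sup>+\<tau>. ennreal ((?k u \<tau> - ?k w \<tau>) / \<tau>) * indicator {0<..} \<tau> \<partial>lborel)"
    proof (intro nn_integral_cong)
      fix \<tau> :: real
      have "(\<bar>u\<bar> / 2 / \<tau>)\<^sup>2 \<le> (\<bar>w\<bar> / 2 / \<tau>)\<^sup>2" if "\<tau> > 0"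
        using that \<open>\<bar>u\<bar> \<le> \<bar>w\<bar>\<close> by (intro power_mono divide_right_mono) auto
      then show "ennreal (\<bar>?h u \<tau> - ?h w \<tau>\<bar> / \<tau>) * indicator {0<..} \<tau> =
        ennreal ((?k u \<tau> - ?k w \<tau>) / \<tau>) * indicator {0<..} \<tau>"
        unfolding e by (auto simp: indicator_def)
    qed
    also have "\<dots> = ennreal (ln ((\<bar>w\<bar> / 2) / (\<bar>u\<bar> / 2)))"
      using that by (intro frullani_gaussian) auto
    finally show ?thesis using that by simp
  qed
  show ?thesis
  proof (cases "\<bar>s - t\<bar> \<le> \<bar>s + t\<bar>")
    case True
    then show ?thesis using assms by (intro *) auto
  next
    case False
    have "\<bar>ln (\<bar>s + t\<bar> / \<bar>s - t\<bar>)\<bar> = \<bar>ln (\<bar>s - t\<bar> / \<bar>s + t\<bar>)\<bar>"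
      using assms by (subst (1 2) ln_div) auto
    then show ?thesis using False assms *[of "s + t" "s - t"] by (simp add: abs_minus_commute)
  qed
qed

text \<open>
  Writing \<open>1 / |\<xi>|\<close> as a superposition of Gaussians turns the left-hand side into the Coulomb energy
  of \<open>f\<close>.  Reflecting in \<open>x\<^sub>2\<close> makes the kernel integrable along lines parallel to the axis of
  antisymmetry; the potential is then bounded by a constant, in a Schur test with weight \<open>1 / |x\<^sub>2|\<close>.
\<close>
theorem coulomb_energy_odd_le:
  fixes f :: "real^2 \<Rightarrow> real" and A :: real
  assumes f: "integrable lborel f" and A: "A \<ge> 0"
    and odd: "\<And>x. f (reflect2 x) = - f x"
    and le: "\<And>x. \<bar>f x\<bar> \<le> A / \<bar>x $ 2\<bar>"
  shows "(\<integral>\<^sup>+\<xi>. ennreal (1 / norm \<xi> * (cmod (LINT x|lborel. cis (- (\<xi> \<bullet> x)) * complex_of_real (f x)))\<^sup>2) \<partial>lborel)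
    \<le> ennreal (2 * pi ^ 3 * A) * (\<integral>\<^sup>+x. ennreal \<bar>f x\<bar> \<partial>lborel)"
proof -
  let ?E = "\<lambda>\<Phi> \<tau> \<xi>. ennreal (2 / sqrt pi) * indicator {0..} \<tau> * ennreal (exp (- (\<tau> * norm \<xi>)\<^sup>2) * (cmod (\<Phi> \<xi>))\<^sup>2)"
  let ?k = "\<lambda>D \<tau> s t. ennreal (D \<tau> s t / \<tau>) * indicator {0<..} \<tau> * ennreal (1 / \<bar>t::real\<bar>)"
  let ?f = "\<lambda>x. ennreal (2 * pi * A * \<bar>f x\<bar>)"
  have [measurable]: "f \<in> borel_measurable borel" using f by auto
  define \<Phi> where "\<Phi> = (\<lambda>\<xi>. (LINT x|lborel. cis (- (\<xi> \<bullet> x)) * complex_of_real (f x)))"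
  have [measurable]: "\<Phi> \<in> borel_measurable borel"
    unfolding \<Phi>_def by measurable
  define D where "D = (\<lambda>\<tau> s t::real. \<bar>exp (- ((s - t) / (2 * \<tau>))\<^sup>2) - exp (- ((s + t) / (2 * \<tau>))\<^sup>2)\<bar>)"
  have D0: "D \<tau> s t \<ge> 0" for \<tau> s t by (simp add: D_def)
  have Dm [measurable]: "(\<lambda>x. D (a x) (b x) (c x)) \<in> borel_measurable M"
    if [measurable]: "a \<in> borel_measurable M" "b \<in> borel_measurable M" "c \<in> borel_measurable M" for a b c :: "_ \<Rightarrow> real" and M
    unfolding D_def by measurable
  \<comment> \<open>1/|\<xi>| is 2/sqrt pi times the integral of exp(-(\<tau> |\<xi>|)^2) over
    \<tau> \<ge> 0. At \<xi> = 0 the left side is 0 by division by zero, so an inequality is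
    stated.\<close>
  have "(\<integral>\<^sup>+\<xi>. ennreal (1 / norm \<xi> * (cmod (\<Phi> \<xi>))\<^sup>2) \<partial>lborel) \<le>
    (\<integral>\<^sup>+\<xi>. \<integral>\<^sup>+\<tau>. ?E \<Phi> \<tau> \<xi> \<partial>lborel \<partial>lborel)"
  proof (intro nn_integral_mono)
    fix \<xi> :: "real^2"
    show "ennreal (1 / norm \<xi> * (cmod (\<Phi> \<xi>))\<^sup>2) \<le>
      (\<integral>\<^sup>+\<tau>. ?E \<Phi> \<tau> \<xi> \<partial>lborel)"
    proof (cases "\<xi> = 0")
      case False
      have "(\<integral>\<^sup>+\<tau>. ?E \<Phi> \<tau> \<xi> \<partial>lborel) =
        (\<integral>\<^sup>+\<tau>. (ennreal (2 / sqrt pi) * ennreal ((cmod (\<Phi> \<xi>))\<^sup>2)) * (ennreal (exp (- (\<tau>\<^sup>2 * (norm \<xi>)\<^sup>2))) * indicator {0..} \<tau>) \<partial>lborel)"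
        by (intro nn_integral_cong) (simp add: ennreal_mult power_mult_distrib mult_ac)
      also have "\<dots> = (ennreal (2 / sqrt pi) * ennreal ((cmod (\<Phi> \<xi>))\<^sup>2)) * ennreal (sqrt pi / (2 * norm \<xi>))"
        using False by (subst nn_integral_cmult) (auto simp: nn_integral_gaussian_half_line)
      also have "\<dots> = ennreal (1 / norm \<xi> * (cmod (\<Phi> \<xi>))\<^sup>2)"
        by (simp add: ennreal_mult[symmetric])
      finally show ?thesis by simp
    qed simp
  qed
  also have "\<dots> = (\<integral>\<^sup>+\<tau>. \<integral>\<^sup>+\<xi>. ?E \<Phi> \<tau> \<xi> \<partial>lborel \<partial>lborel)"
    by (rule lborel_pair.Fubini') measurable
  \<comment> \<open>For fixed \<tau> the constants combine to 2/sqrt pi * pi/\<tau>^2 * A \<tau>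
    sqrt pi = 2 pi A/\<tau>, which leaves exactly the weight 1/\<tau> of Frullani's
    integral.\<close>
  also have "\<dots> \<le> (\<integral>\<^sup>+\<tau>. \<integral>\<^sup>+x. ?f x * (\<integral>\<^sup>+t. ?k D \<tau> (x $ 2) t \<partial>lborel) \<partial>lborel \<partial>lborel)"
  proof (rule nn_integral_mono_AE)
    have "AE \<tau> in lborel. \<tau> \<noteq> (0::real)" by (rule AE_lborel_singleton)
    then show "AE \<tau> in lborel. (\<integral>\<^sup>+\<xi>. ?E \<Phi> \<tau> \<xi> \<partial>lborel) \<le>
       (\<integral>\<^sup>+x. ?f x * (\<integral>\<^sup>+t. ?k D \<tau> (x $ 2) t \<partial>lborel) \<partial>lborel)"
    proof (rule AE_mp, intro AE_I2 impI)
      fix \<tau> :: real assume "\<tau> \<noteq> 0"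
      show "(\<integral>\<^sup>+\<xi>. ?E \<Phi> \<tau> \<xi> \<partial>lborel) \<le>
       (\<integral>\<^sup>+x. ?f x * (\<integral>\<^sup>+t. ?k D \<tau> (x $ 2) t \<partial>lborel) \<partial>lborel)"
      proof (cases "\<tau> > 0")
        case True
        define h where "h = (\<lambda>x. LINT y|lborel. f y * exp (- (norm (x - y) / (2 * \<tau>))\<^sup>2))"
        have [measurable]: "h \<in> borel_measurable borel" unfolding h_def by measurable
        have hle: "ennreal \<bar>h x\<bar> \<le> ennreal (A * \<tau> * sqrt pi) * (\<integral>\<^sup>+t. ennreal (D \<tau> (x $ 2) t / \<bar>t\<bar>) \<partial>lborel)" for x
          unfolding h_def D_def by (rule odd_gaussian_potential[OF f True A odd le])
        have "(\<integral>\<^sup>+\<xi>. ?E \<Phi> \<tau> \<xi> \<partial>lborel) =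
          ennreal (2 / sqrt pi) * ennreal (pi / \<tau>\<^sup>2 * (LINT x|lborel. f x * h x))"
          using True gaussian_weighted_fourier[OF f True] by (subst nn_integral_cmult) (auto simp: \<Phi>_def h_def)
        also have "\<dots> \<le> ennreal (2 / sqrt pi) * (ennreal (pi / \<tau>\<^sup>2) * (\<integral>\<^sup>+x. ennreal \<bar>f x * h x\<bar> \<partial>lborel))"
        proof (intro mult_left_mono)
          have "ennreal (LINT x|lborel. f x * h x) \<le> (\<integral>\<^sup>+x. ennreal \<bar>f x * h x\<bar> \<partial>lborel)"
          proof (cases "integrable lborel (\<lambda>x. f x * h x)")
            case True
            have "ennreal (LINT x|lborel. f x * h x) \<le> ennreal (norm (LINT x|lborel. f x * h x))"
              by (intro ennreal_leI) auto
            also have "\<dots> \<le> (\<integral>\<^sup>+x. ennreal (norm (f x * h x)) \<partial>lborel)"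
              by (rule integral_norm_bound_ennreal[OF True])
            finally show ?thesis by simp
          qed (simp add: not_integrable_integral_eq)
          then show "ennreal (pi / \<tau>\<^sup>2 * (LINT x|lborel. f x * h x)) \<le> ennreal (pi / \<tau>\<^sup>2) * (\<integral>\<^sup>+x. ennreal \<bar>f x * h x\<bar> \<partial>lborel)"
            by (subst ennreal_mult') (auto intro!: mult_left_mono)
        qed auto
        also have "\<dots> = (\<integral>\<^sup>+x. ennreal (2 / sqrt pi * (pi / \<tau>\<^sup>2) * \<bar>f x\<bar>) * ennreal \<bar>h x\<bar> \<partial>lborel)"
          by (subst mult.assoc[symmetric], subst nn_integral_cmult[symmetric])
            (auto simp: ennreal_mult[symmetric] abs_mult mult_ac)
        also have "\<dots> \<le> (\<integral>\<^sup>+x. ennreal (2 / sqrt pi * (pi / \<tau>\<^sup>2) * \<bar>f x\<bar>) * (ennreal (A * \<tau> * sqrt pi) * (\<integral>\<^sup>+t. ennreal (D \<tau> (x $ 2) t / \<bar>t\<bar>) \<partial>lborel)) \<partial>lborel)"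
          by (intro nn_integral_mono mult_left_mono hle) auto
        also have "\<dots> = (\<integral>\<^sup>+x. ?f x * (ennreal (1 / \<tau>) * (\<integral>\<^sup>+t. ennreal (D \<tau> (x $ 2) t / \<bar>t\<bar>) \<partial>lborel)) \<partial>lborel)"
        proof (intro nn_integral_cong)
          fix x :: "real^2"
          have "2 / sqrt pi * (pi / \<tau>\<^sup>2) * \<bar>f x\<bar> * (A * \<tau> * sqrt pi) = 2 * pi * A * \<bar>f x\<bar> * (1 / \<tau>)"
            using True by (simp add: power2_eq_square)
          then have "ennreal (2 / sqrt pi * (pi / \<tau>\<^sup>2) * \<bar>f x\<bar>) * ennreal (A * \<tau> * sqrt pi) = ?f x * ennreal (1 / \<tau>)"
            using True A by (subst (1 2) ennreal_mult[symmetric]) auto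
          then show "ennreal (2 / sqrt pi * (pi / \<tau>\<^sup>2) * \<bar>f x\<bar>) * (ennreal (A * \<tau> * sqrt pi) * (\<integral>\<^sup>+t. ennreal (D \<tau> (x $ 2) t / \<bar>t\<bar>) \<partial>lborel)) =
             ?f x * (ennreal (1 / \<tau>) * (\<integral>\<^sup>+t. ennreal (D \<tau> (x $ 2) t / \<bar>t\<bar>) \<partial>lborel))"
            by (simp only: mult.assoc[symmetric])
        qed
        also have "\<dots> = (\<integral>\<^sup>+x. ?f x * (\<integral>\<^sup>+t. ?k D \<tau> (x $ 2) t \<partial>lborel) \<partial>lborel)"
        proof (intro nn_integral_cong arg_cong2[of _ _ _ _ "(*)"] refl)
          fix x :: "real^2"
          show "ennreal (1 / \<tau>) * (\<integral>\<^sup>+t. ennreal (D \<tau> (x $ 2) t / \<bar>t\<bar>) \<partial>lborel) = (\<integral>\<^sup>+t. ?k D \<tau> (x $ 2) t \<partial>lborel)"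
            using True D0 by (subst nn_integral_cmult[symmetric]) (auto simp: ennreal_mult[symmetric] mult_ac intro!: nn_integral_cong)
        qed
        finally show ?thesis .
      next
        case False
        then show ?thesis using \<open>\<tau> \<noteq> 0\<close> by simp
      qed
    qed
  qed
  also have "\<dots> = (\<integral>\<^sup>+x. \<integral>\<^sup>+\<tau>. ?f x * (\<integral>\<^sup>+t. ?k D \<tau> (x $ 2) t \<partial>lborel) \<partial>lborel \<partial>lborel)"
    by (rule lborel_pair.Fubini') measurable
  \<comment> \<open>For each x the \<tau>-integral produces the logarithm and the t-integral is then
    at most pi^2, uniformly in x.\<close>
  also have "\<dots> \<le> (\<integral>\<^sup>+x. ?f x * ennreal (pi\<^sup>2) \<partial>lborel)"
  proof (intro nn_integral_mono)
    fix x :: "real^2"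
    show "(\<integral>\<^sup>+\<tau>. ?f x * (\<integral>\<^sup>+t. ?k D \<tau> (x $ 2) t \<partial>lborel) \<partial>lborel)
       \<le> ?f x * ennreal (pi\<^sup>2)"
    proof (cases "x $ 2 = 0")
      \<comment> \<open>On the axis of reflection \<open>nn_integral_log_kernel_scaled\<close> does
        not apply, but there oddness forces \<open>f x = 0\<close>.\<close>
      case True
      then have "reflect2 x = x" by (simp add: reflect2_def vec_eq_iff forall_2)
      then have "f x = 0" using odd[of x] by simp
      then show ?thesis by simp
    next
      case False
      have "(\<integral>\<^sup>+\<tau>. ?f x * (\<integral>\<^sup>+t. ?k D \<tau> (x $ 2) t \<partial>lborel) \<partial>lborel) =
        ?f x * (\<integral>\<^sup>+\<tau>. (\<integral>\<^sup>+t. ?k D \<tau> (x $ 2) t \<partial>lborel) \<partial>lborel)"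
        by (rule nn_integral_cmult) measurable
      also have "(\<integral>\<^sup>+\<tau>. (\<integral>\<^sup>+t. ?k D \<tau> (x $ 2) t \<partial>lborel) \<partial>lborel) =
        (\<integral>\<^sup>+t. (\<integral>\<^sup>+\<tau>. ?k D \<tau> (x $ 2) t \<partial>lborel) \<partial>lborel)"
        by (rule lborel_pair.Fubini') measurable
      also have "\<dots> = (\<integral>\<^sup>+t. (\<integral>\<^sup>+\<tau>. ennreal (D \<tau> (x $ 2) t / \<tau>) * indicator {0<..} \<tau> \<partial>lborel) * ennreal (1 / \<bar>t\<bar>) \<partial>lborel)"
        by (intro nn_integral_cong nn_integral_multc) measurable
      also have "\<dots> = (\<integral>\<^sup>+t. ennreal (\<bar>ln (\<bar>x $ 2 + t\<bar> / \<bar>x $ 2 - t\<bar>)\<bar> / \<bar>t\<bar>) \<partial>lborel)"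
      proof (rule nn_integral_cong_AE)
        have "AE t in lborel. t \<noteq> x $ 2" "AE t in lborel. t \<noteq> - (x $ 2)"
          by (rule AE_lborel_singleton)+
        then show "AE t in lborel. (\<integral>\<^sup>+\<tau>. ennreal (D \<tau> (x $ 2) t / \<tau>) * indicator {0<..} \<tau> \<partial>lborel) * ennreal (1 / \<bar>t\<bar>) =
           ennreal (\<bar>ln (\<bar>x $ 2 + t\<bar> / \<bar>x $ 2 - t\<bar>)\<bar> / \<bar>t\<bar>)"
          unfolding D_def
        proof eventually_elim
          case (elim t)
          then have "x $ 2 \<noteq> t" "x $ 2 \<noteq> - t" by auto
          from nn_integral_gaussian_difference[OF this] show ?case
            by (simp add: ennreal_mult[symmetric])
        qed
      qed
      also have "\<dots> \<le> ennreal (pi\<^sup>2)" by (rule nn_integral_log_kernel_scaled[OF False])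
      finally show ?thesis by (simp add: mult_left_mono)
    qed
  qed
  also have "\<dots> = (\<integral>\<^sup>+x. ennreal (2 * pi ^ 3 * A) * ennreal \<bar>f x\<bar> \<partial>lborel)"
    using A by (intro nn_integral_cong) (simp add: ennreal_mult[symmetric] power2_eq_square power3_eq_cube mult_ac)
  also have "\<dots> = ennreal (2 * pi ^ 3 * A) * (\<integral>\<^sup>+x. ennreal \<bar>f x\<bar> \<partial>lborel)"
    by (rule nn_integral_cmult) measurable
  finally show ?thesis by (simp add: \<Phi>_def)
qed

section \<open>Calculus in the plane\<close>

text \<open>The gradient is carried as two numbers, so that all derivatives of the field become
  explicit scalar formulas and \<open>frechet_derivative\<close> disappears.\<close>

definition has_grad :: "(real^2 \<Rightarrow> real) \<Rightarrow> real \<Rightarrow> real \<Rightarrow> real^2 \<Rightarrow> bool" where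
  "has_grad f a b x \<longleftrightarrow> (f has_derivative (\<lambda>h. a * h $ 1 + b * h $ 2)) (at x)"

lemma has_derivative_vec_nth [derivative_intros]:
  "((\<lambda>x::real^'n. x $ i) has_derivative (\<lambda>h. h $ i)) (at x within S)"
  by (rule bounded_linear_imp_has_derivative) (rule bounded_linear_vec_nth)

lemma vector_3_axis: "(vector [a, b, c] :: real^3) = a *\<^sub>R axis 1 1 + b *\<^sub>R axis 2 1 + c *\<^sub>R axis 3 1"
  by (simp add: vec_eq_iff forall_3 axis_def)

lemma has_derivative_vector_3:
  assumes "has_grad f1 a1 b1 x" "has_grad f2 a2 b2 x" "has_grad f3 a3 b3 x"
  shows "((\<lambda>x. vector [f1 x, f2 x, f3 x] :: real^3) has_derivative
    (\<lambda>h. vector [a1 * h $ 1 + b1 * h $ 2, a2 * h $ 1 + b2 * h $ 2, a3 * h $ 1 + b3 * h $ 2])) (at x)"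
  unfolding vector_3_axis
  by (intro has_derivative_add has_derivative_scaleR_left assms[unfolded has_grad_def])

lemma norm_3: "norm (x :: real^3) = sqrt ((x $ 1)\<^sup>2 + (x $ 2)\<^sup>2 + (x $ 3)\<^sup>2)"
  by (simp add: norm_vec_def L2_set_def sum_3)

lemma grad_sq_vector_3:
  assumes "has_grad f1 a1 b1 x" "has_grad f2 a2 b2 x" "has_grad f3 a3 b3 x"
  shows "grad_sq (\<lambda>x. vector [f1 x, f2 x, f3 x] :: real^3) x = a1\<^sup>2 + b1\<^sup>2 + a2\<^sup>2 + b2\<^sup>2 + a3\<^sup>2 + b3\<^sup>2"
  unfolding grad_sq_def frechet_derivative_at[OF has_derivative_vector_3[OF assms], symmetric]
  by (simp add: Basis_real2 axis_12_neq norm_3) (simp add: axis_def)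

lemma C1_on_vector_3:
  assumes "\<And>x. x \<in> S \<Longrightarrow> has_grad f1 (a1 x) (b1 x) x" "\<And>x. x \<in> S \<Longrightarrow> has_grad f2 (a2 x) (b2 x) x"
    "\<And>x. x \<in> S \<Longrightarrow> has_grad f3 (a3 x) (b3 x) x"
    and "continuous_on S a1" "continuous_on S b1" "continuous_on S a2" "continuous_on S b2"
      "continuous_on S a3" "continuous_on S b3"
  shows "C1_on S (\<lambda>x. vector [f1 x, f2 x, f3 x] :: real^3)"
  unfolding C1_on_def
proof (intro conjI ballI allI)
  fix x assume "x \<in> S"
  then show "(\<lambda>x. vector [f1 x, f2 x, f3 x] :: real^3) differentiable at x"
    using has_derivative_vector_3 assms(1-3) unfolding differentiable_def by blast
next
  fix h :: "real^2"
  have "continuous_on S (\<lambda>x. vector [a1 x * h $ 1 + b1 x * h $ 2, a2 x * h $ 1 + b2 x * h $ 2, a3 x * h $ 1 + b3 x * h $ 2] :: real^3)"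
    unfolding vector_3_axis by (intro continuous_intros assms)
  then show "continuous_on S (\<lambda>x. frechet_derivative (\<lambda>x. vector [f1 x, f2 x, f3 x] :: real^3) (at x) h)"
    by (rule continuous_on_eq) (simp add: frechet_derivative_at[OF has_derivative_vector_3[OF assms(1-3)], symmetric])
qed

lemma slice_has_vector_derivative:
  assumes "(w has_derivative D) (at (vector [a, b] :: real^2))"
  shows "((\<lambda>a. w (vector [a, b])) has_vector_derivative D (axis 1 1)) (at a)"
    and "((\<lambda>b. w (vector [a, b])) has_vector_derivative D (axis 2 1)) (at b)"
proof -
  interpret bounded_linear D using assms by (rule has_derivative_bounded_linear)
  have "((\<lambda>a. vector [a, b] :: real^2) has_derivative (\<lambda>h. h *\<^sub>R axis 1 1)) (at a)"
    unfolding vector_2_axis by (auto intro!: derivative_eq_intros)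
  from has_derivative_compose[OF this assms]
  show "((\<lambda>a. w (vector [a, b])) has_vector_derivative D (axis 1 1)) (at a)"
    by (simp add: has_vector_derivative_def scaleR)
  have "((\<lambda>b. vector [a, b] :: real^2) has_derivative (\<lambda>h. h *\<^sub>R axis 2 1)) (at b)"
    unfolding vector_2_axis by (auto intro!: derivative_eq_intros)
  from has_derivative_compose[OF this assms]
  show "((\<lambda>b. w (vector [a, b])) has_vector_derivative D (axis 2 1)) (at b)"
    by (simp add: has_vector_derivative_def scaleR)
qed

lemma integrable_bounded_support:
  fixes f :: "'a::euclidean_space \<Rightarrow> 'b::{banach, second_countable_topology}"
  assumes m: "f \<in> borel_measurable borel" and b: "\<And>x. norm (f x) \<le> K" and S: "bounded S" and s: "\<And>x. x \<notin> S \<Longrightarrow> f x = 0"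
  shows "integrable lborel f"
proof -
  obtain R where R: "\<And>x. x \<in> S \<Longrightarrow> norm x \<le> R" using S by (auto simp: bounded_iff)
  have "integrable lborel (\<lambda>x. indicator (cball 0 R) x *\<^sub>R f x)"
    using m b emeasure_bounded_finite[of "cball (0::'a) R"]
    by (intro integrableI_bounded_set_indicator[where B = K]) auto
  moreover have "(\<lambda>x. indicator (cball 0 R) x *\<^sub>R f x) = f"
    using s R by (fastforce simp: fun_eq_iff indicator_def)
  ultimately show ?thesis by simp
qed

text \<open>The derivative is known to be bounded and measurable only, so the fundamental theorem is
  used for the gauge integral, which is then identified with the Lebesgue integral by
  uniqueness.\<close>

lemma integral_derivative_compact_support:
  fixes w w' :: "real \<Rightarrow> complex"
  assumes d: "\<And>t. (w has_vector_derivative w' t) (at t)"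
    and m: "w' \<in> borel_measurable borel" and b: "\<And>t. norm (w' t) \<le> K"
    and s: "\<And>t. \<bar>t\<bar> \<ge> R \<Longrightarrow> w t = 0" "\<And>t. \<bar>t\<bar> > R \<Longrightarrow> w' t = 0" and R: "R \<ge> 0"
  shows "(LINT t|lborel. w' t) = 0"
proof -
  have "integrable lborel w'"
    by (rule integrable_bounded_support[OF m b, of "{-R..R}"]) (use s(2) in auto)
  then have "(w' has_integral (LINT t|lborel. w' t)) UNIV"
    by (rule has_integral_integral_lborel)
  moreover have "(w' has_integral (w R - w (- R))) {-R..R}"
    using d R by (intro fundamental_theorem_of_calculus) (auto intro: has_vector_derivative_at_within)
  then have "(w' has_integral 0) {-R..R}" using s(1)[of R] s(1)[of "-R"] R by simp
  then have "(w' has_integral 0) UNIV"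
    by (rule has_integral_on_superset) (use s(2) in auto)
  ultimately show ?thesis by (rule has_integral_unique)
qed

text \<open>The divergence theorem without boundary term: each partial derivative is integrated
  first along its own direction, where the compact support gives 0.\<close>

lemma integral_divergence_compact_support:
  fixes w1 w2 :: "real^2 \<Rightarrow> complex"
  assumes d1: "\<And>x. (w1 has_derivative D1 x) (at x)" and d2: "\<And>x. (w2 has_derivative D2 x) (at x)"
    and m: "(\<lambda>x. D1 x (axis 1 1)) \<in> borel_measurable borel" "(\<lambda>x. D2 x (axis 2 1)) \<in> borel_measurable borel"
    and b: "\<And>x. norm (D1 x (axis 1 1)) \<le> K" "\<And>x. norm (D2 x (axis 2 1)) \<le> K"
    and S: "bounded S" and s: "\<And>x. x \<notin> S \<Longrightarrow> w1 x = 0 \<and> w2 x = 0 \<and> D1 x (axis 1 1) = 0 \<and> D2 x (axis 2 1) = 0"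
  shows "(LINT x|lborel. D1 x (axis 1 1) + D2 x (axis 2 1)) = 0"
proof -
  obtain R where R: "R > 0" "\<And>x. x \<in> S \<Longrightarrow> norm x < R"
    using S by (meson bounded_pos_less)
  have out: "vector [a, b] \<notin> S" if "\<bar>a\<bar> \<ge> R \<or> \<bar>b\<bar> \<ge> R" for a b
  proof
    assume "vector [a, b] \<in> S"
    then have "norm (vector [a, b] :: real^2) < R" using R by auto
    moreover have "\<bar>a\<bar> \<le> norm (vector [a, b] :: real^2)" "\<bar>b\<bar> \<le> norm (vector [a, b] :: real^2)"
      using component_le_norm_cart[of "vector [a, b] :: real^2" 1] component_le_norm_cart[of "vector [a, b] :: real^2" 2] by auto
    ultimately show False using that by auto
  qed
  have i: "integrable lborel (\<lambda>x. D1 x (axis 1 1))" "integrable lborel (\<lambda>x. D2 x (axis 2 1))"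
    using m b s by (auto intro!: integrable_bounded_support[OF _ _ S])
  have "(LINT x|lborel. D1 x (axis 1 1)) = 0"
    unfolding integral_real2'[OF i(1)]
  proof (rule integral_eq_zero_AE, intro AE_I2)
    fix b
    show "(LINT a|lborel. D1 (vector [a, b]) (axis 1 1)) = 0"
    proof (rule integral_derivative_compact_support[where R = R and K = K])
      show "(\<lambda>t. D1 (vector [t, b]) (axis 1 1)) \<in> borel_measurable borel"
        by (rule measurable_compose[OF _ m(1)]) simp
      show "((\<lambda>a. w1 (vector [a, b])) has_vector_derivative D1 (vector [a, b]) (axis 1 1)) (at a)" for a
        by (rule slice_has_vector_derivative(1)[OF d1])
    qed (use b s out R in auto)
  qed
  moreover have "(LINT x|lborel. D2 x (axis 2 1)) = 0"
    unfolding integral_real2[OF i(2)]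
  proof (rule integral_eq_zero_AE, intro AE_I2)
    fix a
    show "(LINT b|lborel. D2 (vector [a, b]) (axis 2 1)) = 0"
    proof (rule integral_derivative_compact_support[where R = R and K = K])
      show "(\<lambda>t. D2 (vector [a, t]) (axis 2 1)) \<in> borel_measurable borel"
        by (rule measurable_compose[OF _ m(2)]) simp
      show "((\<lambda>b. w2 (vector [a, b])) has_vector_derivative D2 (vector [a, b]) (axis 2 1)) (at b)" for b
        by (rule slice_has_vector_derivative(2)[OF d2])
    qed (use b s out R in auto)
  qed
  ultimately show ?thesis using i by simp
qed

text \<open>Freezing \<open>g\<close> below a critical point keeps it differentiable. The functions
  \<open>cutoff\<close>, \<open>ell\<close>, \<open>soft\<close> and \<open>core_sq\<close> are
  assembled from such pieces, which avoids a separate argument at each of their joints.\<close>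

lemma DERIV_compose_max:
  fixes g g' :: "real \<Rightarrow> real"
  assumes g: "\<And>t. t \<ge> c \<Longrightarrow> (g has_real_derivative g' t) (at t)" and c: "g' c = 0"
  shows "((\<lambda>u. g (max c u)) has_real_derivative g' (max c u)) (at u)"
proof -
  consider "u < c" | "u > c" | "u = c" by linarith
  then show ?thesis
  proof cases
    case 1
    have "((\<lambda>u::real. g c) has_real_derivative 0) (at u)" by simp
    then have "((\<lambda>u. g (max c u)) has_real_derivative 0) (at u)"
      by (rule has_field_derivative_transform_within_open[of _ _ _ "{..<c}"]) (use 1 in auto)
    with 1 c show ?thesis by (simp add: max_def)
  next
    case 2
    have "(g has_real_derivative g' u) (at u)" using g 2 by simp
    then have "((\<lambda>u. g (max c u)) has_real_derivative g' u) (at u)"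
      by (rule has_field_derivative_transform_within_open[of _ _ _ "{c<..}"]) (use 2 in auto)
    with 2 show ?thesis by (simp add: max_def)
  next
    case 3
    have "((\<lambda>h. (g (c + h) - g c) / h) \<longlongrightarrow> 0) (at 0)"
      using g[of c] c by (simp add: DERIV_def)
    then have "((\<lambda>h. (g (c + h) - g c) / h) \<longlongrightarrow> 0) (at_right 0)"
      by (simp add: filterlim_at_split)
    then have "((\<lambda>h. (g (max c (c + h)) - g c) / h) \<longlongrightarrow> 0) (at_right 0)"
      by (rule Lim_transform_eventually) (auto simp: eventually_at_filter)
    moreover have "((\<lambda>h. (g (max c (c + h)) - g c) / h) \<longlongrightarrow> 0) (at_left 0)"
      by (rule Lim_transform_eventually[OF tendsto_const]) (auto simp: eventually_at_filter max_def)
    ultimately show ?thesis using 3 c by (simp add: DERIV_def filterlim_at_split)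
  qed
qed

lemma has_real_derivative_sq_pos:
  "((\<lambda>t. (max 0 t)\<^sup>2) has_real_derivative 2 * max 0 t) (at (t::real))"
proof -
  have "((\<lambda>t::real. t\<^sup>2) has_real_derivative 2 * t) (at t)" for t
    by (auto intro!: derivative_eq_intros)
  from DERIV_compose_max[of 0, OF this] show ?thesis by simp
qed

section \<open>The divergence of tangential fields on the stadium\<close>

lemma stadium_normal_1: "stadium_normal x $ 1 = max 0 (x $ 1 - 1) - max 0 (- (x $ 1) - 1)"
  and stadium_normal_2: "stadium_normal x $ 2 = x $ 2"
  by (auto simp: stadium_normal_def max_def min_def)

text \<open>The squared distance to the segment [-1, 1] x {0}, written so that it is visibly C^1;
  \<open>1 - normal_sq\<close> serves as defining function of the boundary. The two positive parts
  never overlap, so the cross term in the square of the normal vanishes.\<close>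

definition normal_sq :: "real^2 \<Rightarrow> real" where
  "normal_sq x = (max 0 (x $ 1 - 1))\<^sup>2 + (max 0 (- (x $ 1) - 1))\<^sup>2 + (x $ 2)\<^sup>2"

lemma normal_sq_eq: "normal_sq x = (norm (stadium_normal x))\<^sup>2"
proof -
  have "normal_sq x = (stadium_normal x $ 1)\<^sup>2 + (stadium_normal x $ 2)\<^sup>2"
    unfolding normal_sq_def stadium_normal_1 stadium_normal_2 by (auto simp: max_def power2_eq_square algebra_simps)
  then show ?thesis by (simp add: norm_2)
qed

lemma stadium_iff: "x \<in> stadium \<longleftrightarrow> normal_sq x < 1"
  by (simp add: stadium_eq normal_sq_eq abs_square_less_1)

lemma closure_stadium: "closure stadium = {x. normal_sq x \<le> 1}"
proof -
  have "closure stadium = stadium \<union> frontier stadium"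
    using closure_Un_frontier by auto
  also have "\<dots> = {x. norm (stadium_normal x) \<le> 1}"
    unfolding frontier_stadium by (auto simp: stadium_eq)
  finally show ?thesis by (simp add: normal_sq_eq power_le_one_iff abs_square_le_1)
qed

lemma closure_stadium_bounds:
  assumes "x \<in> closure stadium"
  shows "\<bar>x $ 1\<bar> \<le> 2" "\<bar>x $ 2\<bar> \<le> 1"
proof -
  have n: "normal_sq x \<le> 1" using assms by (simp add: closure_stadium)
  have "(x $ 2)\<^sup>2 \<le> 1" "(max 0 (x $ 1 - 1))\<^sup>2 \<le> 1" "(max 0 (- (x $ 1) - 1))\<^sup>2 \<le> 1"
    using n zero_le_power2[of "x $ 2"] zero_le_power2[of "max 0 (x $ 1 - 1)"] zero_le_power2[of "max 0 (- (x $ 1) - 1)"]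
    unfolding normal_sq_def by linarith+
  then show "\<bar>x $ 1\<bar> \<le> 2" "\<bar>x $ 2\<bar> \<le> 1" by (auto simp: abs_square_le_1)
qed

lemma stadium_bounds:
  assumes "x \<in> stadium"
  shows "\<bar>x $ 1\<bar> \<le> 2" "\<bar>x $ 2\<bar> < 1"
proof -
  show "\<bar>x $ 1\<bar> \<le> 2" using closure_stadium_bounds(1)[of x] closure_subset assms by blast
  have "(x $ 2)\<^sup>2 < 1" using assms zero_le_power2[of "max 0 (x $ 1 - 1)"] zero_le_power2[of "max 0 (- (x $ 1) - 1)"]
    unfolding stadium_iff normal_sq_def by linarith
  then show "\<bar>x $ 2\<bar> < 1" by (simp add: abs_square_less_1)
qed

lemma bounded_stadium: "bounded stadium"
proof (rule boundedI)
  fix x assume "x \<in> stadium"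
  then have "\<bar>x $ 1\<bar> \<le> 2" "\<bar>x $ 2\<bar> < 1" by (rule stadium_bounds)+
  then show "norm x \<le> 3" using norm_le_l1_cart[of x] by (simp add: sum_2)
qed

lemma has_grad_normal_sq: "has_grad normal_sq (2 * stadium_normal x $ 1) (2 * stadium_normal x $ 2) x"
proof -
  note d = has_derivative_compose[OF _ has_real_derivative_sq_pos[unfolded has_field_derivative_def]]
  show ?thesis
    unfolding has_grad_def normal_sq_def[abs_def] stadium_normal_1 stadium_normal_2
    by (rule has_derivative_eq_rhs, (rule d | rule derivative_intros)+) (auto simp: fun_eq_iff algebra_simps)
qed

text \<open>A C^1 step from 0 on z \<le> 1 to 1 on z \<ge> 2, made of squares of positive
  parts.\<close>

definition cutoff :: "real \<Rightarrow> real" where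
  "cutoff z = 1 - (max 0 (1 - (max 0 (z - 1))\<^sup>2))\<^sup>2"

definition cutoff' :: "real \<Rightarrow> real" where
  "cutoff' z = 4 * max 0 (1 - (max 0 (z - 1))\<^sup>2) * max 0 (z - 1)"

lemma DERIV_cutoff: "(cutoff has_real_derivative cutoff' z) (at z)"
  unfolding cutoff_def[abs_def] cutoff'_def
  by (rule DERIV_cong, (rule DERIV_chain2[OF has_real_derivative_sq_pos] derivative_intros)+) simp

lemma cutoff_le_1: "z \<le> 1 \<Longrightarrow> cutoff z = 0" and cutoff_ge_2: "z \<ge> 2 \<Longrightarrow> cutoff z = 1"
  and cutoff'_ge_2: "z \<ge> 2 \<Longrightarrow> cutoff' z = 0"
proof -
  show "z \<le> 1 \<Longrightarrow> cutoff z = 0" by (simp add: cutoff_def)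
  assume z: "z \<ge> 2"
  then have "1 \<le> (max 0 (z - 1))\<^sup>2" by (intro one_le_power) auto
  then show "cutoff z = 1" "cutoff' z = 0" by (auto simp: cutoff_def cutoff'_def)
qed

text \<open>The last bound is the scale-invariant one: it survives when the transition layer is
  squeezed towards the boundary.\<close>

lemma cutoff_bounds: "0 \<le> cutoff z" "cutoff z \<le> 1" "0 \<le> cutoff' z" "cutoff' z \<le> 4" "z * cutoff' z \<le> 8"
proof -
  have "(max 0 (1 - (max 0 (z - 1))\<^sup>2))\<^sup>2 \<le> 1" by (intro power_le_one) auto
  then show "0 \<le> cutoff z" "cutoff z \<le> 1" by (auto simp: cutoff_def)
  show 0: "0 \<le> cutoff' z" by (simp add: cutoff'_def)
  show 4: "cutoff' z \<le> 4"
  proof (cases "z \<ge> 2")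
    case False
    have "max 0 (1 - (max 0 (z - 1))\<^sup>2) * max 0 (z - 1) \<le> 1 * 1"
      using False by (intro mult_mono) auto
    then show ?thesis by (simp add: cutoff'_def)
  qed (simp add: cutoff'_ge_2)
  show "z * cutoff' z \<le> 8"
  proof (cases "z \<ge> 2")
    case False
    have "z * cutoff' z \<le> 2 * 4" using False 0 4 by (intro mult_mono) auto
    then show ?thesis by simp
  qed (simp add: cutoff'_ge_2)
qed

lemma measurable_on_stadium:
  fixes f :: "real^2 \<Rightarrow> 'b::real_normed_vector"
  assumes "continuous_on stadium f"
  shows "(\<lambda>x. if x \<in> stadium then f x else 0) \<in> borel_measurable borel"
proof -
  have "(\<lambda>x. if x \<in> stadium then f x else 0) = (\<lambda>x. indicator stadium x *\<^sub>R f x)"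
    by (auto simp: indicator_def)
  then show ?thesis
    using borel_measurable_continuous_on_indicator[OF _ assms] open_stadium by simp
qed

lemma continuous_on_stadium_normal_nth: "continuous_on S (\<lambda>x. stadium_normal x $ i)"
  by (intro continuous_intros continuous_stadium_normal)

lemma has_grad_imp_continuous_on:
  assumes "\<And>x. x \<in> S \<Longrightarrow> has_grad f (a x) (b x) x"
  shows "continuous_on S f"
  using assms unfolding has_grad_def
  by (meson continuous_at_imp_continuous_on has_derivative_continuous)

lemma cis_inner_has_derivative:
  "((\<lambda>x::real^2. cis (- (\<xi> \<bullet> x))) has_derivative (\<lambda>h. - \<i> * complex_of_real (\<xi> \<bullet> h) * cis (- (\<xi> \<bullet> x)))) (at x)"
  by (auto intro!: derivative_eq_intros simp: fun_eq_iff scaleR_conv_of_real mult_ac)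

text \<open>A tangential field creates no surface charge: the distributional divergence of the
  extension by 0 is the classical divergence inside. As the derivatives are only bounded in the open
  stadium, the field is multiplied by cutoffs, and the layer shrinks to the boundary. The cutoff
  gradient is large but parallel to \<open>stadium_normal\<close>, so it meets only the normal
  component, which \<open>tang\<close> makes small in the layer.\<close>

lemma stadium_integration_by_parts:
  fixes m1 m2 a1 b1 a2 b2 :: "real^2 \<Rightarrow> real" and \<xi> :: "real^2"
  assumes g1: "\<And>x. x \<in> stadium \<Longrightarrow> has_grad m1 (a1 x) (b1 x) x"
    and g2: "\<And>x. x \<in> stadium \<Longrightarrow> has_grad m2 (a2 x) (b2 x) x"
    and c: "continuous_on stadium a1" "continuous_on stadium b2"
    and bd: "\<And>x. x \<in> stadium \<Longrightarrow> \<bar>m1 x\<bar> \<le> K" "\<And>x. x \<in> stadium \<Longrightarrow> \<bar>m2 x\<bar> \<le> K"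
      "\<And>x. x \<in> stadium \<Longrightarrow> \<bar>a1 x\<bar> \<le> K" "\<And>x. x \<in> stadium \<Longrightarrow> \<bar>b2 x\<bar> \<le> K"
    and tang: "\<And>x. x \<in> stadium \<Longrightarrow> \<bar>m1 x * stadium_normal x $ 1 + m2 x * stadium_normal x $ 2\<bar> \<le> K * (1 - normal_sq x)"
  shows "\<i> * (LINT x|lborel. cis (- (\<xi> \<bullet> x)) * complex_of_real (\<xi> \<bullet> (indicator stadium x *\<^sub>R vector [m1 x, m2 x])))
    = (LINT x|lborel. cis (- (\<xi> \<bullet> x)) * complex_of_real (if x \<in> stadium then a1 x + b2 x else 0))"
proof -
  let ?n = "\<lambda>x. stadium_normal x $ 1" and ?n2 = "\<lambda>x. stadium_normal x $ 2"
  have K0: "K \<ge> 0"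
  proof -
    have "(0::real^2) \<in> stadium" by (simp add: stadium_iff normal_sq_def)
    from bd(1)[OF this] show ?thesis by linarith
  qed
  define \<phi> where "\<phi> = (\<lambda>x::real^2. cis (- (\<xi> \<bullet> x)))"
  have n\<phi>: "cmod (\<phi> x) = 1" for x by (simp add: \<phi>_def)
  \<comment> \<open>In this scaling the cutoff is 0 where 1 - normal_sq \<le> 1/(k+1) and 1 where it
    is at least 2/(k+1).\<close>
  define z where "z = (\<lambda>(k::nat) x. (real k + 1) * (1 - normal_sq x))"
  define X where "X = (\<lambda>(k::nat) x. cutoff (z k x))"
  define X' where "X' = (\<lambda>(k::nat) x. - 2 * (real k + 1) * cutoff' (z k x))"
  have gX: "(X k has_derivative (\<lambda>h. X' k x * (?n x * h $ 1 + ?n2 x * h $ 2))) (at x)" for k x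
  proof -
    have "(z k has_derivative (\<lambda>h. (real k + 1) * (- (2 * ?n x * h $ 1 + 2 * ?n2 x * h $ 2)))) (at x)"
      unfolding z_def
      by (rule has_derivative_eq_rhs, (rule derivative_intros has_grad_normal_sq[unfolded has_grad_def])+) (auto simp: fun_eq_iff)
    from has_derivative_compose[OF this DERIV_cutoff[unfolded has_field_derivative_def]]
    show ?thesis unfolding X_def X'_def
      by (rule has_derivative_eq_rhs) (auto simp: fun_eq_iff algebra_simps)
  qed
  define w where "w = (\<lambda>m k x. if x \<in> stadium then complex_of_real (X k x * m x) * \<phi> x else 0)"
  define W where "W = (\<lambda>m (a::_\<Rightarrow>real) (b::_\<Rightarrow>real) k x h. if x \<in> stadium then
     complex_of_real (X k x * (a x * h $ 1 + b x * h $ 2) + X' k x * (?n x * h $ 1 + ?n2 x * h $ 2) * m x) * \<phi> x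
      + complex_of_real (X k x * m x) * (- \<i> * complex_of_real (\<xi> \<bullet> h) * \<phi> x) else 0)"
  have wW: "(w m k has_derivative W m a b k x) (at x)" if g: "\<And>x. x \<in> stadium \<Longrightarrow> has_grad m (a x) (b x) x" for m a b k x
  proof (cases "x \<in> stadium")
    case True
    have "((\<lambda>x. complex_of_real (X k x * m x) * \<phi> x) has_derivative W m a b k x) (at x)"
      unfolding \<phi>_def
      apply (rule has_derivative_eq_rhs)
       apply (rule has_derivative_mult has_derivative_of_real gX g[OF True, unfolded has_grad_def] cis_inner_has_derivative)+
      using True by (auto simp: fun_eq_iff W_def \<phi>_def algebra_simps)
    then show ?thesis
      by (rule has_derivative_transform_within_open[OF _ open_stadium True]) (simp add: w_def)
  next
    case False
    \<comment> \<open>Outside the stadium z \<le> 0, so the cutoff vanishes on a whole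
      neighbourhood. This makes the extension by 0 differentiable across the boundary.\<close>
    let ?U = "{y. z k y < 1}"
    have "continuous_on UNIV (z k)"
      unfolding z_def using has_grad_imp_continuous_on[of UNIV normal_sq, OF has_grad_normal_sq]
      by (intro continuous_intros)
    then have U: "open ?U" by (intro open_Collect_less continuous_intros)
    have xU: "x \<in> ?U"
      using False mult_nonneg_nonpos[of "real k + 1" "1 - normal_sq x"] by (simp add: stadium_iff z_def)
    have "((\<lambda>x. 0) has_derivative W m a b k x) (at x)"
      using False by (simp add: W_def[abs_def])
    then show ?thesis
      by (rule has_derivative_transform_within_open[OF _ U xU]) (auto simp: w_def X_def cutoff_le_1)
  qed
  have cX: "continuous_on S (X k)" for S k
    using gX by (meson continuous_at_imp_continuous_on has_derivative_continuous)
  have cX': "continuous_on S (X' k)" for S k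
    unfolding X'_def cutoff'_def z_def using has_grad_imp_continuous_on[of S normal_sq, OF has_grad_normal_sq]
    by (intro continuous_intros)
  have c\<phi>: "continuous_on S \<phi>" for S unfolding \<phi>_def by (intro continuous_intros)
  have cm: "continuous_on stadium m1" "continuous_on stadium m2"
    using g1 g2 by (auto intro: has_grad_imp_continuous_on)
  have n1: "\<bar>stadium_normal x $ i\<bar> \<le> 1" if "x \<in> stadium" for x i
    using component_le_norm_cart[of "stadium_normal x" i] that by (simp add: stadium_eq)
  have X1: "\<bar>X k x\<bar> \<le> 1" for k x using cutoff_bounds[of "z k x"] by (simp add: X_def)
  have aX': "\<bar>X' k x\<bar> = 2 * (real k + 1) * cutoff' (z k x)" for k x
    unfolding X'_def using cutoff_bounds(3)[of "z k x"] by (subst abs_mult) (simp del: distrib_left_numeral)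
  have X'1: "\<bar>X' k x\<bar> \<le> 8 * (real k + 1)" for k x
    using mult_left_mono[OF cutoff_bounds(4)[of "z k x"], of "2 * (real k + 1)"] by (simp add: aX')
  have [simp]: "(axis 1 1 :: real^2) $ 1 = 1" "(axis 1 1 :: real^2) $ 2 = 0" "(axis 2 1 :: real^2) $ 1 = 0" "(axis 2 1 :: real^2) $ 2 = 1"
    by (simp_all add: axis_def)
  have [simp]: "\<xi> \<bullet> axis i 1 = \<xi> $ i" for i by (simp add: inner_axis)
  have zero: "(LINT x|lborel. W m1 a1 b1 k x (axis 1 1) + W m2 a2 b2 k x (axis 2 1)) = 0" for k
  proof (rule integral_divergence_compact_support[OF wW[OF g1] wW[OF g2]])
    show "(\<lambda>x. W m1 a1 b1 k x (axis 1 1)) \<in> borel_measurable borel"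
      unfolding W_def by (rule measurable_on_stadium) (auto intro!: continuous_intros cX cX' c\<phi> cm c continuous_on_stadium_normal_nth)
    show "(\<lambda>x. W m2 a2 b2 k x (axis 2 1)) \<in> borel_measurable borel"
      unfolding W_def by (rule measurable_on_stadium) (auto intro!: continuous_intros cX cX' c\<phi> cm c continuous_on_stadium_normal_nth)
    have est: "cmod (complex_of_real (X k x * a + X' k x * n * m) * \<phi> x + complex_of_real (X k x * m) * (- \<i> * complex_of_real (\<xi> $ i) * \<phi> x))
       \<le> K + 8 * (real k + 1) * K + K * norm \<xi>" if "\<bar>a\<bar> \<le> K" "\<bar>n\<bar> \<le> 1" "\<bar>m\<bar> \<le> K" for x a n m i
    proof -
      have "\<bar>X k x * a\<bar> \<le> 1 * K" unfolding abs_mult by (intro mult_mono X1 that) auto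
      moreover have "\<bar>X' k x * n * m\<bar> \<le> (8 * (real k + 1) * 1) * K"
        unfolding abs_mult by (intro mult_mono X'1 that) auto
      moreover have "\<bar>X k x * m\<bar> * \<bar>\<xi> $ i\<bar> \<le> (1 * K) * norm \<xi>"
        unfolding abs_mult by (intro mult_mono X1 that component_le_norm_cart) (auto simp: K0)
      moreover have "cmod (complex_of_real (X k x * a + X' k x * n * m) * \<phi> x) \<le> \<bar>X k x * a\<bar> + \<bar>X' k x * n * m\<bar>"
        unfolding norm_mult n\<phi> norm_of_real by simp
      moreover have "cmod (complex_of_real (X k x * m) * (- \<i> * complex_of_real (\<xi> $ i) * \<phi> x)) = \<bar>X k x * m\<bar> * \<bar>\<xi> $ i\<bar>"
        unfolding norm_mult n\<phi> norm_of_real by simp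
      ultimately show ?thesis
        using norm_triangle_ineq[of "complex_of_real (X k x * a + X' k x * n * m) * \<phi> x" "complex_of_real (X k x * m) * (- \<i> * complex_of_real (\<xi> $ i) * \<phi> x)"]
        by linarith
    qed
    have pos: "0 \<le> K + 8 * (real k + 1) * K + K * norm \<xi>" using K0 by simp
    show "cmod (W m1 a1 b1 k x (axis 1 1)) \<le> K + 8 * (real k + 1) * K + K * norm \<xi>" for x
      using est[of "a1 x" "?n x" "m1 x" x 1] bd n1 pos by (auto simp: W_def)
    show "cmod (W m2 a2 b2 k x (axis 2 1)) \<le> K + 8 * (real k + 1) * K + K * norm \<xi>" for x
      using est[of "b2 x" "?n2 x" "m2 x" x 2] bd n1 pos by (auto simp: W_def)
    show "bounded stadium" by (rule bounded_stadium)
    show "x \<notin> stadium \<Longrightarrow> w m1 k x = 0 \<and> w m2 k x = 0 \<and> W m1 a1 b1 k x (axis 1 1) = 0 \<and> W m2 a2 b2 k x (axis 2 1) = 0" for x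
      by (simp add: w_def W_def)
  qed
  define F where "F = (\<lambda>x. if x \<in> stadium then complex_of_real (a1 x + b2 x) * \<phi> x - \<i> * complex_of_real (\<xi> $ 1 * m1 x + \<xi> $ 2 * m2 x) * \<phi> x else 0)"
  define G where "G = (\<lambda>k x. W m1 a1 b1 k x (axis 1 1) + W m2 a2 b2 k x (axis 2 1))"
  have G: "G k x = (if x \<in> stadium then complex_of_real (X k x) * F x + complex_of_real (X' k x * (m1 x * ?n x + m2 x * ?n2 x)) * \<phi> x else 0)" for k x
    by (simp add: G_def W_def F_def algebra_simps)
  have Fm: "F \<in> borel_measurable borel"
    unfolding F_def by (rule measurable_on_stadium) (auto intro!: continuous_intros c\<phi> cm c)
  have Fb: "cmod (F x) \<le> 2 * K + 2 * norm \<xi> * K" for x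
  proof (cases "x \<in> stadium")
    case True
    have "\<bar>\<xi> $ i\<bar> * \<bar>m\<bar> \<le> norm \<xi> * K" if "\<bar>m\<bar> \<le> K" for i m
      by (intro mult_mono component_le_norm_cart that) auto
    from this[OF bd(1)[OF True], of 1] this[OF bd(2)[OF True], of 2]
    have "\<bar>\<xi> $ 1 * m1 x + \<xi> $ 2 * m2 x\<bar> \<le> 2 * norm \<xi> * K"
      using abs_triangle_ineq[of "\<xi> $ 1 * m1 x" "\<xi> $ 2 * m2 x"] by (simp add: abs_mult)
    moreover have "\<bar>a1 x + b2 x\<bar> \<le> 2 * K" using bd(3,4)[OF True] by linarith
    moreover have "cmod (F x) \<le> cmod (complex_of_real (a1 x + b2 x) * \<phi> x) + cmod (\<i> * complex_of_real (\<xi> $ 1 * m1 x + \<xi> $ 2 * m2 x) * \<phi> x)"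
      unfolding F_def using True by (simp only: if_True norm_triangle_ineq4)
    moreover have "cmod (complex_of_real (a1 x + b2 x) * \<phi> x) = \<bar>a1 x + b2 x\<bar>"
      "cmod (\<i> * complex_of_real (\<xi> $ 1 * m1 x + \<xi> $ 2 * m2 x) * \<phi> x) = \<bar>\<xi> $ 1 * m1 x + \<xi> $ 2 * m2 x\<bar>"
      unfolding norm_mult n\<phi> norm_of_real by simp_all
    ultimately show ?thesis by linarith
  qed (auto simp: F_def K0)
  have "(\<lambda>k. LINT x|lborel. G k x) \<longlonglongrightarrow> (LINT x|lborel. F x)"
  \<comment> \<open>The bound is 16 K for the term with the cutoff gradient plus 2 K + 2 |\<xi>| K
    for \<open>F\<close>.\<close>
  proof (rule integral_dominated_convergence[where w = "\<lambda>x. indicator stadium x * (18 * K + 2 * norm \<xi> * K)"])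
    show "F \<in> borel_measurable lborel" using Fm by simp
    show "G k \<in> borel_measurable lborel" for k
    proof -
      have "(\<lambda>x. if x \<in> stadium then complex_of_real (X k x) * F x + complex_of_real (X' k x * (m1 x * ?n x + m2 x * ?n2 x)) * \<phi> x else 0) \<in> borel_measurable borel"
        by (rule measurable_on_stadium) (auto simp: F_def intro!: continuous_intros cX cX' c\<phi> cm c continuous_on_stadium_normal_nth 
           intro: continuous_on_eq[where f = "\<lambda>x. complex_of_real (a1 x + b2 x) * \<phi> x - \<i> * complex_of_real (\<xi> $ 1 * m1 x + \<xi> $ 2 * m2 x) * \<phi> x"])
      then show ?thesis by (simp add: G[abs_def])
    qed
    show "integrable lborel (\<lambda>x. indicator stadium x * (18 * K + 2 * norm \<xi> * K))"
      using emeasure_bounded_finite[OF bounded_stadium] open_stadium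
      by (intro integrable_mult_left integrable_real_indicator) auto
    show "AE x in lborel. (\<lambda>k. G k x) \<longlonglongrightarrow> F x"
    proof (intro AE_I2)
      fix x
      show "(\<lambda>k. G k x) \<longlonglongrightarrow> F x"
      proof (cases "x \<in> stadium")
        case True
        then have p: "1 - normal_sq x > 0" by (simp add: stadium_iff)
        have "eventually (\<lambda>k. real k + 1 \<ge> 2 / (1 - normal_sq x)) sequentially" by real_asymp
        then have "eventually (\<lambda>k. F x = G k x) sequentially"
        proof eventually_elim
          case (elim k)
          then have "z k x \<ge> 2" using p by (simp add: z_def field_simps)
          then show ?case by (simp add: G X_def X'_def cutoff_ge_2 cutoff'_ge_2 True)
        qed
        then show ?thesis by (rule Lim_transform_eventually[OF tendsto_const])
      qed (simp add: G F_def)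
    qed
    show "AE x in lborel. cmod (G k x) \<le> indicator stadium x * (18 * K + 2 * norm \<xi> * K)" for k
    proof (intro AE_I2)
      fix x
      show "cmod (G k x) \<le> indicator stadium x * (18 * K + 2 * norm \<xi> * K)"
      proof (cases "x \<in> stadium")
        case True
        then have p: "1 - normal_sq x > 0" by (simp add: stadium_iff)
        let ?t = "m1 x * ?n x + m2 x * ?n2 x"
        \<comment> \<open>The factor k + 1 of the cutoff gradient is absorbed by the tangency
          defect: together they form z * cutoff' z, which is bounded independently of k.\<close>
        have "\<bar>X' k x * ?t\<bar> \<le> (2 * (real k + 1) * cutoff' (z k x)) * (K * (1 - normal_sq x))"
          unfolding abs_mult using cutoff_bounds(3)[of "z k x"]
          by (intro mult_mono tang True) (auto simp: aX')
        also have "\<dots> = 2 * K * (z k x * cutoff' (z k x))" by (simp add: z_def algebra_simps)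
        also have "\<dots> \<le> 2 * K * 8" using K0 by (intro mult_left_mono cutoff_bounds) auto
        finally have 1: "\<bar>X' k x * ?t\<bar> \<le> 16 * K" by simp
        have "\<bar>X k x\<bar> * cmod (F x) \<le> 1 * (2 * K + 2 * norm \<xi> * K)" by (intro mult_mono X1 Fb) auto
        then have 2: "cmod (complex_of_real (X k x) * F x) \<le> 2 * K + 2 * norm \<xi> * K" by (simp add: norm_mult)
        have "cmod (G k x) \<le> cmod (complex_of_real (X k x) * F x) + cmod (complex_of_real (X' k x * ?t) * \<phi> x)"
          unfolding G using True by (simp only: if_True norm_triangle_ineq)
        also have "cmod (complex_of_real (X' k x * ?t) * \<phi> x) = \<bar>X' k x * ?t\<bar>" 
          unfolding norm_mult n\<phi> norm_of_real by simp
        finally show ?thesis using 1 2 True by simp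
      qed (simp add: G)
    qed
  qed
  moreover have "(LINT x|lborel. G k x) = 0" for k
    unfolding G_def by (rule zero)
  ultimately have F0: "(LINT x|lborel. F x) = 0"
    by (simp only:) (metis LIMSEQ_unique tendsto_const)
  let ?p = "\<lambda>x. cis (- (\<xi> \<bullet> x)) * complex_of_real (if x \<in> stadium then a1 x + b2 x else 0)"
  let ?q = "\<lambda>x. cis (- (\<xi> \<bullet> x)) * complex_of_real (\<xi> \<bullet> (indicator stadium x *\<^sub>R vector [m1 x, m2 x]))"
  have Fpq: "F x = ?p x - \<i> * ?q x" for x
    by (simp add: F_def \<phi>_def inner_2 algebra_simps)
  have pi: "integrable lborel ?p"
  proof (rule integrable_bounded_support[OF _ _ bounded_stadium])
    have [measurable]: "(\<lambda>x. if x \<in> stadium then a1 x + b2 x else 0) \<in> borel_measurable borel"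
      by (rule measurable_on_stadium) (intro continuous_intros c)
    show "?p \<in> borel_measurable borel" by measurable
    show "cmod (?p x) \<le> 2 * K" for x
      using bd(3,4)[of x] K0 by (auto simp: norm_mult simp del: of_real_add)
  qed auto
  have Fi: "integrable lborel F"
    by (rule integrable_bounded_support[OF Fm Fb bounded_stadium]) (simp add: F_def)
  have "?q = (\<lambda>x. \<i> * (F x - ?p x))" unfolding Fpq by (auto simp: fun_eq_iff algebra_simps)
  then have qi: "integrable lborel ?q" using Fi pi by simp
  have "(LINT x|lborel. F x) = (LINT x|lborel. ?p x) - \<i> * (LINT x|lborel. ?q x)"
    unfolding Fpq using pi qi by simp
  then show ?thesis using F0 by simp
qed

section \<open>Traces, and the energy of a vortex\<close>

lemma C1_on_has_derivative:
  assumes "C1_on S f" "x \<in> S"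
  shows "(f has_derivative frechet_derivative f (at x)) (at x)"
  using assms unfolding C1_on_def by (metis frechet_derivative_works)

text \<open>Strict star-shapedness about the origin: dilations push the closure into the open
  stadium. It supplies the approximants for the trace.\<close>

lemma scaleR_closure_stadium:
  assumes x: "x \<in> closure stadium" and l: "0 \<le> l" "l < 1"
  shows "l *\<^sub>R x \<in> stadium"
proof -
  have "\<bar>stadium_normal (l *\<^sub>R x) $ 1\<bar> \<le> l * \<bar>stadium_normal x $ 1\<bar>"
  proof -
    have "l * x $ 1 - 1 \<le> l * (x $ 1 - 1)" "- (l * x $ 1) - 1 \<le> l * (- (x $ 1) - 1)"
      using l by (auto simp: algebra_simps)
    moreover have "0 \<le> l * max 0 (x $ 1 - 1)" "l * (x $ 1 - 1) \<le> l * max 0 (x $ 1 - 1)"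
      "0 \<le> l * max 0 (- (x $ 1) - 1)" "l * (- (x $ 1) - 1) \<le> l * max 0 (- (x $ 1) - 1)"
      using l by (auto intro!: mult_left_mono)
    ultimately have m: "max 0 (l * x $ 1 - 1) \<le> l * max 0 (x $ 1 - 1)" "max 0 (- (l * x $ 1) - 1) \<le> l * max 0 (- (x $ 1) - 1)"
      by auto
    have a: "\<bar>max 0 (u - 1) - max 0 (- u - 1)\<bar> = max 0 (u - 1) + max 0 (- u - 1)" for u :: real
      by (auto simp: max_def)
    show ?thesis
      using add_mono[OF m] unfolding stadium_normal_1 a by (simp only: vector_scaleR_component real_scaleR_def distrib_left)
  qed
  then have "(stadium_normal (l *\<^sub>R x) $ 1)\<^sup>2 \<le> (l * \<bar>stadium_normal x $ 1\<bar>)\<^sup>2"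
    by (metis abs_ge_zero power2_abs power_mono)
  then have "normal_sq (l *\<^sub>R x) \<le> l\<^sup>2 * normal_sq x"
    unfolding normal_sq_eq norm_2 by (simp add: stadium_normal_2 power_mult_distrib distrib_left)
  also have "\<dots> \<le> l\<^sup>2 * 1" using x by (intro mult_left_mono) (auto simp: closure_stadium)
  also have "\<dots> < 1" using l by (simp add: abs_square_less_1)
  finally show ?thesis by (simp add: stadium_iff)
qed

lemma finite_measure_stadium_arclength: "emeasure stadium_arclength (space stadium_arclength) < \<infinity>"
proof -
  have [measurable]: "stadium_curve \<in> measurable (restrict_space lborel {0..<2 * pi + 4}) borel"
    using stadium_curve_measurable by (intro measurable_restrict_space1) auto
  have "emeasure stadium_arclength (space stadium_arclength) = emeasure (restrict_space lborel {0..<2 * pi + 4}) (space (restrict_space lborel {0..<2 * pi + 4}))"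
    unfolding stadium_arclength_def by (subst emeasure_distr) auto
  also have "\<dots> = emeasure lborel {0..<2 * pi + 4}"
    by (subst emeasure_restrict_space) (auto simp: space_restrict_space)
  finally show ?thesis by (simp add: emeasure_lborel_Ico)
qed

lemma nn_integral_tendsto_0:
  fixes f :: "nat \<Rightarrow> 'a \<Rightarrow> real"
  assumes m: "\<And>k. (\<lambda>x. indicator S x * f k x) \<in> borel_measurable M"
    and b: "\<And>k x. x \<in> S \<Longrightarrow> 0 \<le> f k x \<and> f k x \<le> C"
    and S: "S \<in> sets M" "emeasure M S < \<infinity>"
    and lim: "\<And>x. x \<in> S \<Longrightarrow> (\<lambda>k. f k x) \<longlonglongrightarrow> 0"
  shows "(\<lambda>k. \<integral>\<^sup>+x\<in>S. ennreal (f k x) \<partial>M) \<longlonglongrightarrow> 0"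
proof -
  have "(\<lambda>k. \<integral>\<^sup>+x. ennreal (indicator S x * f k x) \<partial>M) \<longlonglongrightarrow> (\<integral>\<^sup>+x. 0 \<partial>M)"
  proof (rule nn_integral_dominated_convergence[where w = "\<lambda>x. ennreal C * indicator S x"])
    show "(\<lambda>x. ennreal (indicator S x * f k x)) \<in> borel_measurable M" for k using m by simp
    show "(\<lambda>x. ennreal C * indicator S x) \<in> borel_measurable M" using S by simp
    show "AE x in M. ennreal (indicator S x * f k x) \<le> ennreal C * indicator S x" for k
      using b by (intro AE_I2) (auto simp: indicator_def intro!: ennreal_leI)
    show "(\<integral>\<^sup>+x. ennreal C * indicator S x \<partial>M) < \<infinity>"
      using S by (simp add: nn_integral_cmult_indicator ennreal_mult_less_top)
    show "AE x in M. (\<lambda>k. ennreal (indicator S x * f k x)) \<longlonglongrightarrow> 0"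
    proof (intro AE_I2)
      fix x
      show "(\<lambda>k. ennreal (indicator S x * f k x)) \<longlonglongrightarrow> 0"
        using lim[of x] by (cases "x \<in> S") (auto simp: tendsto_ennreal_iff[where x = 0, simplified] intro: tendsto_ennrealI[where x = 0, simplified])
    qed
  qed auto
  moreover have "(\<integral>\<^sup>+x. ennreal (indicator S x * f k x) \<partial>M) = (\<integral>\<^sup>+x\<in>S. ennreal (f k x) \<partial>M)" for k
    by (intro nn_integral_cong) (auto simp: indicator_def)
  ultimately show ?thesis by simp
qed

text \<open>The approximants are m(l_k x) with l_k increasing to 1; they are C^1 on a neighbourhood
  of the closure although \<open>m\<close> is C^1 only inside. The gradient bound and the continuity
  on the closure give dominated convergence, both in the interior and on the boundary curve.\<close>

lemma stadium_has_trace: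
  fixes m :: "real^2 \<Rightarrow> real^3"
  assumes C1: "C1_on stadium m" and cl: "continuous_on (closure stadium) m"
    and gb: "\<And>x. x \<in> stadium \<Longrightarrow> grad_sq m x \<le> K"
  shows "has_trace stadium_arclength stadium m (\<lambda>x. if x \<in> closure stadium then m x else 0)"
proof -
  define l where "l = (\<lambda>k::nat. 1 - 1 / (real k + 2))"
  have l: "0 \<le> l k" "l k < 1" for k by (auto simp: l_def field_simps)
  have ll: "l \<longlonglongrightarrow> 1" unfolding l_def by real_asymp
  define w where "w = (\<lambda>k x. m (l k *\<^sub>R x))"
  define U where "U = (\<lambda>k. (\<lambda>x. l k *\<^sub>R x) -` stadium)"
  define Dm where "Dm = (\<lambda>x. frechet_derivative m (at x))"
  have clU: "closure stadium \<subseteq> U k" for k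
    using scaleR_closure_stadium l by (auto simp: U_def)
  have stU: "x \<in> U k" if "x \<in> stadium" for x k using clU closure_subset that by blast
  have lst: "l k *\<^sub>R x \<in> stadium" if "x \<in> closure stadium" for x k
    using clU[of k] that by (auto simp: U_def)
  have lcl: "l k *\<^sub>R x \<in> closure stadium" if "x \<in> closure stadium" for x k
    using lst[OF that] closure_subset by blast
  have dm: "(m has_derivative Dm x) (at x)" if "x \<in> stadium" for x
    unfolding Dm_def by (rule C1_on_has_derivative[OF C1 that])
  have dw: "(w k has_derivative (\<lambda>h. Dm (l k *\<^sub>R x) (l k *\<^sub>R h))) (at x)" if "x \<in> U k" for k x
  proof -
    have "((\<lambda>x. l k *\<^sub>R x) has_derivative (\<lambda>h. l k *\<^sub>R h)) (at x)" by (auto intro!: derivative_eq_intros)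
    from has_derivative_compose[OF this dm] show ?thesis using that by (simp add: w_def U_def)
  qed
  have cDm: "continuous_on stadium (\<lambda>x. Dm x h)" for h
    using C1 by (simp add: C1_on_def Dm_def)
  have lin: "linear (Dm x)" if "x \<in> stadium" for x
    using dm[OF that] by (rule has_derivative_linear)
  have cDw: "continuous_on S (\<lambda>x. Dm (l k *\<^sub>R x) h)" if "S \<subseteq> U k" for S h k
    using that by (intro continuous_on_compose2[OF cDm] continuous_intros) (auto simp: U_def)
  have fw: "frechet_derivative (w k) (at x) = (\<lambda>h. l k *\<^sub>R Dm (l k *\<^sub>R x) h)" if "x \<in> U k" for k x
    using frechet_derivative_at[OF dw[OF that]] linear_scale[OF lin, of "l k *\<^sub>R x"] that by (auto simp: U_def fun_eq_iff)
  have "open (U k)" for k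
    unfolding U_def by (intro open_vimage open_stadium continuous_intros)
  moreover have C1w: "C1_on (U k) (w k)" for k
    unfolding C1_on_def
  proof (intro conjI ballI allI)
    show "w k differentiable at x" if "x \<in> U k" for x using dw[OF that] unfolding differentiable_def by blast
    have c: "continuous_on (U k) (\<lambda>x. l k *\<^sub>R Dm (l k *\<^sub>R x) h)" for h
      by (intro continuous_intros cDw) auto
    show "continuous_on (U k) (\<lambda>x. frechet_derivative (w k) (at x) h)" for h
      by (rule continuous_on_eq[OF c[of h]]) (simp add: fw)
  qed
  moreover have "(\<lambda>k. \<integral>\<^sup>+x\<in>stadium. ennreal ((norm (w k x - m x))\<^sup>2 + grad_sq (\<lambda>y. w k y - m y) x) \<partial>lborel) \<longlonglongrightarrow> 0"
  proof -
    have "bounded (m ` closure stadium)"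
      using bounded_stadium by (intro compact_imp_bounded compact_continuous_image cl) (simp add: compact_closure)
    then obtain B where B: "\<And>x. x \<in> closure stadium \<Longrightarrow> norm (m x) \<le> B" by (auto simp: bounded_iff)
    have gs: "grad_sq (\<lambda>y. w k y - m y) x = (\<Sum>e\<in>Basis. (norm (l k *\<^sub>R Dm (l k *\<^sub>R x) e - Dm x e))\<^sup>2)" if "x \<in> stadium" for k x
    proof -
      have "((\<lambda>y. w k y - m y) has_derivative (\<lambda>h. Dm (l k *\<^sub>R x) (l k *\<^sub>R h) - Dm x h)) (at x)"
        using stU that by (intro has_derivative_diff dw dm) auto
      note fd = frechet_derivative_at[OF this, symmetric]
      have "x \<in> closure stadium" using that closure_subset by blast
      from linear_scale[OF lin[OF lst[OF this]]]
      show ?thesis unfolding grad_sq_def fd by simp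
    qed
    have De: "(norm (Dm x e))\<^sup>2 \<le> K" if "x \<in> stadium" "e \<in> Basis" for x e
      using member_le_sum[of e Basis "\<lambda>e. (norm (Dm x e))\<^sup>2"] gb[OF that(1)] that(2) by (simp add: grad_sq_def Dm_def)
    have sq: "(norm (a - b))\<^sup>2 \<le> 2 * (norm a)\<^sup>2 + 2 * (norm b)\<^sup>2" for a b :: "real^3"
    proof -
      have "(norm (a - b))\<^sup>2 \<le> (norm a + norm b)\<^sup>2" by (intro power_mono norm_triangle_ineq4) auto
      also have "\<dots> \<le> 2 * (norm a)\<^sup>2 + 2 * (norm b)\<^sup>2"
        using zero_le_power2[of "norm a - norm b"] by (simp add: power2_eq_square algebra_simps)
      finally show ?thesis .
    qed
    define f where "f = (\<lambda>k x. (norm (w k x - m x))\<^sup>2 + (\<Sum>e\<in>Basis. (norm (l k *\<^sub>R Dm (l k *\<^sub>R x) e - Dm x e))\<^sup>2))"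
    have "(\<lambda>k. \<integral>\<^sup>+x\<in>stadium. ennreal (f k x) \<partial>lborel) \<longlonglongrightarrow> 0"
    proof (rule nn_integral_tendsto_0)
      show "(\<lambda>x. indicator stadium x * f k x) \<in> borel_measurable lborel" for k
      proof -
        have ss: "stadium \<subseteq> closure stadium" "stadium \<subseteq> U k" using closure_subset stU by blast+
        have "continuous_on stadium (\<lambda>x. m (l k *\<^sub>R x))"
          by (rule continuous_on_compose2[OF cl]) (use lcl ss in \<open>auto intro!: continuous_intros\<close>)
        then have "continuous_on stadium (f k)"
          unfolding f_def w_def by (intro continuous_intros cDw cDm ss continuous_on_subset[OF cl ss(1)])
        from borel_measurable_continuous_on_indicator[OF _ this] show ?thesis using open_stadium by simp
      qed
      show "stadium \<in> sets lborel" "emeasure lborel stadium < \<infinity>"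
        using open_stadium emeasure_bounded_finite[OF bounded_stadium] by auto
      fix x assume x: "x \<in> stadium"
      then have x': "x \<in> closure stadium" using closure_subset by blast
      show "0 \<le> f k x \<and> f k x \<le> 4 * B\<^sup>2 + (\<Sum>e\<in>(Basis::(real^2) set). 4 * K)" for k
      proof
        show "0 \<le> f k x" unfolding f_def by (intro add_nonneg_nonneg sum_nonneg) auto
        have "(norm (w k x - m x))\<^sup>2 \<le> 2 * (norm (w k x))\<^sup>2 + 2 * (norm (m x))\<^sup>2" by (rule sq)
        also have "\<dots> \<le> 2 * B\<^sup>2 + 2 * B\<^sup>2"
          unfolding w_def by (intro add_mono mult_left_mono power_mono B lcl x') auto
        finally have 1: "(norm (w k x - m x))\<^sup>2 \<le> 4 * B\<^sup>2" by simp
        have 2: "(norm (l k *\<^sub>R Dm (l k *\<^sub>R x) e - Dm x e))\<^sup>2 \<le> 4 * K" if e: "e \<in> Basis" for e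
        proof -
          have "(norm (l k *\<^sub>R Dm (l k *\<^sub>R x) e - Dm x e))\<^sup>2 \<le> 2 * (norm (l k *\<^sub>R Dm (l k *\<^sub>R x) e))\<^sup>2 + 2 * (norm (Dm x e))\<^sup>2" by (rule sq)
          also have "(norm (l k *\<^sub>R Dm (l k *\<^sub>R x) e))\<^sup>2 \<le> (1 * norm (Dm (l k *\<^sub>R x) e))\<^sup>2"
            unfolding norm_scaleR using l[of k] by (intro power_mono mult_right_mono) auto
          finally show ?thesis using De[OF x e] De[OF lst[OF x'] e, of k] by simp
        qed
        show "f k x \<le> 4 * B\<^sup>2 + (\<Sum>e\<in>(Basis::(real^2) set). 4 * K)"
          unfolding f_def by (intro add_mono 1 sum_mono 2)
      qed
      have lx: "(\<lambda>k. l k *\<^sub>R x) \<longlonglongrightarrow> x" using tendsto_scaleR[OF ll tendsto_const[of x]] by simp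
      have mx: "(\<lambda>k. w k x) \<longlonglongrightarrow> m x"
        unfolding w_def by (rule continuous_on_tendsto_compose[OF cl lx x']) (use lcl[OF x'] in auto)
      have Dx: "(\<lambda>k. l k *\<^sub>R Dm (l k *\<^sub>R x) e) \<longlonglongrightarrow> 1 *\<^sub>R Dm x e" for e
        by (intro tendsto_scaleR ll continuous_on_tendsto_compose[OF cDm lx x]) (use lst[OF x'] in auto)
      have "(\<lambda>k. f k x) \<longlonglongrightarrow> (norm (m x - m x))\<^sup>2 + (\<Sum>e\<in>Basis. (norm (1 *\<^sub>R Dm x e - Dm x e))\<^sup>2)"
        unfolding f_def by (intro tendsto_intros mx Dx)
      then show "(\<lambda>k. f k x) \<longlonglongrightarrow> 0" by simp
    qed
    moreover have "(\<integral>\<^sup>+x\<in>stadium. ennreal ((norm (w k x - m x))\<^sup>2 + grad_sq (\<lambda>y. w k y - m y) x) \<partial>lborel) = (\<integral>\<^sup>+x\<in>stadium. ennreal (f k x) \<partial>lborel)" for k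
      by (intro nn_integral_cong) (auto simp: indicator_def f_def gs)
    ultimately show ?thesis by simp
  qed
  moreover have "(\<lambda>k. \<integral>\<^sup>+x\<in>frontier stadium. ennreal ((norm (w k x - (if x \<in> closure stadium then m x else 0)))\<^sup>2) \<partial>stadium_arclength) \<longlonglongrightarrow> 0"
  proof -
    have fc: "x \<in> closure stadium" if "x \<in> frontier stadium" for x using that by (simp add: frontier_def)
    have "bounded (m ` closure stadium)"
      using bounded_stadium by (intro compact_imp_bounded compact_continuous_image cl) (simp add: compact_closure)
    then obtain B where B: "\<And>x. x \<in> closure stadium \<Longrightarrow> norm (m x) \<le> B" by (auto simp: bounded_iff)
    have sets: "sets stadium_arclength = sets borel" by (simp add: stadium_arclength_def)
    have "(\<lambda>k. \<integral>\<^sup>+x\<in>frontier stadium. ennreal ((norm (w k x - m x))\<^sup>2) \<partial>stadium_arclength) \<longlonglongrightarrow> 0"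
    proof (rule nn_integral_tendsto_0)
      show "(\<lambda>x. indicator (frontier stadium) x * (norm (w k x - m x))\<^sup>2) \<in> borel_measurable stadium_arclength" for k
      proof -
        have "continuous_on (frontier stadium) (\<lambda>x. (norm (w k x - m x))\<^sup>2)"
          unfolding w_def using fc lcl
          by (intro continuous_intros continuous_on_compose2[OF cl] continuous_on_subset[OF cl]) auto
        from borel_measurable_continuous_on_indicator[OF _ this]
        have "(\<lambda>x. indicator (frontier stadium) x * (norm (w k x - m x))\<^sup>2) \<in> borel_measurable borel" by simp
        then show ?thesis by (subst measurable_cong_sets[OF sets refl])
      qed
      show fs: "frontier stadium \<in> sets stadium_arclength" unfolding sets by simp
      have "emeasure stadium_arclength (frontier stadium) \<le> emeasure stadium_arclength (space stadium_arclength)"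
        by (rule emeasure_space)
      then show "emeasure stadium_arclength (frontier stadium) < \<infinity>"
        using finite_measure_stadium_arclength by (rule le_less_trans)
      fix x assume "x \<in> frontier stadium"
      then have x': "x \<in> closure stadium" by (rule fc)
      show "0 \<le> (norm (w k x - m x))\<^sup>2 \<and> (norm (w k x - m x))\<^sup>2 \<le> (B + B)\<^sup>2" for k
        unfolding w_def using B[OF x'] B[OF lcl[OF x'], of k]
        by (intro conjI zero_le_power2 power_mono order_trans[OF norm_triangle_ineq4] add_mono) auto
      have lx: "(\<lambda>k. l k *\<^sub>R x) \<longlonglongrightarrow> x" using tendsto_scaleR[OF ll tendsto_const[of x]] by simp
      have mx: "(\<lambda>k. w k x) \<longlonglongrightarrow> m x"
        unfolding w_def by (rule continuous_on_tendsto_compose[OF cl lx x']) (use lcl[OF x'] in auto)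
      have "(\<lambda>k. (norm (w k x - m x))\<^sup>2) \<longlonglongrightarrow> (norm (m x - m x))\<^sup>2"
        by (intro tendsto_intros mx)
      then show "(\<lambda>k. (norm (w k x - m x))\<^sup>2) \<longlonglongrightarrow> 0" by simp
    qed
    moreover have "(\<integral>\<^sup>+x\<in>frontier stadium. ennreal ((norm (w k x - (if x \<in> closure stadium then m x else 0)))\<^sup>2) \<partial>stadium_arclength) =
       (\<integral>\<^sup>+x\<in>frontier stadium. ennreal ((norm (w k x - m x))\<^sup>2) \<partial>stadium_arclength)" for k
      using fc by (intro nn_integral_cong) (auto simp: indicator_def)
    ultimately show ?thesis by simp
  qed
  moreover have "(\<lambda>x. if x \<in> closure stadium then m x else 0) \<in> borel_measurable borel"
  proof -
    have "(\<lambda>x. indicator (closure stadium) x *\<^sub>R m x) \<in> borel_measurable borel"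
      by (rule borel_measurable_continuous_on_indicator[OF _ cl]) simp
    moreover have "(\<lambda>x. if x \<in> closure stadium then m x else 0) = (\<lambda>x. indicator (closure stadium) x *\<^sub>R m x)"
      by (auto simp: indicator_def)
    ultimately show ?thesis by simp
  qed
  ultimately show ?thesis
    unfolding has_trace_def using clU by (intro conjI exI[of _ U] exI[of _ w] allI) auto
qed

text \<open>A layer-cake argument in place of polar coordinates: 1/r^2 is 1/R^2 plus the integral of
  2/t^3 over [r, R], and after Tonelli only areas of discs remain. Enlarging annuli to discs costs
  at most the additive pi.\<close>

lemma nn_integral_inverse_square_annulus:
  fixes c :: "real^2"
  assumes e: "0 < e" "e \<le> R"
  shows "(\<integral>\<^sup>+x. ennreal (1 / (norm (x - c))\<^sup>2) * indicator {x. e \<le> norm (x - c) \<and> norm (x - c) \<le> R} x \<partial>lborel)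
    \<le> ennreal (2 * pi * ln (R / e) + pi)"
proof -
  let ?k = "\<lambda>x t. ennreal (2 / t ^ 3) * indicator {e..R} t * indicator {x. norm (x - c) \<le> t} x"
  let ?h = "\<lambda>x. ennreal (1 / (norm (x - c))\<^sup>2) * indicator {x. e \<le> norm (x - c) \<and> norm (x - c) \<le> R} x"
  let ?b = "\<lambda>x. ennreal (1 / R\<^sup>2) * indicator (cball c R) x"
  have cb: "emeasure lborel (cball c t) = ennreal (pi * t\<^sup>2)" if "t \<ge> 0" for t
    using that by (simp add: emeasure_cball unit_ball_vol_2)
  have ind: "indicator {x. norm (x - c) \<le> t} x = (indicator (cball c t) x :: ennreal)" for x t
    by (simp add: indicator_def dist_norm norm_minus_commute)
  have "(\<integral>\<^sup>+x. ?h x \<partial>lborel) \<le>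
    (\<integral>\<^sup>+x. ?b x + (\<integral>\<^sup>+t. ?k x t \<partial>lborel) \<partial>lborel)"
  proof (intro nn_integral_mono)
    fix x :: "real^2"
    show "?h x \<le>
      ?b x + (\<integral>\<^sup>+t. ?k x t \<partial>lborel)"
    proof (cases "e \<le> norm (x - c) \<and> norm (x - c) \<le> R")
      case True
      define r where "r = norm (x - c)"
      have r: "0 < r" "e \<le> r" "r \<le> R" using True e by (auto simp: r_def)
      have "(\<integral>\<^sup>+t. ?k x t \<partial>lborel) =
        (\<integral>\<^sup>+t. ennreal (2 / t ^ 3) * indicator {r..R} t \<partial>lborel)"
        using r by (intro nn_integral_cong) (auto simp: indicator_def r_def)
      also have "\<dots> = ennreal ((- 1 / R\<^sup>2) - (- 1 / r\<^sup>2))"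
        using r by (intro nn_integral_FTC_Icc)
          (auto intro!: derivative_eq_intros simp: field_simps power2_eq_square power3_eq_cube)
      finally have I: "(\<integral>\<^sup>+t. ?k x t \<partial>lborel) = ennreal (1 / r\<^sup>2 - 1 / R\<^sup>2)" by simp
      have "1 / R\<^sup>2 \<le> 1 / r\<^sup>2" using r by (intro divide_left_mono power_mono) auto
      then have "ennreal (1 / R\<^sup>2) + ennreal (1 / r\<^sup>2 - 1 / R\<^sup>2) = ennreal (1 / r\<^sup>2)"
        by (subst ennreal_plus[symmetric]) auto
      then show ?thesis unfolding I using r True by (simp add: indicator_def dist_norm norm_minus_commute r_def)
    qed (auto simp: indicator_def)
  qed
  also have "\<dots> = (\<integral>\<^sup>+x. ?b x \<partial>lborel) + (\<integral>\<^sup>+x. (\<integral>\<^sup>+t. ?k x t \<partial>lborel) \<partial>lborel)"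
    by (rule nn_integral_add) (simp, simp add: indicator_def, measurable)
  also have "(\<integral>\<^sup>+x. ?b x \<partial>lborel) = ennreal (1 / R\<^sup>2) * ennreal (pi * R\<^sup>2)"
    using e by (simp add: nn_integral_cmult_indicator cb)
  also have "\<dots> = ennreal pi" using e by (subst ennreal_mult[symmetric]) auto
  also have "(\<integral>\<^sup>+x. (\<integral>\<^sup>+t. ?k x t \<partial>lborel) \<partial>lborel) =
     (\<integral>\<^sup>+t. (\<integral>\<^sup>+x. ?k x t \<partial>lborel) \<partial>lborel)"
    by (rule lborel_pair.Fubini') (simp add: indicator_def, measurable)
  also have "\<dots> = (\<integral>\<^sup>+t. ennreal (2 * pi / t) * indicator {e..R} t \<partial>lborel)"
  proof (intro nn_integral_cong)
    fix t :: real
    show "(\<integral>\<^sup>+x. ?k x t \<partial>lborel) = ennreal (2 * pi / t) * indicator {e..R} t"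
      using e unfolding ind
      by (subst nn_integral_cmult_indicator) 
        (auto simp: cb indicator_def ennreal_mult[symmetric] power2_eq_square power3_eq_cube)
  qed
  also have "\<dots> = ennreal (2 * pi * ln R - 2 * pi * ln e)"
    using e by (intro nn_integral_FTC_Icc) (auto intro!: derivative_eq_intros simp: field_simps)
  also have "ennreal pi + \<dots> = ennreal (2 * pi * ln (R / e) + pi)"
    using e by (subst ennreal_plus[symmetric]) (auto simp: ln_div algebra_simps)
  finally show ?thesis .
qed

section \<open>The wall profile\<close>

text \<open>For u \<ge> 0, u * ell u is the primitive of 1/max 1 u that vanishes at 0;
  \<open>ell\<close> is this primitive divided by u, without the singularity at 0.\<close>

definition ell :: "real \<Rightarrow> real" where
  "ell u = (1 + ln (max 1 u)) / max 1 u"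

definition ell' :: "real \<Rightarrow> real" where
  "ell' u = - ln (max 1 u) / (max 1 u)\<^sup>2"

lemma DERIV_ell: "(ell has_real_derivative ell' u) (at u)"
proof -
  have "((\<lambda>t. (1 + ln t) / t) has_real_derivative - ln t / t\<^sup>2) (at t)" if "1 \<le> t" for t :: real
    using that by (auto intro!: derivative_eq_intros simp: field_simps power2_eq_square)
  from DERIV_compose_max[of 1, OF this] show ?thesis
    unfolding ell_def[abs_def] ell'_def by simp
qed

lemma ell_pos: "0 < ell u" and ell_le_1: "ell u \<le> 1"
proof -
  show "0 < ell u" by (auto simp: ell_def intro!: divide_pos_pos add_pos_nonneg)
  have "0 < max 1 u" by (simp add: less_max_iff_disj)
  from ln_le_minus_one[OF this] have "1 + ln (max 1 u) \<le> max 1 u" by linarith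
  then show "ell u \<le> 1" by (simp add: ell_def)
qed

text \<open>\<open>\<delta>\<close> is the wall width, \<open>\<epsilon>\<close> the core radius; \<open>\<Lambda>\<close> is chosen such that \<open>v (\<plusminus>1) = 0\<close> below.\<close>
locale landau =
  fixes \<delta> \<epsilon> \<Lambda> :: real
  assumes \<delta>_pos: "0 < \<delta>" and \<delta>_le: "\<delta> \<le> 1 / 100" and \<Lambda>_def: "\<Lambda> = 1 / 2 - ln \<delta>" and \<Lambda>_ge: "\<Lambda> \<ge> 8"
    and \<epsilon>_pos: "0 < \<epsilon>" and \<epsilon>_le: "\<epsilon> \<le> \<delta> / 2"
begin

text \<open>The logarithm -ln |y| / \<Lambda> for |y| \<ge> \<delta>, continued for |y| \<le>
  \<delta> by the parabola with the same value and slope at \<delta>. The value at 0 is 1.\<close>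

definition v :: "real \<Rightarrow> real" where
  "v y = 1 - y\<^sup>2 / \<delta>\<^sup>2 * ell (y\<^sup>2 / \<delta>\<^sup>2) / (2 * \<Lambda>)"

definition v' :: "real \<Rightarrow> real" where
  "v' y = - y / (\<Lambda> * max (\<delta>\<^sup>2) (y\<^sup>2))"

text \<open>\<open>W\<close> is 1 - v^2 divided by y^2/(2 \<Lambda> \<delta>^2), that is, with the
  double zero at y = 0 removed. Solving v = Q / sqrt (y^2 + Q^2) for Q gives Q^2 = y^2 v^2 / (1 -
  v^2), which becomes regular in terms of \<open>W\<close>.\<close>

definition W :: "real \<Rightarrow> real" where
  "W y = (1 + v y) * ell (y\<^sup>2 / \<delta>\<^sup>2)"

definition W' :: "real \<Rightarrow> real" where
  "W' y = v' y * ell (y\<^sup>2 / \<delta>\<^sup>2) + (1 + v y) * (ell' (y\<^sup>2 / \<delta>\<^sup>2) * (2 * y / \<delta>\<^sup>2))"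

text \<open>
  \<open>Q\<close> is the solution of \<open>v y = Q y / sqrt (y\<^sup>2 + (Q y)\<^sup>2)\<close>, in a form without singularity at \<open>y = 0\<close>.
\<close>
definition Q :: "real \<Rightarrow> real" where
  "Q y = \<delta> * sqrt (2 * \<Lambda>) * (v y / sqrt (W y))"

definition Q' :: "real \<Rightarrow> real" where
  "Q' y = \<delta> * sqrt (2 * \<Lambda>) * (v' y / sqrt (W y) - v y * W' y / (2 * W y * sqrt (W y)))"

lemma v_small: "\<bar>y\<bar> \<le> \<delta> \<Longrightarrow> v y = 1 - y\<^sup>2 / (2 * \<Lambda> * \<delta>\<^sup>2)"
proof -
  assume "\<bar>y\<bar> \<le> \<delta>"
  then have "y\<^sup>2 \<le> \<delta>\<^sup>2" using abs_le_square_iff[of y \<delta>] \<delta>_pos by simp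
  then have "max 1 (y\<^sup>2 / \<delta>\<^sup>2) = 1" using \<delta>_pos by (simp add: max_def)
  then show ?thesis by (simp add: v_def ell_def)
qed

lemma v_large: "\<bar>y\<bar> \<ge> \<delta> \<Longrightarrow> v y = - ln \<bar>y\<bar> / \<Lambda>"
proof -
  assume y: "\<bar>y\<bar> \<ge> \<delta>"
  then have y0: "\<bar>y\<bar> > 0" using \<delta>_pos by linarith
  have "\<delta>\<^sup>2 \<le> y\<^sup>2" using abs_le_square_iff[of \<delta> y] y \<delta>_pos by simp
  then have "max 1 (y\<^sup>2 / \<delta>\<^sup>2) = y\<^sup>2 / \<delta>\<^sup>2" using \<delta>_pos by (simp add: max_def)
  moreover have "ln (y\<^sup>2 / \<delta>\<^sup>2) = 2 * ln \<bar>y\<bar> - 2 * ln \<delta>"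
    using y0 \<delta>_pos ln_realpow[of "\<bar>y\<bar>" 2] ln_realpow[of \<delta> 2] by (simp add: ln_div)
  ultimately have "v y = 1 - (1 + (2 * ln \<bar>y\<bar> - 2 * ln \<delta>)) / (2 * \<Lambda>)"
    using y0 \<delta>_pos by (simp add: v_def ell_def)
  also have "1 + (2 * ln \<bar>y\<bar> - 2 * ln \<delta>) = 2 * \<Lambda> + 2 * ln \<bar>y\<bar>" by (simp add: \<Lambda>_def)
  finally show ?thesis using \<Lambda>_ge by (simp add: field_simps)
qed

lemma max_sq: "max (\<delta>\<^sup>2) (y\<^sup>2) = (if \<bar>y\<bar> \<le> \<delta> then \<delta>\<^sup>2 else y\<^sup>2)"
  using abs_le_square_iff[of y \<delta>] \<delta>_pos by (auto simp: max_def)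

lemma max_sq_pos: "0 < max (\<delta>\<^sup>2) (y\<^sup>2)"
  using \<delta>_pos by (simp add: less_max_iff_disj)

lemma DERIV_sq_div: "((\<lambda>y. y\<^sup>2 / \<delta>\<^sup>2) has_real_derivative (2 * y / \<delta>\<^sup>2)) (at y)"
  by (intro DERIV_cdivide) (auto intro!: derivative_eq_intros)

lemma DERIV_v: "(v has_real_derivative v' y) (at y)"
proof -
  let ?u = "y\<^sup>2 / \<delta>\<^sup>2"
  have "((\<lambda>u. u * ell u) has_real_derivative (ell u + u * ell' u)) (at u)" for u
    by (auto intro!: derivative_eq_intros DERIV_ell)
  moreover note DERIV_sq_div
  ultimately have "((\<lambda>y. y\<^sup>2 / \<delta>\<^sup>2 * ell (y\<^sup>2 / \<delta>\<^sup>2)) has_real_derivative (ell ?u + ?u * ell' ?u) * (2 * y / \<delta>\<^sup>2)) (at y)"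
    by (rule DERIV_chain2)
  then have d: "(v has_real_derivative 0 - (ell ?u + ?u * ell' ?u) * (2 * y / \<delta>\<^sup>2) / (2 * \<Lambda>)) (at y)"
    unfolding v_def by (intro DERIV_diff DERIV_cdivide) auto
  have e: "ell ?u + ?u * ell' ?u = 1 / max 1 ?u"
  proof (cases "?u \<le> 1")
    case True
    then show ?thesis by (simp add: ell_def ell'_def max_def)
  next
    case False
    then show ?thesis by (simp add: ell_def ell'_def max_def field_simps power2_eq_square)
  qed
  have m: "max (\<delta>\<^sup>2) (y\<^sup>2) = \<delta>\<^sup>2 * max 1 ?u"
    using \<delta>_pos by (auto simp: max_def field_simps)
  have f: "0 - 1 / max 1 ?u * (2 * y / \<delta>\<^sup>2) / (2 * \<Lambda>) = - y / (\<Lambda> * (\<delta>\<^sup>2 * max 1 ?u))"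
    using \<Lambda>_ge by simp
  show ?thesis using d unfolding e f v'_def m .
qed

lemma v_nonneg: "\<bar>y\<bar> \<le> 1 \<Longrightarrow> 0 \<le> v y"
proof (cases "\<bar>y\<bar> \<le> \<delta>")
  case True
  then have "y\<^sup>2 \<le> \<delta>\<^sup>2" using abs_le_square_iff[of y \<delta>] \<delta>_pos by simp
  then have "y\<^sup>2 / (2 * \<Lambda> * \<delta>\<^sup>2) \<le> 1"
    using \<delta>_pos \<Lambda>_ge mult_mono[of 1 "2 * \<Lambda>" "y\<^sup>2" "\<delta>\<^sup>2"] by (simp add: divide_le_eq)
  with True show ?thesis by (simp add: v_small)
next
  case False
  assume "\<bar>y\<bar> \<le> 1"
  then have "ln \<bar>y\<bar> \<le> 0" using False \<delta>_pos by simp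
  with False \<Lambda>_ge show ?thesis by (simp add: v_large divide_le_0_iff)
qed

lemma v_le_1: "v y \<le> 1"
  unfolding v_def using ell_pos[of "y\<^sup>2 / \<delta>\<^sup>2"] \<Lambda>_ge by (simp add: mult_nonneg_nonneg)

lemma W_pos: "\<bar>y\<bar> \<le> 1 \<Longrightarrow> 0 < W y"
  unfolding W_def using v_nonneg[of y] ell_pos by (intro mult_pos_pos) auto

lemma DERIV_W: "(W has_real_derivative W' y) (at y)"
proof -
  from DERIV_chain2[OF DERIV_ell DERIV_sq_div]
  show ?thesis unfolding W_def W'_def
    by (auto intro!: derivative_eq_intros DERIV_v)
qed

lemma DERIV_Q: "\<bar>y\<bar> \<le> 1 \<Longrightarrow> (Q has_real_derivative Q' y) (at y)"
proof -
  assume "\<bar>y\<bar> \<le> 1"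
  then have W: "W y > 0" by (rule W_pos)
  show ?thesis unfolding Q_def Q'_def
    by (rule derivative_eq_intros DERIV_v DERIV_W refl | use W in force)+
      (use W in \<open>auto simp: field_simps\<close>)
qed

lemma continuous_ell: "continuous_on S ell" "continuous_on S ell'"
  unfolding ell_def[abs_def] ell'_def[abs_def] by (intro continuous_intros; auto simp: max_def)+

lemma continuous_v: "continuous_on S v"
  using DERIV_v by (meson DERIV_isCont continuous_at_imp_continuous_on)

lemma continuous_v': "continuous_on S v'"
  unfolding v'_def[abs_def] using max_sq_pos \<Lambda>_ge by (intro continuous_intros) (auto simp: less_le)

lemma continuous_Q: "continuous_on {-1..1} Q"
  by (intro continuous_at_imp_continuous_on ballI DERIV_isCont[OF DERIV_Q]) auto

lemma continuous_Q': "continuous_on {-1..1} Q'"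
proof -
  have W: "continuous_on {-1..1} W"
    by (intro continuous_at_imp_continuous_on ballI DERIV_isCont[OF DERIV_W])
  have W': "continuous_on {-1..1} W'"
    unfolding W'_def[abs_def] using \<delta>_pos
    by (intro continuous_intros continuous_v continuous_v' continuous_on_compose2[OF continuous_ell(1)[of UNIV]] continuous_on_compose2[OF continuous_ell(2)[of UNIV]]) auto
  have "W y \<noteq> 0" if "y \<in> {-1..1}" for y using W_pos[of y] that by (auto simp: abs_le_iff)
  then show ?thesis
    unfolding Q'_def[abs_def] by (intro continuous_intros continuous_v continuous_v' W W') auto
qed

lemma Q_even: "Q (- y) = Q y" and Q'_odd: "Q' (- y) = - Q' y" and v'_odd: "v' (- y) = - v' y"
proof -
  have "v (- y) = v y" "v' (- y) = - v' y" "W (- y) = W y" by (auto simp: v_def v'_def W_def)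
  moreover from this have "W' (- y) = - W' y" by (auto simp: W'_def algebra_simps)
  ultimately show "Q (- y) = Q y" "Q' (- y) = - Q' y" "v' (- y) = - v' y"
    by (auto simp: Q_def Q'_def algebra_simps)
qed

lemma Q_nonneg: "\<bar>y\<bar> \<le> 1 \<Longrightarrow> 0 \<le> Q y"
  unfolding Q_def using \<delta>_pos \<Lambda>_ge v_nonneg[of y] W_pos[of y] by simp

definition r0 :: "real \<Rightarrow> real" where
  "r0 y = sqrt (y\<^sup>2 + (Q y)\<^sup>2)"

lemma Q_sq: "\<bar>y\<bar> \<le> 1 \<Longrightarrow> (Q y)\<^sup>2 * W y = 2 * \<Lambda> * \<delta>\<^sup>2 * (v y)\<^sup>2"
  using W_pos[of y] \<Lambda>_ge by (simp add: Q_def power_mult_distrib power_divide)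

text \<open>The squared defining equation of \<open>Q\<close>. It follows from y^2 W = 2 \<Lambda>
  \<delta>^2 (1 - v^2) after cancelling \<open>W\<close>, which is positive.\<close>

lemma Q_sq_v: "\<bar>y\<bar> \<le> 1 \<Longrightarrow> (Q y)\<^sup>2 = (v y)\<^sup>2 * (y\<^sup>2 + (Q y)\<^sup>2)"
proof -
  assume y: "\<bar>y\<bar> \<le> 1"
  have "y\<^sup>2 * ell (y\<^sup>2 / \<delta>\<^sup>2) = 2 * \<Lambda> * \<delta>\<^sup>2 * (1 - v y)"
    using \<delta>_pos \<Lambda>_ge by (simp add: v_def)
  moreover have "y\<^sup>2 * W y = (1 + v y) * (y\<^sup>2 * ell (y\<^sup>2 / \<delta>\<^sup>2))"
    by (simp add: W_def mult_ac)
  ultimately have "y\<^sup>2 * W y = (1 + v y) * (2 * \<Lambda> * \<delta>\<^sup>2 * (1 - v y))" by simp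
  then have "y\<^sup>2 * W y = 2 * \<Lambda> * \<delta>\<^sup>2 * (1 - (v y)\<^sup>2)"
    by (simp add: algebra_simps power2_eq_square)
  then have "((v y)\<^sup>2 * (y\<^sup>2 + (Q y)\<^sup>2)) * W y = (v y)\<^sup>2 * (2 * \<Lambda> * \<delta>\<^sup>2 * (1 - (v y)\<^sup>2)) + (v y)\<^sup>2 * (2 * \<Lambda> * \<delta>\<^sup>2 * (v y)\<^sup>2)"
    using Q_sq[OF y] by (simp add: distrib_left distrib_right mult.assoc)
  also have "\<dots> = (Q y)\<^sup>2 * W y" unfolding Q_sq[OF y] by (simp add: algebra_simps)
  finally show ?thesis using W_pos[OF y] by simp
qed

text \<open>The maximum of 1 and u, times \<open>ell u\<close>, is 1 + ln (max 1 u) \<ge> 1 for u =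
  y^2/\<delta>^2, so \<open>W\<close> is at least 1 / max 1 u; moreover v \<le> 1.\<close>

lemma Q_sq_le: "\<bar>y\<bar> \<le> 1 \<Longrightarrow> (Q y)\<^sup>2 \<le> 2 * \<Lambda> * max (\<delta>\<^sup>2) (y\<^sup>2)"
proof -
  assume y: "\<bar>y\<bar> \<le> 1"
  let ?u = "y\<^sup>2 / \<delta>\<^sup>2"
  have m: "max (\<delta>\<^sup>2) (y\<^sup>2) = \<delta>\<^sup>2 * max 1 ?u"
    using \<delta>_pos by (auto simp: max_def field_simps)
  have "1 \<le> max 1 ?u * ell ?u"
  proof -
    have "max 1 ?u * ell ?u = 1 + ln (max 1 ?u)" by (simp add: ell_def)
    then show ?thesis by simp
  qed
  also have "\<dots> \<le> max 1 ?u * W y"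
    unfolding W_def using v_nonneg[OF y] ell_pos[of ?u] by (intro mult_left_mono) (auto simp: distrib_right)
  finally have "1 \<le> max 1 ?u * W y" .
  then have "(Q y)\<^sup>2 * 1 \<le> (Q y)\<^sup>2 * (max 1 ?u * W y)" by (intro mult_left_mono) auto
  also have "\<dots> = max 1 ?u * (2 * \<Lambda> * \<delta>\<^sup>2 * (v y)\<^sup>2)" using Q_sq[OF y] by (simp add: mult_ac)
  also have "\<dots> \<le> max 1 ?u * (2 * \<Lambda> * \<delta>\<^sup>2 * 1)"
    using v_nonneg[OF y] v_le_1[of y] \<Lambda>_ge by (intro mult_left_mono) (auto simp: power_le_one)
  finally show ?thesis using m by (simp add: mult_ac)
qed

lemma r0_sq: "(r0 y)\<^sup>2 = y\<^sup>2 + (Q y)\<^sup>2"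
  by (simp add: r0_def)

lemma r0_nonneg: "0 \<le> r0 y"
  by (simp add: r0_def)

text \<open>Only |y| \<le> \<delta> needs an argument: there v \<ge> 1/2 and W \<le> 2, so Q^2 \<ge>
  \<Lambda> \<delta>^2 / 4, and \<Lambda> is large. Together with \<open>r0_sq_le\<close>, r0^2 is
  comparable to the regularised y^2 up to a factor of order \<Lambda>.\<close>

lemma r0_sq_ge: "\<bar>y\<bar> \<le> 1 \<Longrightarrow> max (\<delta>\<^sup>2) (y\<^sup>2) \<le> (r0 y)\<^sup>2"
proof -
  assume y: "\<bar>y\<bar> \<le> 1"
  show ?thesis
  proof (cases "\<bar>y\<bar> \<le> \<delta>")
    case True
    then have "y\<^sup>2 \<le> \<delta>\<^sup>2" using abs_le_square_iff[of y \<delta>] \<delta>_pos by simp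
    then have "y\<^sup>2 / (2 * \<Lambda> * \<delta>\<^sup>2) \<le> 1 / 2"
      using \<delta>_pos \<Lambda>_ge mult_mono[of 1 "\<Lambda>" "y\<^sup>2" "\<delta>\<^sup>2"] by (simp add: divide_le_eq)
    then have v: "v y \<ge> 1 / 2" using True by (simp add: v_small)
    have "W y \<le> 2 * 1" unfolding W_def using v_le_1[of y] v ell_le_1 ell_pos by (intro mult_mono) (auto simp: less_imp_le)
    have "(1 / 2)\<^sup>2 \<le> (v y)\<^sup>2" using v by (intro power_mono) auto
    then have "2 * \<Lambda> * \<delta>\<^sup>2 * (1 / 2)\<^sup>2 \<le> (Q y)\<^sup>2 * W y"
      unfolding Q_sq[OF y] using \<Lambda>_ge by (intro mult_left_mono) auto
    also have "\<dots> \<le> (Q y)\<^sup>2 * 2" using \<open>W y \<le> 2 * 1\<close> by (intro mult_left_mono) auto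
    finally have "\<Lambda> / 4 * \<delta>\<^sup>2 \<le> (Q y)\<^sup>2" by (simp add: power2_eq_square)
    moreover have "1 * \<delta>\<^sup>2 \<le> \<Lambda> / 4 * \<delta>\<^sup>2" using \<Lambda>_ge by (intro mult_right_mono) auto
    ultimately have "\<delta>\<^sup>2 \<le> (Q y)\<^sup>2" by linarith
    then show ?thesis using True by (simp add: r0_sq max_sq add_increasing)
  next
    case False
    then show ?thesis by (simp add: max_sq r0_sq)
  qed
qed

lemma r0_ge: assumes "\<bar>y\<bar> \<le> 1" shows "\<delta> \<le> r0 y" "\<bar>y\<bar> \<le> r0 y" "0 < r0 y"
proof -
  have "\<delta>\<^sup>2 \<le> (r0 y)\<^sup>2" using r0_sq_ge[OF assms] by auto
  then show "\<delta> \<le> r0 y" by (rule power2_le_imp_le[OF _ r0_nonneg])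
  then show "0 < r0 y" using \<delta>_pos by linarith
  have "\<bar>y\<bar>\<^sup>2 \<le> (r0 y)\<^sup>2" using r0_sq_ge[OF assms] by auto
  then show "\<bar>y\<bar> \<le> r0 y" by (rule power2_le_imp_le[OF _ r0_nonneg])
qed

lemma r0_sq_le: "\<bar>y\<bar> \<le> 1 \<Longrightarrow> (r0 y)\<^sup>2 \<le> 3 * \<Lambda> * max (\<delta>\<^sup>2) (y\<^sup>2)"
proof -
  assume y: "\<bar>y\<bar> \<le> 1"
  have "y\<^sup>2 \<le> 1 * max (\<delta>\<^sup>2) (y\<^sup>2)" by simp
  also have "\<dots> \<le> \<Lambda> * max (\<delta>\<^sup>2) (y\<^sup>2)" using \<Lambda>_ge max_sq_pos[of y] by (intro mult_right_mono) auto
  finally show ?thesis using Q_sq_le[OF y] unfolding r0_sq by linarith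
qed

lemma v_eq_Q_r0: "\<bar>y\<bar> \<le> 1 \<Longrightarrow> v y = Q y / r0 y"
proof -
  assume y: "\<bar>y\<bar> \<le> 1"
  have "(Q y)\<^sup>2 = (v y * r0 y)\<^sup>2" using Q_sq_v[OF y] by (simp add: power_mult_distrib r0_sq)
  then have "Q y = v y * r0 y"
    using Q_nonneg[OF y] v_nonneg[OF y] r0_nonneg[of y] by (simp add: power2_eq_iff_nonneg)
  then show ?thesis using r0_ge(3)[OF y] by simp
qed

lemma v'_eq: assumes y: "\<bar>y\<bar> < 1" shows "v' y = y * (y * Q' y - Q y) / (r0 y) ^ 3"
proof -
  have r: "r0 y > 0" using r0_ge(3) y by simp
  have s: "y\<^sup>2 + (Q y)\<^sup>2 > 0" using r by (metis r0_sq zero_less_power)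
  have "(Q has_real_derivative Q' y) (at y)" using DERIV_Q y by simp
  then have "(r0 has_real_derivative (2 * y + 2 * Q y * Q' y) / (2 * r0 y)) (at y)"
    unfolding r0_def using s
    by (auto intro!: derivative_eq_intros simp: divide_simps)
  then have "((\<lambda>y. Q y / r0 y) has_real_derivative (Q' y * r0 y - Q y * ((2 * y + 2 * Q y * Q' y) / (2 * r0 y))) / (r0 y * r0 y)) (at y)"
    using r DERIV_Q[of y] y by (intro DERIV_divide) auto
  then have "(v has_real_derivative (Q' y * r0 y - Q y * ((2 * y + 2 * Q y * Q' y) / (2 * r0 y))) / (r0 y * r0 y)) (at y)"
    by (rule has_field_derivative_transform_within_open[of _ _ _ "{-1<..<1}"]) (use y in \<open>auto simp: v_eq_Q_r0\<close>)
  then have "v' y = (Q' y * r0 y - Q y * ((2 * y + 2 * Q y * Q' y) / (2 * r0 y))) / (r0 y * r0 y)"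
    by (rule DERIV_unique[OF DERIV_v])
  also have "\<dots> = (Q' y * (r0 y)\<^sup>2 - Q y * (y + Q y * Q' y)) / (r0 y) ^ 3"
    using r by (simp add: field_simps power2_eq_square power3_eq_cube)
  also have "\<dots> = y * (y * Q' y - Q y) / (r0 y) ^ 3"
    unfolding r0_sq by (simp add: algebra_simps power2_eq_square)
  finally show ?thesis .
qed

text \<open>This combination governs both the divergence and the gradient in the wall. Since v' is
  known explicitly, it can be read off from \<open>v'_eq\<close>.\<close>

lemma yQ'_Q: assumes y: "\<bar>y\<bar> < 1" shows "\<bar>y * Q' y - Q y\<bar> = (r0 y) ^ 3 / (\<Lambda> * max (\<delta>\<^sup>2) (y\<^sup>2))"
proof (cases "y = 0")
  \<comment> \<open>At 0 both sides of \<open>v'_eq\<close> vanish and the factor y cannot be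
    cancelled. Here the claim reduces to Q(0)^2 = \<Lambda> \<delta>^2 with r0(0) = Q(0).\<close>
  case True
  have "v 0 = 1" by (simp add: v_def)
  moreover have "W 0 = 2" by (simp add: W_def v_def ell_def)
  ultimately have "(Q 0)\<^sup>2 = \<Lambda> * \<delta>\<^sup>2" using Q_sq[of 0] by simp
  moreover have "r0 0 = Q 0" using Q_nonneg[of 0] by (simp add: r0_def)
  moreover have "Q 0 \<ge> 0" by (simp add: Q_nonneg)
  ultimately show ?thesis
    using True \<Lambda>_ge \<delta>_pos by (simp add: power3_eq_cube max_def field_simps) (simp add: power2_eq_square)
next
  case False
  have r: "r0 y > 0" using r0_ge(3) y by simp
  have "\<bar>y\<bar> / (\<Lambda> * max (\<delta>\<^sup>2) (y\<^sup>2)) = \<bar>v' y\<bar>"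
    using \<Lambda>_ge max_sq_pos[of y] by (simp add: v'_def abs_mult)
  also have "\<dots> = \<bar>y\<bar> * \<bar>y * Q' y - Q y\<bar> / (r0 y) ^ 3"
    unfolding v'_eq[OF y] using r by (simp add: abs_mult)
  finally have "\<bar>y\<bar> * (1 / (\<Lambda> * max (\<delta>\<^sup>2) (y\<^sup>2))) = \<bar>y\<bar> * (\<bar>y * Q' y - Q y\<bar> / (r0 y) ^ 3)" by simp
  then have "1 / (\<Lambda> * max (\<delta>\<^sup>2) (y\<^sup>2)) = \<bar>y * Q' y - Q y\<bar> / (r0 y) ^ 3"
    using False by (simp only: mult_cancel_left) auto
  then show ?thesis using r by (simp add: divide_eq_eq eq_divide_eq)
qed

text \<open>Needed for tangency: \<open>Q\<close> vanishes at least linearly at |y| = 1, with a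
  slope that keeps the wall away from the caps. For |y| \<ge> \<delta> the inequalities 1 - v^2
  \<ge> 1/(2 \<Lambda>) and |y| v \<le> (1 - |y|)/\<Lambda> give Q^2 \<le> (2/\<Lambda>) (1 -
  |y|)^2, and \<Lambda> \<ge> 8 yields the factor 1/2.\<close>

lemma Q_le: assumes y: "\<bar>y\<bar> \<le> 1" shows "Q y \<le> (1 - \<bar>y\<bar>) / 2"
proof (cases "\<bar>y\<bar> \<le> \<delta>")
  case True
  \<comment> \<open>In the centre of the wall Q^2 \<le> 2 \<Lambda> \<delta>^2 \<le> 2 \<delta>,
    which is tiny because \<delta> \<le> 1/100.\<close>
  have "- ln \<delta> \<le> 1 / \<delta> - 1" using ln_le_minus_one[of "1 / \<delta>"] \<delta>_pos by (simp add: ln_div)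
  then have "2 * \<Lambda> \<le> 2 / \<delta>" using \<Lambda>_def by (simp add: field_simps)
  then have "2 * \<Lambda> * \<delta>\<^sup>2 \<le> 2 / \<delta> * \<delta>\<^sup>2" by (intro mult_right_mono) auto
  also have "\<dots> = 2 * \<delta>" using \<delta>_pos by (simp add: power2_eq_square)
  also have "\<dots> \<le> (1 / 5)\<^sup>2" using \<delta>_le by (simp add: power2_eq_square)
  finally have "(Q y)\<^sup>2 \<le> (1 / 5)\<^sup>2" using Q_sq_le[OF y] True by (simp add: max_sq)
  then have "Q y \<le> 1 / 5" by (rule power2_le_imp_le) simp
  moreover have "\<bar>y\<bar> \<le> 1 / 100" using True \<delta>_le by (rule order_trans)
  ultimately show ?thesis by (simp add: field_simps)
next
  case False
  then have yp: "\<bar>y\<bar> > 0" using \<delta>_pos by linarith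
  have "(Q y)\<^sup>2 * (1 - (v y)\<^sup>2) = y\<^sup>2 * (v y)\<^sup>2"
    using Q_sq_v[OF y] by (simp add: algebra_simps)
  moreover have "1 / (2 * \<Lambda>) \<le> 1 - (v y)\<^sup>2"
  proof -
    have "ln \<delta> \<le> ln \<bar>y\<bar>" using False \<delta>_pos by simp
    then have "v y \<le> 1 - 1 / (2 * \<Lambda>)"
      using False \<Lambda>_ge \<Lambda>_def by (simp add: v_large field_simps)
    moreover have "(v y)\<^sup>2 \<le> v y" using v_nonneg[OF y] v_le_1[of y] by (simp add: power2_eq_square mult_left_le)
    ultimately show ?thesis by linarith
  qed
  then have "(Q y)\<^sup>2 * (1 / (2 * \<Lambda>)) \<le> (Q y)\<^sup>2 * (1 - (v y)\<^sup>2)" by (intro mult_left_mono) auto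
  moreover have "\<bar>y\<bar> * v y \<le> (1 - \<bar>y\<bar>) / \<Lambda>"
  proof -
    have "- ln \<bar>y\<bar> \<le> 1 / \<bar>y\<bar> - 1" using ln_le_minus_one[of "1 / \<bar>y\<bar>"] yp by (simp add: ln_div)
    then have "\<bar>y\<bar> * - ln \<bar>y\<bar> \<le> \<bar>y\<bar> * (1 / \<bar>y\<bar> - 1)" by (intro mult_left_mono) auto
    also have "\<dots> = 1 - \<bar>y\<bar>" using yp by (simp add: field_simps)
    finally show ?thesis using False \<Lambda>_ge by (simp add: v_large field_simps)
  qed
  then have "(\<bar>y\<bar> * v y)\<^sup>2 \<le> ((1 - \<bar>y\<bar>) / \<Lambda>)\<^sup>2" using v_nonneg[OF y] by (intro power_mono) auto
  ultimately have "(Q y)\<^sup>2 * (1 / (2 * \<Lambda>)) \<le> ((1 - \<bar>y\<bar>) / \<Lambda>)\<^sup>2" by (simp add: power_mult_distrib)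
  then have "(Q y)\<^sup>2 \<le> 2 * \<Lambda> * ((1 - \<bar>y\<bar>) / \<Lambda>)\<^sup>2"
    using \<Lambda>_ge by (simp add: divide_le_eq mult.commute)
  also have "\<dots> = (1 - \<bar>y\<bar>)\<^sup>2 * (2 / \<Lambda>)" using \<Lambda>_ge by (simp add: power2_eq_square field_simps)
  also have "\<dots> \<le> (1 - \<bar>y\<bar>)\<^sup>2 * (1 / 4)" using \<Lambda>_ge by (intro mult_left_mono) (auto simp: field_simps)
  also have "\<dots> = ((1 - \<bar>y\<bar>) / 2)\<^sup>2" by (simp add: power2_eq_square)
  finally show ?thesis by (rule power2_le_imp_le) (use y in auto)
qed

end

section \<open>Smoothing of the corners\<close>

text \<open>
  For \<open>\<sigma> > 0\<close> this is a \<open>C\<^sup>1\<close> approximation of \<open>max 0 t\<close> that is exact for \<open>|t| \<ge> \<sigma>\<close>; in this form the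
  division by zero makes it equal to \<open>max 0 t\<close> for \<open>\<sigma> = 0\<close>.
\<close>
definition soft :: "real \<Rightarrow> real \<Rightarrow> real" where
  "soft t \<sigma> = max 0 t + (max 0 (\<sigma> - \<bar>t\<bar>))\<^sup>2 / (4 * \<sigma>)"

text \<open>\<open>soft1\<close> and \<open>soft2\<close> are the partial derivatives of
  \<open>soft\<close> in t and in \<sigma> for \<sigma> > 0.\<close>

definition soft1 :: "real \<Rightarrow> real \<Rightarrow> real" where
  "soft1 t \<sigma> = (max 0 (t + \<sigma>) - max 0 (t - \<sigma>)) / (2 * \<sigma>)"

definition soft2 :: "real \<Rightarrow> real \<Rightarrow> real" where
  "soft2 t \<sigma> = (max 0 (t + \<sigma>) + max 0 (t - \<sigma>)) / (2 * \<sigma>) - ((max 0 (t + \<sigma>))\<^sup>2 - (max 0 (t - \<sigma>))\<^sup>2) / (4 * \<sigma>\<^sup>2)"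

text \<open>In this form \<open>soft t \<sigma>\<close> is the average of the positive part over
  [t - \<sigma>, t + \<sigma>], and it is C^1 in both arguments.\<close>

lemma soft_eq: "\<sigma> > 0 \<Longrightarrow> soft t \<sigma> = ((max 0 (t + \<sigma>))\<^sup>2 - (max 0 (t - \<sigma>))\<^sup>2) / (4 * \<sigma>)"
proof -
  assume s: "\<sigma> > 0"
  consider "t \<le> - \<sigma>" | "- \<sigma> \<le> t" "t \<le> 0" | "0 \<le> t" "t \<le> \<sigma>" | "\<sigma> \<le> t" by linarith
  then show ?thesis
    by cases (use s in \<open>auto simp: soft_def max_def abs_if field_simps power2_eq_square\<close>)
qed

lemma soft_ge: "0 \<le> \<sigma> \<Longrightarrow> \<sigma> \<le> t \<Longrightarrow> soft t \<sigma> = t" and soft_le: "0 \<le> \<sigma> \<Longrightarrow> t \<le> - \<sigma> \<Longrightarrow> soft t \<sigma> = 0"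
proof -
  show "0 \<le> \<sigma> \<Longrightarrow> \<sigma> \<le> t \<Longrightarrow> soft t \<sigma> = t" by (auto simp: soft_def max_def)
  assume "0 \<le> \<sigma>" "t \<le> - \<sigma>"
  then have "max 0 t = 0" "max 0 (\<sigma> - \<bar>t\<bar>) = 0" by auto
  then show "soft t \<sigma> = 0" by (simp add: soft_def)
qed

lemma soft_bounds: "0 \<le> \<sigma> \<Longrightarrow> t \<le> \<sigma> \<Longrightarrow> 0 \<le> soft t \<sigma> \<and> soft t \<sigma> \<le> \<sigma>"
proof (cases "\<sigma> = 0 \<or> t \<le> - \<sigma>")
  case True
  assume "0 \<le> \<sigma>" "t \<le> \<sigma>"
  with True have "t \<le> - \<sigma>" by auto
  with \<open>0 \<le> \<sigma>\<close> show ?thesis by (simp add: soft_le)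
next
  case False
  assume "0 \<le> \<sigma>" and t: "t \<le> \<sigma>"
  with False have s: "\<sigma> > 0" by auto
  have "soft t \<sigma> = (t + \<sigma>)\<^sup>2 / (4 * \<sigma>)" using t s False by (simp add: soft_eq max_def)
  moreover have "(t + \<sigma>)\<^sup>2 \<le> (2 * \<sigma>)\<^sup>2" using t False by (intro power_mono) auto
  ultimately show ?thesis using s by (simp add: divide_le_eq power2_eq_square)
qed

lemma soft1_ge: "0 < \<sigma> \<Longrightarrow> \<sigma> \<le> t \<Longrightarrow> soft1 t \<sigma> = 1" and soft1_le: "0 < \<sigma> \<Longrightarrow> t \<le> - \<sigma> \<Longrightarrow> soft1 t \<sigma> = 0"
  by (auto simp: soft1_def max_def)

lemma soft2_ge: "0 < \<sigma> \<Longrightarrow> \<sigma> \<le> t \<Longrightarrow> soft2 t \<sigma> = 0" and soft2_le: "0 < \<sigma> \<Longrightarrow> t \<le> - \<sigma> \<Longrightarrow> soft2 t \<sigma> = 0"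
  by (auto simp: soft2_def max_def field_simps power2_eq_square)

lemma soft1_bounds: "0 < \<sigma> \<Longrightarrow> 0 \<le> soft1 t \<sigma> \<and> soft1 t \<sigma> \<le> 1"
  by (auto simp: soft1_def max_def field_simps)

text \<open>In the transition zone \<open>soft2\<close> equals a - a^2 with a = (t + \<sigma>)/(2
  \<sigma>) in [0, 1].\<close>

lemma soft2_bounds: "0 < \<sigma> \<Longrightarrow> 0 \<le> soft2 t \<sigma> \<and> soft2 t \<sigma> \<le> 1 / 4"
proof (cases "\<bar>t\<bar> < \<sigma>")
  case True
  assume s: "0 < \<sigma>"
  define a where "a = (t + \<sigma>) / (2 * \<sigma>)"
  have "max 0 (t + \<sigma>) = t + \<sigma>" "max 0 (t - \<sigma>) = 0" using True by auto
  then have "soft2 t \<sigma> = a - a\<^sup>2"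
    by (simp add: soft2_def a_def power_divide power_mult_distrib)
  moreover have "0 \<le> a" "a \<le> 1" using True s by (auto simp: a_def field_simps)
  moreover have "0 \<le> (a - 1 / 2)\<^sup>2" by simp
  moreover have "a * a \<le> a" using calculation by (simp add: mult_left_le)
  ultimately show ?thesis by (simp add: power2_eq_square algebra_simps)
next
  case False
  assume s: "0 < \<sigma>"
  then show ?thesis using False soft2_ge[OF s, of t] soft2_le[OF s, of t] by (cases "t \<ge> \<sigma>") auto
qed

lemma has_derivative_soft:
  assumes t: "(t has_derivative T) (at x)" and s: "(\<sigma> has_derivative S) (at x)" and pos: "\<sigma> x > 0"
  shows "((\<lambda>x. soft (t x) (\<sigma> x)) has_derivative (\<lambda>h. soft1 (t x) (\<sigma> x) * T h + soft2 (t x) (\<sigma> x) * S h)) (at x)"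
proof -
  note d = has_derivative_compose[OF _ has_real_derivative_sq_pos[unfolded has_field_derivative_def]]
  let ?f = "\<lambda>x. ((max 0 (t x + \<sigma> x))\<^sup>2 - (max 0 (t x - \<sigma> x))\<^sup>2) / (4 * \<sigma> x)"
  have D: "(?f has_derivative (\<lambda>h. soft1 (t x) (\<sigma> x) * T h + soft2 (t x) (\<sigma> x) * S h)) (at x)"
    apply (rule has_derivative_eq_rhs)
     apply (rule has_derivative_divide' has_derivative_diff d has_derivative_add has_derivative_mult_right t s)+
    using pos apply simp
    using pos by (auto simp: fun_eq_iff soft1_def soft2_def field_simps power2_eq_square)
  have "isCont \<sigma> x" using s by (rule has_derivative_continuous)
  then have "eventually (\<lambda>y. \<sigma> y > 0) (nhds x)"
    using pos order_tendstoD(1)[of \<sigma> "\<sigma> x" "nhds x" 0] by (simp add: continuous_at tendsto_at_iff_tendsto_nhds)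
  then have "eventually (\<lambda>y. ?f y = soft (t y) (\<sigma> y)) (nhds x)"
    by (rule eventually_mono) (simp add: soft_eq)
  then obtain U where U: "open U" "x \<in> U" "\<And>y. y \<in> U \<Longrightarrow> ?f y = soft (t y) (\<sigma> y)"
    unfolding eventually_nhds by blast
  show ?thesis by (rule has_derivative_transform_within_open[OF D U])
qed

text \<open>The point is \<sigma> = 0, which occurs on the horizontal sides: the correction to the
  positive part is at most (2 \<sigma>)^2/(4 \<sigma>) = \<sigma> and so vanishes in the
  limit.\<close>

lemma continuous_on_soft:
  assumes t: "continuous_on S t" and s: "continuous_on S \<sigma>" and nn: "\<And>x. x \<in> S \<Longrightarrow> 0 \<le> \<sigma> x"
  shows "continuous_on S (\<lambda>x. soft (t x) (\<sigma> x))"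
proof -
  let ?R = "\<lambda>x. (max 0 (\<sigma> x - \<bar>t x\<bar>))\<^sup>2 / (4 * \<sigma> x)"
  have "continuous_on S (\<lambda>x. ?R x)"
    unfolding continuous_on_def
  proof
    fix x assume x: "x \<in> S"
    have ts: "(t \<longlongrightarrow> t x) (at x within S)" "(\<sigma> \<longlongrightarrow> \<sigma> x) (at x within S)"
      using t s x by (auto simp: continuous_on_def)
    show "((\<lambda>x. ?R x) \<longlongrightarrow> ?R x) (at x within S)"
    proof (cases "\<sigma> x = 0")
      case False
      then show ?thesis by (intro tendsto_intros ts) auto
    next
      case True
      have "((\<lambda>x. ?R x) \<longlongrightarrow> 0) (at x within S)"
      proof (rule tendsto_0_le[where K = 1 and f = \<sigma>])
        show "(\<sigma> \<longlongrightarrow> 0) (at x within S)" using ts(2) True by simp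
        show "eventually (\<lambda>x. norm (?R x) \<le> norm (\<sigma> x) * 1) (at x within S)"
          unfolding eventually_at_filter
        proof (rule always_eventually, intro allI impI)
          fix y assume "y \<in> S"
          then have s: "\<sigma> y \<ge> 0" by (rule nn)
          have "(max 0 (\<sigma> y - \<bar>t y\<bar>))\<^sup>2 \<le> (2 * \<sigma> y)\<^sup>2" using s by (intro power_mono) auto
          then show "norm (?R y) \<le> norm (\<sigma> y) * 1"
            using s by (auto simp: divide_le_eq power2_eq_square)
        qed
      qed
      with True show ?thesis by simp
    qed
  qed
  from continuous_on_add[OF continuous_on_max[OF continuous_on_const t] this]
  show ?thesis unfolding soft_def .
qed

section \<open>The vortex core\<close>

text \<open>\<open>core_sq Z = (1 - (max 0 (1 - Z))\<^sup>4) / Z\<close>, in a form without removable singularity.\<close>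
definition core_sq :: "real \<Rightarrow> real" where
  "core_sq Z = max 0 (1 - Z) + (max 0 (1 - Z))\<^sup>2 + (max 0 (1 - Z)) ^ 3 + 1 / max 1 Z"

definition core_sq' :: "real \<Rightarrow> real" where
  "core_sq' Z = - 2 * max 0 (1 - Z) - 3 * (max 0 (1 - Z))\<^sup>2 - 1 / (max 1 Z)\<^sup>2"

lemma DERIV_core_sq: "(core_sq has_real_derivative core_sq' Z) (at Z)"
proof -
  have l: "((\<lambda>Z. 1 - Z) has_real_derivative - 1) (at Z)" by (auto intro!: derivative_eq_intros)
  have "((\<lambda>t::real. t ^ 3) has_real_derivative 3 * t\<^sup>2) (at t)" for t
    by (auto intro!: derivative_eq_intros)
  from DERIV_compose_max[of 0, OF this]
  have c: "((\<lambda>t::real. (max 0 t) ^ 3) has_real_derivative 3 * (max 0 t)\<^sup>2) (at t)" for t by simp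
  \<comment> \<open>1/t has slope -1 at t = 1; adding t makes 1 a critical point, as
    \<open>DERIV_compose_max\<close> requires. The added summand comes from max 0 (1 - Z) = max 1 Z
    - Z.\<close>
  have "((\<lambda>t::real. 1 / t + t) has_real_derivative 1 - 1 / t\<^sup>2) (at t)" if "t \<ge> 1" for t
    using that by (auto intro!: derivative_eq_intros simp: power2_eq_square)
  from DERIV_compose_max[of 1, OF this]
  have i: "((\<lambda>t::real. 1 / max 1 t + max 1 t) has_real_derivative 1 - 1 / (max 1 t)\<^sup>2) (at t)" for t by simp
  have eq: "core_sq = (\<lambda>Z. (max 0 (1 - Z))\<^sup>2 + (max 0 (1 - Z)) ^ 3 + (1 / max 1 Z + max 1 Z) - Z)"
    by (auto simp: core_sq_def fun_eq_iff max_def)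
  show ?thesis
    apply (subst eq)
    apply (rule DERIV_cong)
     apply (rule i DERIV_diff DERIV_add DERIV_chain2[OF has_real_derivative_sq_pos l] DERIV_chain2[OF c l] DERIV_ident)+
    by (simp add: core_sq'_def)
qed

lemma core_sq_ge_1: "Z \<ge> 1 \<Longrightarrow> core_sq Z = 1 / Z" and core_sq'_ge_1: "Z \<ge> 1 \<Longrightarrow> core_sq' Z = - 1 / Z\<^sup>2"
  by (auto simp: core_sq_def core_sq'_def max_def)

lemma core_sq_pos: "core_sq Z > 0"
  by (auto simp: core_sq_def intro!: add_nonneg_pos)

lemma core_sq_bounds: "0 \<le> Z \<Longrightarrow> core_sq Z \<le> 4" and core_sq_le_1: "Z \<le> 1 \<Longrightarrow> 1 \<le> core_sq Z"
  and core_sq'_bounds: "0 \<le> Z \<Longrightarrow> \<bar>core_sq' Z\<bar> \<le> 6"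
proof -
  define a where "a = max 0 (1 - Z)"
  have i: "1 / max 1 Z \<le> 1" "0 \<le> 1 / max 1 Z" "1 / (max 1 Z)\<^sup>2 \<le> 1" "0 \<le> 1 / (max 1 Z)\<^sup>2"
    by (auto simp: divide_le_eq one_le_power)
  { assume "0 \<le> Z"
    then have a: "0 \<le> a" "a \<le> 1" by (auto simp: a_def)
    then have "a\<^sup>2 \<le> 1" "a ^ 3 \<le> 1" "0 \<le> a\<^sup>2" by (auto simp: power_le_one)
    then show "core_sq Z \<le> 4" "\<bar>core_sq' Z\<bar> \<le> 6"
      using a i unfolding core_sq_def core_sq'_def a_def[symmetric] abs_le_iff by linarith+ }
  assume "Z \<le> 1"
  then have "1 / max 1 Z = 1" by simp
  then show "1 \<le> core_sq Z" by (simp add: core_sq_def)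
qed

lemma core_sq_mult: "0 \<le> Z \<Longrightarrow> Z * core_sq Z = 1 - (max 0 (1 - Z)) ^ 4"
proof (cases "Z \<le> 1")
  case True
  then have "core_sq Z = (1 - Z) + (1 - Z)\<^sup>2 + (1 - Z) ^ 3 + 1" by (simp add: core_sq_def max_def)
  then have "Z * core_sq Z = Z * ((1 - Z) + (1 - Z)\<^sup>2 + (1 - Z) ^ 3 + 1)" by simp
  also have "\<dots> = 1 - (1 - Z) ^ 4" by (simp add: power2_eq_square power3_eq_cube power4_eq_xxxx algebra_simps)
  finally show ?thesis using True by (simp add: max_def)
next
  case False
  then show ?thesis by (simp add: core_sq_ge_1)
qed

lemma continuous_core_sq: "continuous_on S core_sq" "continuous_on S core_sq'"
  unfolding core_sq_def[abs_def] core_sq'_def[abs_def] by (intro continuous_intros; auto simp: max_def)+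

section \<open>The vector field\<close>

context landau
begin

text \<open>
  The smoothing width vanishes on the horizontal part of the boundary, where tangency must be exact;
  on the caps the smoothed corners stay inside the stadium.
\<close>
definition sg :: "real \<Rightarrow> real" where
  "sg y = \<delta> ^ 3 * (1 - y\<^sup>2)"

definition ta :: "real^2 \<Rightarrow> real" where "ta x = x $ 1 - Q (x $ 2) - 1"
definition tb :: "real^2 \<Rightarrow> real" where "tb x = Q (x $ 2) - x $ 1 - 1"

text \<open>With positive parts in place of \<open>soft\<close> this is the median of x1 - 1, Q and
  x1 + 1: \<open>ta\<close> measures how far Q lies below x1 - 1, and \<open>tb\<close> how far it
  lies above x1 + 1.\<close>

definition q :: "real^2 \<Rightarrow> real" where
  "q x = Q (x $ 2) + soft (ta x) (sg (x $ 2)) - soft (tb x) (sg (x $ 2))"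

definition qx :: "real^2 \<Rightarrow> real" where
  "qx x = soft1 (ta x) (sg (x $ 2)) + soft1 (tb x) (sg (x $ 2))"

text \<open>The contribution of the varying width \<open>sg\<close>, whose derivative is -2
  \<delta>^3 y, to the derivative of \<open>q\<close> in the second coordinate.\<close>

definition e2 :: "real^2 \<Rightarrow> real" where
  "e2 x = soft2 (ta x) (sg (x $ 2)) - soft2 (tb x) (sg (x $ 2))"

definition qy :: "real^2 \<Rightarrow> real" where
  "qy x = Q' (x $ 2) * (1 - qx x) - 2 * \<delta> ^ 3 * x $ 2 * e2 x"

definition Z :: "real^2 \<Rightarrow> real" where
  "Z x = ((x $ 2)\<^sup>2 + (q x)\<^sup>2) / \<epsilon>\<^sup>2"

definition Zx :: "real^2 \<Rightarrow> real" where "Zx x = 2 * q x * qx x / \<epsilon>\<^sup>2"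
definition Zy :: "real^2 \<Rightarrow> real" where "Zy x = 2 * (x $ 2 + q x * qy x) / \<epsilon>\<^sup>2"

text \<open>\<open>B\<close> stands for 1/r, with which it agrees outside the core, and is regular
  where r = 0. It fits \<open>m3\<close>: the in-plane part has squared length Z core_sq(Z) = 1 -
  m3^2.\<close>

definition B :: "real^2 \<Rightarrow> real" where "B x = sqrt (core_sq (Z x)) / \<epsilon>"
definition B' :: "real^2 \<Rightarrow> real" where "B' x = core_sq' (Z x) / (2 * sqrt (core_sq (Z x))) / \<epsilon>"

definition m1 :: "real^2 \<Rightarrow> real" where "m1 x = - (x $ 2) * B x"
definition m2 :: "real^2 \<Rightarrow> real" where "m2 x = q x * B x"
definition m3 :: "real^2 \<Rightarrow> real" where "m3 x = (max 0 (1 - Z x))\<^sup>2"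

definition m1x :: "real^2 \<Rightarrow> real" where "m1x x = - (x $ 2) * (B' x * Zx x)"
definition m1y :: "real^2 \<Rightarrow> real" where "m1y x = - B x - x $ 2 * (B' x * Zy x)"
definition m2x :: "real^2 \<Rightarrow> real" where "m2x x = qx x * B x + q x * (B' x * Zx x)"
definition m2y :: "real^2 \<Rightarrow> real" where "m2y x = qy x * B x + q x * (B' x * Zy x)"
definition m3x :: "real^2 \<Rightarrow> real" where "m3x x = - 2 * max 0 (1 - Z x) * Zx x"
definition m3y :: "real^2 \<Rightarrow> real" where "m3y x = - 2 * max 0 (1 - Z x) * Zy x"

definition field :: "real^2 \<Rightarrow> real^3" where
  "field x = vector [m1 x, m2 x, m3 x]"

lemma sg_pos: "\<bar>y\<bar> < 1 \<Longrightarrow> 0 < sg y" and sg_nonneg: "\<bar>y\<bar> \<le> 1 \<Longrightarrow> 0 \<le> sg y" and sg_le: "sg y \<le> \<delta> ^ 3"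
proof -
  show "0 < sg y" if "\<bar>y\<bar> < 1" using that \<delta>_pos by (simp add: sg_def abs_square_less_1)
  show "0 \<le> sg y" if "\<bar>y\<bar> \<le> 1" using that \<delta>_pos by (simp add: sg_def abs_square_le_1)
  show "sg y \<le> \<delta> ^ 3" using \<delta>_pos by (simp add: sg_def mult_left_le)
qed

lemma DERIV_sg: "(sg has_real_derivative - 2 * \<delta> ^ 3 * y) (at y)"
  unfolding sg_def by (auto intro!: derivative_eq_intros)

lemma has_grad_q:
  assumes x: "\<bar>x $ 2\<bar> < 1"
  shows "has_grad q (qx x) (qy x) x"
proof -
  have y: "((\<lambda>x::real^2. x $ 2) has_derivative (\<lambda>h. h $ 2)) (at x)" by (auto intro!: derivative_eq_intros)
  have Q: "((\<lambda>x. Q (x $ 2)) has_derivative (\<lambda>h. Q' (x $ 2) * h $ 2)) (at x)"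
    using has_derivative_compose[OF y DERIV_Q[unfolded has_field_derivative_def]] x by simp
  have s: "((\<lambda>x. sg (x $ 2)) has_derivative (\<lambda>h. (- 2 * \<delta> ^ 3 * x $ 2) * h $ 2)) (at x)"
    using has_derivative_compose[OF y DERIV_sg[unfolded has_field_derivative_def]] by simp
  have a: "(ta has_derivative (\<lambda>h. h $ 1 - Q' (x $ 2) * h $ 2)) (at x)"
    unfolding ta_def by (rule has_derivative_eq_rhs, (rule derivative_intros Q)+) simp
  have b: "(tb has_derivative (\<lambda>h. Q' (x $ 2) * h $ 2 - h $ 1)) (at x)"
    unfolding tb_def by (rule has_derivative_eq_rhs, (rule derivative_intros Q)+) simp
  note sp = sg_pos[OF x]
  show ?thesis
    unfolding has_grad_def q_def[abs_def]
    by (rule has_derivative_eq_rhs, rule has_derivative_diff[OF has_derivative_add[OF Q has_derivative_soft[OF a s sp]] has_derivative_soft[OF b s sp]])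
      (simp add: fun_eq_iff qx_def qy_def e2_def algebra_simps)
qed

lemma has_grad_Z:
  assumes x: "\<bar>x $ 2\<bar> < 1"
  shows "has_grad Z (Zx x) (Zy x) x"
  unfolding has_grad_def Z_def[abs_def]
  by (rule has_derivative_eq_rhs, (rule derivative_intros has_grad_q[OF x, unfolded has_grad_def])+)
    (use \<epsilon>_pos in \<open>auto simp: fun_eq_iff Zx_def Zy_def field_simps power2_eq_square\<close>)

lemma has_grad_B:
  assumes x: "\<bar>x $ 2\<bar> < 1"
  shows "has_grad B (B' x * Zx x) (B' x * Zy x) x"
proof -
  have "((\<lambda>z. sqrt (core_sq z) / \<epsilon>) has_real_derivative B' x) (at (Z x))"
    unfolding B'_def using core_sq_pos[of "Z x"] \<epsilon>_pos
    by (auto intro!: derivative_eq_intros DERIV_core_sq simp: field_simps)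
  from has_derivative_compose[OF has_grad_Z[OF x, unfolded has_grad_def] this[unfolded has_field_derivative_def]]
  show ?thesis unfolding has_grad_def B_def
    by (rule has_derivative_eq_rhs) (simp add: fun_eq_iff algebra_simps)
qed

lemma has_grad_m:
  assumes x: "\<bar>x $ 2\<bar> < 1"
  shows "has_grad m1 (m1x x) (m1y x) x" "has_grad m2 (m2x x) (m2y x) x" "has_grad m3 (m3x x) (m3y x) x"
proof -
  note d = has_grad_B[OF x, unfolded has_grad_def] has_grad_q[OF x, unfolded has_grad_def]
  show "has_grad m1 (m1x x) (m1y x) x"
    unfolding has_grad_def m1_def
    by (rule has_derivative_eq_rhs, (rule derivative_intros d)+) (simp add: fun_eq_iff m1x_def m1y_def algebra_simps)
  show "has_grad m2 (m2x x) (m2y x) x"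
    unfolding has_grad_def m2_def
    by (rule has_derivative_eq_rhs, (rule derivative_intros d)+) (simp add: fun_eq_iff m2x_def m2y_def algebra_simps)
  have "((\<lambda>z. (max 0 (1 - z))\<^sup>2) has_real_derivative 2 * max 0 (1 - z) * - 1) (at z)" for z :: real
    by (rule DERIV_chain2[OF has_real_derivative_sq_pos]) (auto intro!: derivative_eq_intros)
  from has_derivative_compose[OF has_grad_Z[OF x, unfolded has_grad_def] this[unfolded has_field_derivative_def]]
  show "has_grad m3 (m3x x) (m3y x) x"
    unfolding has_grad_def m3_def m3x_def m3y_def
    by (rule has_derivative_eq_rhs) (simp add: fun_eq_iff algebra_simps)
qed

definition strip :: "(real^2) set" where "strip = {x. \<bar>x $ 2\<bar> < 1}"

lemma continuous_strip:
  "continuous_on strip q" "continuous_on strip qx" "continuous_on strip qy" "continuous_on strip Z"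
  "continuous_on strip Zx" "continuous_on strip Zy" "continuous_on strip B" "continuous_on strip B'"
proof -
  have Qc: "continuous_on strip (\<lambda>x. Q (x $ 2))" "continuous_on strip (\<lambda>x. Q' (x $ 2))"
    by (rule continuous_on_compose2[OF continuous_Q] continuous_on_compose2[OF continuous_Q'];
      auto simp: strip_def intro!: continuous_intros)+
  have sc: "continuous_on strip (\<lambda>x. sg (x $ 2))" unfolding sg_def by (intro continuous_intros)
  have tc: "continuous_on strip ta" "continuous_on strip tb"
    unfolding ta_def[abs_def] tb_def[abs_def] by (intro continuous_intros Qc)+
  have s0: "sg (x $ 2) \<noteq> 0" if "x \<in> strip" for x using sg_pos[of "x $ 2"] that by (auto simp: strip_def)
  show q: "continuous_on strip q"
    by (rule has_grad_imp_continuous_on[OF has_grad_q]) (simp add: strip_def)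
  show qx: "continuous_on strip qx"
    unfolding qx_def[abs_def] soft1_def using s0 by (intro continuous_intros tc sc) auto
  have e2: "continuous_on strip e2"
    unfolding e2_def[abs_def] soft2_def using s0 by (intro continuous_intros tc sc) auto
  show qy: "continuous_on strip qy"
    unfolding qy_def[abs_def] by (intro continuous_intros Qc qx e2)
  show Z: "continuous_on strip Z" and "continuous_on strip Zx" "continuous_on strip Zy"
    unfolding Z_def[abs_def] Zx_def[abs_def] Zy_def[abs_def] using \<epsilon>_pos by (intro continuous_intros q qx qy; simp)+
  have c: "continuous_on strip (\<lambda>x. core_sq (Z x))" "continuous_on strip (\<lambda>x. core_sq' (Z x))"
    by (rule continuous_on_compose2[OF continuous_core_sq(1)[of UNIV] Z] continuous_on_compose2[OF continuous_core_sq(2)[of UNIV] Z]; simp)+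
  show "continuous_on strip B" "continuous_on strip B'"
    unfolding B_def[abs_def] B'_def[abs_def] using \<epsilon>_pos core_sq_pos by (intro continuous_intros c; auto simp: less_le)+
qed

lemma continuous_strip_m:
  "continuous_on strip m1x" "continuous_on strip m1y" "continuous_on strip m2x" "continuous_on strip m2y"
  "continuous_on strip m3x" "continuous_on strip m3y"
  unfolding m1x_def[abs_def] m1y_def[abs_def] m2x_def[abs_def] m2y_def[abs_def] m3x_def[abs_def] m3y_def[abs_def]
  by (intro continuous_intros continuous_strip)+

lemma norm_field: "norm (field x) = 1"
proof -
  have Z0: "Z x \<ge> 0" by (simp add: Z_def)
  have "(m1 x)\<^sup>2 + (m2 x)\<^sup>2 = ((x $ 2)\<^sup>2 + (q x)\<^sup>2) * (B x)\<^sup>2"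
    by (simp add: m1_def m2_def algebra_simps power2_eq_square)
  also have "(B x)\<^sup>2 = core_sq (Z x) / \<epsilon>\<^sup>2" using core_sq_pos[of "Z x"] by (simp add: B_def power_divide)
  also have "((x $ 2)\<^sup>2 + (q x)\<^sup>2) * \<dots> = Z x * core_sq (Z x)" by (simp add: Z_def)
  also have "\<dots> = 1 - (max 0 (1 - Z x)) ^ 4" by (rule core_sq_mult[OF Z0])
  finally show ?thesis
    by (simp add: field_def norm_3 m3_def power_even_eq[symmetric] flip: power_mult)
qed

lemma continuous_field_closed: "continuous_on {x. \<bar>x $ 2\<bar> \<le> 1} field"
proof -
  let ?S = "{x::real^2. \<bar>x $ 2\<bar> \<le> 1}"
  have Qc: "continuous_on ?S (\<lambda>x. Q (x $ 2))"
    by (rule continuous_on_compose2[OF continuous_Q]) (auto intro!: continuous_intros)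
  have sc: "continuous_on ?S (\<lambda>x. sg (x $ 2))" unfolding sg_def by (intro continuous_intros)
  have tc: "continuous_on ?S ta" "continuous_on ?S tb"
    unfolding ta_def[abs_def] tb_def[abs_def] by (intro continuous_intros Qc)+
  have q: "continuous_on ?S q"
    unfolding q_def[abs_def] by (intro continuous_intros continuous_on_soft tc sc Qc) (auto intro: sg_nonneg)
  have Z: "continuous_on ?S Z"
    unfolding Z_def[abs_def] using \<epsilon>_pos by (intro continuous_intros q; simp)
  have B: "continuous_on ?S B"
    unfolding B_def[abs_def] using \<epsilon>_pos
    by (intro continuous_intros continuous_on_compose2[OF continuous_core_sq(1)[of UNIV] Z]) auto
  show ?thesis
    unfolding field_def[abs_def] m1_def m2_def m3_def vector_3_axis by (intro continuous_intros B q Z)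
qed

end

section \<open>Pointwise bounds for the divergence, the gradient and the normal component\<close>

context landau
begin

definition active :: "real^2 \<Rightarrow> bool" where
  "active x \<longleftrightarrow> \<bar>x $ 1 - Q (x $ 2)\<bar> < 1 + sg (x $ 2)"

text \<open>As ta + tb = -2, a width below 1 keeps the two smoothing zones apart: at each point at
  most one corner of the median is being rounded.\<close>

lemma sg_lt_1: "sg y < 1"
proof -
  have "\<delta> ^ 3 < 1" using \<delta>_pos \<delta>_le by (intro power_less_one_iff[THEN iffD2]) auto
  then show ?thesis using sg_le[of y] by linarith
qed

lemma region_cases:
  obtains "sg (x $ 2) \<le> ta x" | "sg (x $ 2) \<le> tb x" | "active x"
proof -
  have "sg (x $ 2) \<le> ta x \<or> sg (x $ 2) \<le> tb x \<or> active x"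
    unfolding active_def ta_def tb_def by linarith
  then show ?thesis using that by blast
qed

lemma right_region:
  assumes y: "\<bar>x $ 2\<bar> \<le> 1" and r: "sg (x $ 2) \<le> ta x"
  shows "q x = x $ 1 - 1" and "\<bar>x $ 2\<bar> < 1 \<Longrightarrow> qx x = 1" and "\<bar>x $ 2\<bar> < 1 \<Longrightarrow> qy x = 0"
proof -
  have b: "tb x \<le> - sg (x $ 2)" using r sg_lt_1[of "x $ 2"] unfolding ta_def tb_def by linarith
  show "q x = x $ 1 - 1"
    unfolding q_def soft_ge[OF sg_nonneg[OF y] r] soft_le[OF sg_nonneg[OF y] b] by (simp add: ta_def)
  show qx: "qx x = 1" if y: "\<bar>x $ 2\<bar> < 1"
    unfolding qx_def soft1_ge[OF sg_pos[OF y] r] soft1_le[OF sg_pos[OF y] b] by simp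
  show "qy x = 0" if y: "\<bar>x $ 2\<bar> < 1"
    unfolding qy_def e2_def qx[OF y] soft2_ge[OF sg_pos[OF y] r] soft2_le[OF sg_pos[OF y] b] by simp
qed

lemma left_region:
  assumes y: "\<bar>x $ 2\<bar> \<le> 1" and r: "sg (x $ 2) \<le> tb x"
  shows "q x = x $ 1 + 1" and "\<bar>x $ 2\<bar> < 1 \<Longrightarrow> qx x = 1" and "\<bar>x $ 2\<bar> < 1 \<Longrightarrow> qy x = 0"
proof -
  have b: "ta x \<le> - sg (x $ 2)" using r sg_lt_1[of "x $ 2"] unfolding ta_def tb_def by linarith
  show "q x = x $ 1 + 1"
    unfolding q_def soft_ge[OF sg_nonneg[OF y] r] soft_le[OF sg_nonneg[OF y] b] by (simp add: tb_def)
  show qx: "qx x = 1" if y: "\<bar>x $ 2\<bar> < 1"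
    unfolding qx_def soft1_ge[OF sg_pos[OF y] r] soft1_le[OF sg_pos[OF y] b] by simp
  show "qy x = 0" if y: "\<bar>x $ 2\<bar> < 1"
    unfolding qy_def e2_def qx[OF y] soft2_ge[OF sg_pos[OF y] r] soft2_le[OF sg_pos[OF y] b] by simp
qed

lemma active_region:
  assumes y: "\<bar>x $ 2\<bar> \<le> 1" and a: "active x"
  shows "\<bar>q x - Q (x $ 2)\<bar> \<le> sg (x $ 2)"
    and "\<bar>x $ 2\<bar> < 1 \<Longrightarrow> 0 \<le> qx x \<and> qx x \<le> 1" and "\<bar>x $ 2\<bar> < 1 \<Longrightarrow> \<bar>e2 x\<bar> \<le> 1 / 4"
proof -
  have t: "ta x \<le> sg (x $ 2)" "tb x \<le> sg (x $ 2)" using a unfolding active_def ta_def tb_def by linarith+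
  show "\<bar>q x - Q (x $ 2)\<bar> \<le> sg (x $ 2)"
    using soft_bounds[OF sg_nonneg[OF y] t(1)] soft_bounds[OF sg_nonneg[OF y] t(2)] unfolding q_def by linarith
  have or: "ta x \<le> - sg (x $ 2) \<or> tb x \<le> - sg (x $ 2)" using sg_lt_1[of "x $ 2"] unfolding ta_def tb_def by linarith
  { assume y: "\<bar>x $ 2\<bar> < 1"
    show "0 \<le> qx x \<and> qx x \<le> 1"
      using or soft1_bounds[OF sg_pos[OF y], of "ta x"] soft1_bounds[OF sg_pos[OF y], of "tb x"]
        soft1_le[OF sg_pos[OF y], of "ta x"] soft1_le[OF sg_pos[OF y], of "tb x"] unfolding qx_def by auto
    show "\<bar>e2 x\<bar> \<le> 1 / 4"
      using soft2_bounds[OF sg_pos[OF y], of "ta x"] soft2_bounds[OF sg_pos[OF y], of "tb x"] unfolding e2_def by linarith }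
qed

definition r :: "real^2 \<Rightarrow> real" where
  "r x = sqrt ((x $ 2)\<^sup>2 + (q x)\<^sup>2)"

lemma r_sq: "(r x)\<^sup>2 = (x $ 2)\<^sup>2 + (q x)\<^sup>2" and r_nonneg: "0 \<le> r x"
  by (simp_all add: r_def)

lemma Z_eq: "Z x = (r x / \<epsilon>)\<^sup>2"
  by (simp add: Z_def r_sq power_divide)

text \<open>Away from the left rotation, q is either at least Q or within \<delta>^3 of Q, and
  \<delta>^3 \<le> \<delta>^2 r0 because r0 \<ge> \<delta>. The factor tends to 1, so the smoothing
  does not spoil the leading constant.\<close>

lemma r_ge_not_left:
  assumes y: "\<bar>x $ 2\<bar> \<le> 1" and nl: "\<not> sg (x $ 2) \<le> tb x"
  shows "(1 - \<delta>\<^sup>2) * r0 (x $ 2) \<le> r x"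
proof -
  from nl consider "sg (x $ 2) \<le> ta x" | "active x" using region_cases[of x] by blast
  then show ?thesis
  proof cases
    case 1
    then have "Q (x $ 2) \<le> q x" using right_region(1)[OF y 1] sg_nonneg[OF y] unfolding ta_def by linarith
    then have "r0 (x $ 2) \<le> r x" unfolding r0_def r_def using Q_nonneg[OF y] by (intro real_sqrt_le_mono add_left_mono power_mono) auto
    moreover have "(1 - \<delta>\<^sup>2) * r0 (x $ 2) \<le> 1 * r0 (x $ 2)" using r0_nonneg by (intro mult_right_mono) auto
    ultimately show ?thesis by simp
  next
    case 2
    have "sqrt ((x $ 2 + 0)\<^sup>2 + (q x + (Q (x $ 2) - q x))\<^sup>2) \<le> sqrt ((x $ 2)\<^sup>2 + (q x)\<^sup>2) + sqrt (0\<^sup>2 + (Q (x $ 2) - q x)\<^sup>2)"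
      by (rule real_sqrt_sum_squares_triangle_ineq)
    then have "r0 (x $ 2) \<le> r x + \<bar>Q (x $ 2) - q x\<bar>" by (simp add: r0_def r_def)
    moreover have "\<bar>Q (x $ 2) - q x\<bar> \<le> \<delta> ^ 3" using active_region(1)[OF y 2] sg_le[of "x $ 2"] by linarith
    moreover have "\<delta> ^ 3 \<le> \<delta>\<^sup>2 * r0 (x $ 2)"
      using r0_ge(1)[OF y] \<delta>_pos by (simp add: power3_eq_cube power2_eq_square mult_left_mono)
    ultimately show ?thesis by (simp add: algebra_simps)
  qed
qed

lemma \<delta>_sq_le: "\<delta>\<^sup>2 \<le> 1 / 10000"
proof -
  have "\<delta>\<^sup>2 \<le> (1 / 100)\<^sup>2" using \<delta>_pos \<delta>_le by (intro power_mono) auto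
  then show ?thesis by (simp add: power2_eq_square)
qed

text \<open>Here \<epsilon> \<le> \<delta>/2 \<le> r0/2 < r: the core does not reach beyond the left
  rotation, and elsewhere the formulas for Z \<ge> 1 apply.\<close>

lemma r_ge_half:
  assumes y: "\<bar>x $ 2\<bar> \<le> 1" and nl: "\<not> sg (x $ 2) \<le> tb x"
  shows "r0 (x $ 2) / 2 < r x" "1 \<le> Z x"
proof -
  have "1 / 2 * r0 (x $ 2) < (1 - \<delta>\<^sup>2) * r0 (x $ 2)"
    using \<delta>_sq_le r0_ge(3)[OF y] by (intro mult_strict_right_mono) auto
  with r_ge_not_left[OF y nl] show "r0 (x $ 2) / 2 < r x" by simp
  then have "\<epsilon> \<le> r x" using r0_ge(1)[OF y] \<epsilon>_le by linarith
  then have "1 \<le> r x / \<epsilon>" using \<epsilon>_pos by simp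
  then show "1 \<le> Z x" unfolding Z_eq by (rule one_le_power)
qed

definition G :: "real^2 \<Rightarrow> real" where
  "G x = (m1x x)\<^sup>2 + (m1y x)\<^sup>2 + (m2x x)\<^sup>2 + (m2y x)\<^sup>2 + (m3x x)\<^sup>2 + (m3y x)\<^sup>2"

text \<open>Outside the core the field is the planar unit vector (-x2, q)/r, so |grad m|^2 is the
  squared gradient of its angle, which is (-x2 qx, q - x2 qy)/r^2 up to sign.\<close>

lemma outer_formulas:
  assumes Z: "1 \<le> Z x"
  shows "G x = ((x $ 2 * qx x)\<^sup>2 + (q x - x $ 2 * qy x)\<^sup>2) / (r x) ^ 4"
    and "m1x x + m2y x = x $ 2 * (q x * qx x + x $ 2 * qy x - q x) / (r x) ^ 3"
    and "B x = 1 / r x"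
proof -
  have "r x \<noteq> 0" using Z by (auto simp: Z_eq)
  then have rp: "r x > 0" using r_nonneg[of x] by linarith
  show B: "B x = 1 / r x"
    using \<epsilon>_pos rp unfolding B_def core_sq_ge_1[OF Z] by (simp add: Z_eq real_sqrt_divide)
  have B': "B' x = - \<epsilon>\<^sup>2 / (2 * (r x) ^ 3)"
    using \<epsilon>_pos rp unfolding B'_def core_sq_ge_1[OF Z] core_sq'_ge_1[OF Z]
    by (simp add: Z_eq real_sqrt_divide field_simps power2_eq_square power3_eq_cube)
  have BZx: "B' x * Zx x = - q x * qx x / (r x) ^ 3" using \<epsilon>_pos by (simp add: B' Zx_def)
  have BZy: "B' x * Zy x = - (x $ 2 + q x * qy x) / (r x) ^ 3" using \<epsilon>_pos rp by (simp add: B' Zy_def field_simps)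
  have Bc: "B x = ((x $ 2)\<^sup>2 + (q x)\<^sup>2) / (r x) ^ 3"
    unfolding B r_sq[symmetric] using rp by (simp add: power2_eq_square power3_eq_cube)
  let ?y = "x $ 2"
  define T where "T = ?y * qy x - q x"
  have 1: "m1x x = q x * (?y * qx x) / (r x) ^ 3" unfolding m1x_def BZx by simp
  have 2: "m1y x = q x * T / (r x) ^ 3"
    unfolding m1y_def T_def BZy Bc using rp by (simp add: field_simps power2_eq_square)
  have 3: "m2x x = ?y * (?y * qx x) / (r x) ^ 3"
    unfolding m2x_def BZx Bc using rp by (simp add: field_simps power2_eq_square)
  have 4: "m2y x = ?y * T / (r x) ^ 3"
    unfolding m2y_def T_def BZy Bc using rp by (simp add: field_simps power2_eq_square)
  have 5: "m3x x = 0" "m3y x = 0" using Z by (auto simp: m3x_def m3y_def)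
  have "G x = (((q x)\<^sup>2 + ?y\<^sup>2) * ((?y * qx x)\<^sup>2 + T\<^sup>2)) / ((r x) ^ 3)\<^sup>2"
    unfolding G_def 1 2 3 4 5 by (simp add: power_mult_distrib power_divide add_divide_distrib[symmetric] algebra_simps)
  also have "(q x)\<^sup>2 + ?y\<^sup>2 = (r x)\<^sup>2" by (simp add: r_sq)
  also have "((r x)\<^sup>2 * ((?y * qx x)\<^sup>2 + T\<^sup>2)) / ((r x) ^ 3)\<^sup>2 = ((?y * qx x)\<^sup>2 + T\<^sup>2) / (r x) ^ 4"
    using rp by (simp add: power2_eq_square power3_eq_cube power4_eq_xxxx)
  finally show "G x = ((x $ 2 * qx x)\<^sup>2 + (q x - x $ 2 * qy x)\<^sup>2) / (r x) ^ 4"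
    unfolding T_def by (simp add: power2_commute)
  show "m1x x + m2y x = x $ 2 * (q x * qx x + x $ 2 * qy x - q x) / (r x) ^ 3"
    unfolding 1 4 T_def by (simp add: add_divide_distrib[symmetric] algebra_simps)
qed

definition F :: "real^2 \<Rightarrow> real" where
  "F x = m1x x + m2y x"

lemma F_right: "\<bar>x $ 2\<bar> < 1 \<Longrightarrow> sg (x $ 2) \<le> ta x \<Longrightarrow> F x = 0"
proof -
  assume y: "\<bar>x $ 2\<bar> < 1" and a: "sg (x $ 2) \<le> ta x"
  then have y': "\<bar>x $ 2\<bar> \<le> 1" by simp
  have "\<not> sg (x $ 2) \<le> tb x" using a sg_pos[OF y] unfolding ta_def tb_def by linarith
  then have "1 \<le> Z x" by (rule r_ge_half(2)[OF y'])
  from outer_formulas(2)[OF this] show "F x = 0"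
    using right_region[OF y' a] y by (simp add: F_def)
qed

text \<open>This includes the core: the field is a rotation about (-1, 0) whose amplitude
  \<open>B\<close> depends on the distance alone, so the terms from \<open>Zx\<close> and
  \<open>Zy\<close> cancel.\<close>

lemma F_left: "\<bar>x $ 2\<bar> < 1 \<Longrightarrow> sg (x $ 2) \<le> tb x \<Longrightarrow> F x = 0"
  using left_region[of x] by (simp add: F_def m1x_def m2y_def Zx_def Zy_def)

text \<open>The numerator of the divergence is (1 - qx) (y Q' - Q) plus a smoothing error E of size
  \<delta>^3. Since 0 \<le> 1 - qx \<le> 1, the first part is at most the wall charge |v'| up to the
  factor from \<open>r_ge_not_left\<close>.\<close>

lemma F_active:
  assumes y: "\<bar>x $ 2\<bar> < 1" and nl: "\<not> sg (x $ 2) \<le> tb x" and a: "active x"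
  shows "\<bar>F x\<bar> \<le> 1 / (1 - \<delta>\<^sup>2) ^ 3 * \<bar>v' (x $ 2)\<bar> + 16 * \<delta>"
proof -
  let ?w = "x $ 2 * Q' (x $ 2) - Q (x $ 2)"
  let ?y = "x $ 2"
  have y': "\<bar>?y\<bar> \<le> 1" using y by simp
  note Z = r_ge_half(2)[OF y' nl]
  have r0: "0 < r0 ?y" by (rule r0_ge(3)[OF y'])
  have k: "0 < 1 - \<delta>\<^sup>2" using \<delta>_sq_le by simp
  have rp: "0 < r x" using r_ge_half(1)[OF y' nl] r0 by linarith
  define M where "M = q x - Q ?y"
  have M: "\<bar>M\<bar> \<le> \<delta> ^ 3" using active_region(1)[OF y' a] sg_le[of ?y] by (simp add: M_def)
  have p: "0 \<le> 1 - qx x" "1 - qx x \<le> 1" and e: "\<bar>e2 x\<bar> \<le> 1 / 4"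
    using active_region(2,3)[OF y' a] y by auto
  define E where "E = - (1 - qx x) * M - 2 * \<delta> ^ 3 * (?y)\<^sup>2 * e2 x"
  have "q x * qx x + ?y * qy x - q x = (1 - qx x) * (?w) + E"
    by (simp add: qy_def M_def E_def algebra_simps power2_eq_square)
  then have F: "F x = ?y * ((1 - qx x) * (?w) + E) / (r x) ^ 3"
    unfolding F_def outer_formulas(2)[OF Z] by simp
  have E: "\<bar>E\<bar> \<le> 2 * \<delta> ^ 3"
  proof -
    have "\<bar>(1 - qx x) * M\<bar> \<le> 1 * \<delta> ^ 3" unfolding abs_mult using p M by (intro mult_mono) auto
    moreover have "\<bar>2 * \<delta> ^ 3 * (?y)\<^sup>2 * e2 x\<bar> \<le> (2 * \<delta> ^ 3 * 1) * (1 / 4)"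
    proof -
      have "?y\<^sup>2 \<le> 1" using y' by (simp add: abs_square_le_1)
      then have "2 * \<delta> ^ 3 * (?y)\<^sup>2 * \<bar>e2 x\<bar> \<le> (2 * \<delta> ^ 3 * 1) * (1 / 4)"
        using e \<delta>_pos by (intro mult_mono) auto
      then show ?thesis using \<delta>_pos by (simp add: abs_mult)
    qed
    moreover have "0 \<le> \<delta> ^ 3" using \<delta>_pos by simp
    ultimately show ?thesis unfolding E_def by linarith
  qed
  have "\<bar>F x\<bar> = \<bar>?y\<bar> * \<bar>(1 - qx x) * (?w) + E\<bar> / (r x) ^ 3"
    unfolding F using rp by (simp add: abs_mult)
  also have "\<dots> \<le> \<bar>?y\<bar> * (\<bar>?w\<bar> + 2 * \<delta> ^ 3) / (r x) ^ 3"
  proof (intro divide_right_mono mult_left_mono)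
    have "\<bar>(1 - qx x) * (?w)\<bar> \<le> 1 * \<bar>?w\<bar>"
      unfolding abs_mult using p by (intro mult_mono) auto
    then show "\<bar>(1 - qx x) * (?w) + E\<bar> \<le> \<bar>?w\<bar> + 2 * \<delta> ^ 3"
      using E by (intro order_trans[OF abs_triangle_ineq] add_mono) simp_all
  qed (use rp in auto)
  also have "\<dots> = \<bar>?y\<bar> * \<bar>?w\<bar> / (r x) ^ 3 + 2 * \<delta> ^ 3 * \<bar>?y\<bar> / (r x) ^ 3"
    by (simp add: distrib_left add_divide_distrib)
  also have "\<bar>?y\<bar> * \<bar>?w\<bar> / (r x) ^ 3 \<le> \<bar>?y\<bar> * \<bar>?w\<bar> / ((1 - \<delta>\<^sup>2) * r0 ?y) ^ 3"
    using r_ge_not_left[OF y' nl] k r0 rp by (intro divide_left_mono power_mono mult_pos_pos zero_less_power) auto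
  also have "\<dots> = 1 / (1 - \<delta>\<^sup>2) ^ 3 * \<bar>v' ?y\<bar>"
    unfolding v'_eq[OF y] using r0 by (simp add: abs_mult power_mult_distrib)
  \<comment> \<open>Of the three powers of \<delta> in the smoothing width, two are paired with r0
    \<ge> \<delta>, and |y| \<le> r0; this cancels r^3 \<ge> (r0/2)^3 and leaves one
    \<delta>.\<close>
  also have "2 * \<delta> ^ 3 * \<bar>?y\<bar> / (r x) ^ 3 \<le> 16 * \<delta>"
  proof -
    have "2 * \<delta> ^ 3 * \<bar>?y\<bar> \<le> 2 * \<delta> ^ 3 * r0 ?y"
      using r0_ge(2)[OF y'] \<delta>_pos by (intro mult_left_mono) auto
    also have "\<dots> = 2 * \<delta> * (\<delta> * \<delta> * r0 ?y)" by (simp add: power3_eq_cube)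
    also have "\<dots> \<le> 2 * \<delta> * (r0 ?y * r0 ?y * r0 ?y)"
      using \<delta>_pos r0_ge(1)[OF y'] by (intro mult_left_mono mult_mono) auto
    also have "\<dots> = 16 * \<delta> * (r0 ?y / 2) ^ 3" by (simp add: power3_eq_cube)
    also have "\<dots> \<le> 16 * \<delta> * (r x) ^ 3"
      using r_ge_half(1)[OF y' nl] \<delta>_pos r0 by (intro mult_left_mono power_mono) auto
    finally show ?thesis using rp by (simp add: divide_le_eq)
  qed
  finally show ?thesis by simp
qed

definition fbd :: "real \<Rightarrow> real" where
  "fbd y = 1 / (1 - \<delta>\<^sup>2) ^ 3 * \<bar>v' y\<bar> + 16 * \<delta>"

lemma F_bound:
  assumes y: "\<bar>x $ 2\<bar> < 1"
  shows "\<bar>F x\<bar> \<le> indicator {x. \<bar>x $ 1 - Q (x $ 2)\<bar> \<le> 1 + \<delta> ^ 3} x * fbd (x $ 2)"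
proof -
  have k: "0 < 1 - \<delta>\<^sup>2" using \<delta>_sq_le by simp
  have f0: "0 \<le> fbd (x $ 2)" unfolding fbd_def using k \<delta>_pos by simp
  consider "sg (x $ 2) \<le> tb x" | "\<not> sg (x $ 2) \<le> tb x" "sg (x $ 2) \<le> ta x" | "\<not> sg (x $ 2) \<le> tb x" "active x"
    using region_cases[of x] by blast
  then show ?thesis
  proof cases
    case 3
    then have "\<bar>x $ 1 - Q (x $ 2)\<bar> \<le> 1 + \<delta> ^ 3" using sg_le[of "x $ 2"] unfolding active_def by linarith
    then show ?thesis using F_active[OF y 3] by (simp add: fbd_def)
  qed (use F_left[OF y] F_right[OF y] f0 in auto)
qed

text \<open>The constant A for the Coulomb bound; it is (1 + o(1))/\<Lambda> as long as \<delta>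
  \<Lambda> tends to 0.\<close>

definition amp :: real where
  "amp = 1 / (1 - \<delta>\<^sup>2) ^ 3 / \<Lambda> + 16 * \<delta>"

lemma fbd_le: "\<bar>y\<bar> \<le> 1 \<Longrightarrow> y \<noteq> 0 \<Longrightarrow> fbd y \<le> amp / \<bar>y\<bar>"
proof -
  assume y: "\<bar>y\<bar> \<le> 1" "y \<noteq> 0"
  have k: "0 < 1 - \<delta>\<^sup>2" using \<delta>_sq_le by simp
  have "\<bar>v' y\<bar> \<le> 1 / \<Lambda> / \<bar>y\<bar>"
  proof -
    have "\<bar>v' y\<bar> = \<bar>y\<bar> / (\<Lambda> * max (\<delta>\<^sup>2) (y\<^sup>2))" using \<Lambda>_ge max_sq_pos[of y] by (simp add: v'_def abs_mult)
    also have "\<dots> \<le> \<bar>y\<bar> / (\<Lambda> * y\<^sup>2)" using \<Lambda>_ge y by (intro divide_left_mono mult_left_mono) (auto intro!: mult_pos_pos simp: less_max_iff_disj)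
    also have "\<dots> = 1 / \<Lambda> / \<bar>y\<bar>" using y \<Lambda>_ge by (simp add: power2_eq_square field_simps abs_if)
    finally show ?thesis .
  qed
  then have "1 / (1 - \<delta>\<^sup>2) ^ 3 * \<bar>v' y\<bar> \<le> 1 / (1 - \<delta>\<^sup>2) ^ 3 * (1 / \<Lambda> / \<bar>y\<bar>)"
    using k by (intro mult_left_mono) auto
  moreover have "16 * \<delta> \<le> 16 * \<delta> / \<bar>y\<bar>" using y \<delta>_pos by (simp add: le_divide_eq mult_left_le)
  ultimately show ?thesis by (simp add: fbd_def amp_def add_divide_distrib)
qed

lemma F_odd: "\<bar>x $ 2\<bar> < 1 \<Longrightarrow> F (reflect2 x) = - F x"
proof -
  have "ta (reflect2 x) = ta x" "tb (reflect2 x) = tb x" "sg (- (x $ 2)) = sg (x $ 2)"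
    by (auto simp: ta_def tb_def sg_def reflect2_def Q_even)
  then have q: "q (reflect2 x) = q x" "qx (reflect2 x) = qx x" "e2 (reflect2 x) = e2 x"
    by (auto simp: q_def qx_def e2_def reflect2_def Q_even)
  then have "qy (reflect2 x) = - qy x" by (simp add: qy_def reflect2_def Q'_odd algebra_simps)
  moreover from this q have "Z (reflect2 x) = Z x" "Zx (reflect2 x) = Zx x" "Zy (reflect2 x) = - Zy x"
    by (auto simp: Z_def Zx_def Zy_def reflect2_def minus_divide_left)
  ultimately show ?thesis using q by (simp add: F_def m1x_def m2y_def B_def B'_def reflect2_def)
qed

text \<open>A density of order 1/(\<delta>^2 + y^2) integrates to O(1/\<delta>). The delicate term
  is D = |y Q' - Q| = r0^3/(\<Lambda> X) with X the regularised y^2: D^2/r0^4 = r0^2/(\<Lambda>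
  X)^2, and the factor \<Lambda> in r0^2 \<le> 3 \<Lambda> X is outweighed by \<Lambda>^2.\<close>

lemma G_outer_bound:
  assumes y: "\<bar>x $ 2\<bar> < 1" and nl: "\<not> sg (x $ 2) \<le> tb x"
  shows "G x \<le> 800 / max (\<delta>\<^sup>2) ((x $ 2)\<^sup>2)"
proof -
  let ?y = "x $ 2" and ?X = "max (\<delta>\<^sup>2) ((x $ 2)\<^sup>2)"
  have y': "\<bar>?y\<bar> \<le> 1" using y by simp
  note Z = r_ge_half(2)[OF y' nl]
  have r0: "0 < r0 ?y" by (rule r0_ge(3)[OF y'])
  have rp: "0 < r x" using r_ge_half(1)[OF y' nl] r0 by linarith
  have X: "0 < ?X" by (rule max_sq_pos)
  have "(r0 ?y / 2) ^ 4 \<le> (r x) ^ 4" using r_ge_half(1)[OF y' nl] r0 by (intro power_mono) auto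
  then have r4: "(r0 ?y) ^ 4 / 16 \<le> (r x) ^ 4" by (simp add: power_divide)
  from nl consider "sg ?y \<le> ta x" | "active x" using region_cases[of x] by blast
  then show ?thesis
  proof cases
    case 1
    have "G x = (r x)\<^sup>2 / (r x) ^ 4"
      unfolding outer_formulas(1)[OF Z] using right_region(2,3)[OF y' 1 y] by (simp add: r_sq)
    also have "\<dots> = 1 / (r x)\<^sup>2" using rp by (simp add: power2_eq_square power4_eq_xxxx)
    also have "\<dots> \<le> 1 / (r0 ?y / 2)\<^sup>2"
      using r_ge_half(1)[OF y' nl] r0 by (intro divide_left_mono power_mono) auto
    also have "\<dots> = 4 / (r0 ?y)\<^sup>2" by (simp add: power_divide)
    also have "\<dots> \<le> 4 / ?X" using r0_sq_ge[OF y'] X r0 by (intro divide_left_mono) auto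
    also have "\<dots> \<le> 800 / ?X" using X by (intro divide_right_mono) auto
    finally show ?thesis .
  next
    case 2
    define M where "M = q x - Q ?y"
    have d3: "\<delta> ^ 3 \<le> r0 ?y"
    proof -
      have "\<delta> ^ 3 \<le> \<delta> ^ 1" using \<delta>_pos \<delta>_le by (intro power_decreasing) auto
      then show ?thesis using r0_ge(1)[OF y'] by simp
    qed
    have M: "\<bar>M\<bar> \<le> r0 ?y" using active_region(1)[OF y' 2] sg_le[of ?y] d3 unfolding M_def by linarith
    have p: "0 \<le> qx x" "qx x \<le> 1" and e: "\<bar>e2 x\<bar> \<le> 1 / 4"
      using active_region(2,3)[OF y' 2] y by auto
    have a: "(?y * qx x)\<^sup>2 \<le> (r0 ?y)\<^sup>2"
    proof -
      have "\<bar>?y * qx x\<bar> \<le> r0 ?y * 1" unfolding abs_mult using r0_ge(2)[OF y'] p r0 by (intro mult_mono) auto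
      then show ?thesis by (simp add: abs_le_square_iff[symmetric] r0_nonneg)
    qed
    define D where "D = \<bar>?y * Q' ?y - Q ?y\<bar>"
    have "q x - ?y * qy x = (1 - qx x) * (Q ?y - ?y * Q' ?y) + (qx x * Q ?y + M + 2 * \<delta> ^ 3 * ?y\<^sup>2 * e2 x)"
      by (simp add: qy_def M_def algebra_simps power2_eq_square)
    moreover have "\<bar>(1 - qx x) * (Q ?y - ?y * Q' ?y)\<bar> \<le> 1 * D"
      unfolding abs_mult D_def using p by (intro mult_mono) auto
    moreover have "\<bar>qx x * Q ?y\<bar> \<le> 1 * r0 ?y"
    proof -
      have "(Q ?y)\<^sup>2 \<le> (r0 ?y)\<^sup>2" by (simp add: r0_sq)
      then have "Q ?y \<le> r0 ?y" by (rule power2_le_imp_le[OF _ r0_nonneg])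
      then show ?thesis unfolding abs_mult using p Q_nonneg[OF y'] by (intro mult_mono) auto
    qed
    moreover have "\<bar>2 * \<delta> ^ 3 * ?y\<^sup>2 * e2 x\<bar> \<le> r0 ?y"
    proof -
      have "?y\<^sup>2 \<le> 1" using y' by (simp add: abs_square_le_1)
      then have "2 * \<delta> ^ 3 * ?y\<^sup>2 * \<bar>e2 x\<bar> \<le> (2 * \<delta> ^ 3 * 1) * (1 / 4)"
        using e \<delta>_pos by (intro mult_mono) auto
      moreover have "0 \<le> \<delta> ^ 3" using \<delta>_pos by simp
      ultimately have "2 * \<delta> ^ 3 * ?y\<^sup>2 * \<bar>e2 x\<bar> \<le> r0 ?y" using d3 by linarith
      then show ?thesis using \<delta>_pos by (simp add: abs_mult)
    qed
    ultimately have "\<bar>q x - ?y * qy x\<bar> \<le> D + 3 * r0 ?y" using M by linarith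
    then have "(q x - ?y * qy x)\<^sup>2 \<le> (D + 3 * r0 ?y)\<^sup>2"
      by (simp add: abs_le_square_iff[symmetric] D_def r0_nonneg)
    also have "\<dots> \<le> 2 * D\<^sup>2 + 18 * (r0 ?y)\<^sup>2"
      using zero_le_power2[of "D - 3 * r0 ?y"] by (simp add: power2_eq_square algebra_simps)
    finally have num: "(?y * qx x)\<^sup>2 + (q x - ?y * qy x)\<^sup>2 \<le> 2 * D\<^sup>2 + 19 * (r0 ?y)\<^sup>2" using a by linarith
    have "D = (r0 ?y) ^ 3 / (\<Lambda> * ?X)" unfolding D_def by (rule yQ'_Q[OF y])
    then have "2 * D\<^sup>2 = 2 * (r0 ?y)\<^sup>2 / (\<Lambda>\<^sup>2 * ?X\<^sup>2) * (r0 ?y) ^ 4"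
      using power_add[of "r0 ?y" 2 4] power_mult[of "r0 ?y" 3 2] by (simp add: power_divide power_mult_distrib)
    also have "\<dots> \<le> 2 * (3 * \<Lambda> * ?X) / (\<Lambda>\<^sup>2 * ?X\<^sup>2) * (r0 ?y) ^ 4"
      using r0_sq_le[OF y'] r0 by (intro mult_right_mono divide_right_mono mult_left_mono) auto
    also have "2 * (3 * \<Lambda> * ?X) / (\<Lambda>\<^sup>2 * ?X\<^sup>2) = 6 / (\<Lambda> * ?X)"
      using X \<Lambda>_ge by (simp add: power2_eq_square)
    also have "\<dots> \<le> 6 / (1 * ?X)" using X \<Lambda>_ge by (intro divide_left_mono mult_right_mono) auto
    finally have D2: "2 * D\<^sup>2 \<le> 6 / ?X * (r0 ?y) ^ 4" using r0 by (simp add: mult_right_mono)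
    have "19 * (r0 ?y)\<^sup>2 = 19 * (r0 ?y)\<^sup>2 * ?X / ?X" using X by simp
    also have "\<dots> \<le> 19 * (r0 ?y)\<^sup>2 * (r0 ?y)\<^sup>2 / ?X"
      using r0_sq_ge[OF y'] X by (intro divide_right_mono mult_left_mono) auto
    also have "\<dots> = 19 / ?X * (r0 ?y) ^ 4" by (simp add: power2_eq_square power4_eq_xxxx)
    finally have "(?y * qx x)\<^sup>2 + (q x - ?y * qy x)\<^sup>2 \<le> 25 / ?X * (r0 ?y) ^ 4"
      using num D2 by (simp add: add_divide_distrib[symmetric] field_simps)
    then have "G x \<le> 25 / ?X * (r0 ?y) ^ 4 / (r x) ^ 4"
      unfolding outer_formulas(1)[OF Z] using rp by (intro divide_right_mono) auto
    also have "\<dots> \<le> 25 / ?X * (r0 ?y) ^ 4 / ((r0 ?y) ^ 4 / 16)"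
      using r4 r0 rp X by (intro divide_left_mono) auto
    also have "\<dots> = 400 / ?X" using r0 by simp
    also have "\<dots> \<le> 800 / ?X" using X by (intro divide_right_mono) auto
    finally show ?thesis .
  qed
qed

definition vtx :: "real^2" where "vtx = vector [-1, 0]"

lemma r_left:
  assumes y: "\<bar>x $ 2\<bar> < 1" and l: "sg (x $ 2) \<le> tb x"
  shows "r x = norm (x - vtx)"
  using left_region(1)[OF _ l] y by (simp add: r_def norm_2 vtx_def add.commute)

text \<open>The field is an exact vortex outside the core. In the core each of the six partial
  derivatives is at most 8/\<epsilon>, whence 384 = 6 * 64.\<close>

lemma G_left_bound:
  assumes y: "\<bar>x $ 2\<bar> < 1" and l: "sg (x $ 2) \<le> tb x"
  shows "\<epsilon> \<le> r x \<Longrightarrow> G x = 1 / (r x)\<^sup>2" and "r x < \<epsilon> \<Longrightarrow> G x \<le> 384 / \<epsilon>\<^sup>2"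
proof -
  have y': "\<bar>x $ 2\<bar> \<le> 1" using y by simp
  have qq: "qx x = 1" "qy x = 0" using left_region(2,3)[OF y' l y] by auto
  { assume e: "\<epsilon> \<le> r x"
    then have "1 \<le> r x / \<epsilon>" using \<epsilon>_pos by simp
    then have "1 \<le> Z x" unfolding Z_eq by (rule one_le_power)
    from outer_formulas(1)[OF this] qq have "G x = (r x)\<^sup>2 / (r x) ^ 4" by (simp add: r_sq)
    then show "G x = 1 / (r x)\<^sup>2" using e \<epsilon>_pos by (simp add: power2_eq_square power4_eq_xxxx) }
  assume e: "r x < \<epsilon>"
  then have Z: "0 \<le> Z x" "Z x \<le> 1" unfolding Z_eq using r_nonneg[of x] \<epsilon>_pos by (auto intro!: power_le_one)
  have c: "1 \<le> sqrt (core_sq (Z x))" "sqrt (core_sq (Z x)) \<le> 2"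
    using core_sq_le_1[OF Z(2)] core_sq_bounds[OF Z(1)] by (auto simp: real_le_lsqrt)
  have B: "\<bar>B x\<bar> \<le> 2 / \<epsilon>" unfolding B_def using c \<epsilon>_pos by (simp add: divide_right_mono)
  have B': "\<bar>B' x\<bar> \<le> 3 / \<epsilon>"
  proof -
    have "\<bar>core_sq' (Z x)\<bar> / (2 * sqrt (core_sq (Z x))) \<le> 6 / (2 * 1)"
      using core_sq'_bounds[OF Z(1)] c by (intro frac_le mult_left_mono) auto
    from divide_right_mono[OF this, of \<epsilon>] show ?thesis
      unfolding B'_def using \<epsilon>_pos c by (simp add: abs_mult)
  qed
  have yq: "\<bar>x $ 2\<bar> \<le> \<epsilon>" "\<bar>q x\<bar> \<le> \<epsilon>"
  proof -
    have "\<bar>x $ 2\<bar> \<le> r x" "\<bar>q x\<bar> \<le> r x" unfolding r_def by (simp_all add: real_le_rsqrt)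
    then show "\<bar>x $ 2\<bar> \<le> \<epsilon>" "\<bar>q x\<bar> \<le> \<epsilon>" using e by auto
  qed
  have Zd: "\<bar>Zx x\<bar> \<le> 2 / \<epsilon>" "\<bar>Zy x\<bar> \<le> 2 / \<epsilon>"
    using yq \<epsilon>_pos by (auto simp: Zx_def Zy_def qq abs_mult power2_eq_square divide_le_eq)
  have t: "\<bar>w * (B' x * z)\<bar> \<le> 6 / \<epsilon>" if "\<bar>w\<bar> \<le> \<epsilon>" "\<bar>z\<bar> \<le> 2 / \<epsilon>" for w z
  proof -
    have "\<bar>w\<bar> * (\<bar>B' x\<bar> * \<bar>z\<bar>) \<le> \<epsilon> * (3 / \<epsilon> * (2 / \<epsilon>))"
      using that B' \<epsilon>_pos by (intro mult_mono) auto
    then show ?thesis using \<epsilon>_pos by (simp add: abs_mult)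
  qed
  have sq: "w\<^sup>2 \<le> 64 / \<epsilon>\<^sup>2" if "\<bar>w\<bar> \<le> 8 / \<epsilon>" for w
  proof -
    have "\<bar>w\<bar>\<^sup>2 \<le> (8 / \<epsilon>)\<^sup>2" using that by (intro power_mono) auto
    then show ?thesis by (simp add: power_divide)
  qed
  have e68: "6 / \<epsilon> \<le> 8 / \<epsilon>" "6 / \<epsilon> + 2 / \<epsilon> = 8 / \<epsilon>" "4 / \<epsilon> \<le> 8 / \<epsilon>" using \<epsilon>_pos by (auto simp: divide_right_mono add_divide_distrib[symmetric])
  have "\<bar>m1x x\<bar> \<le> 8 / \<epsilon>" using t[OF yq(1) Zd(1)] e68 unfolding m1x_def by simp
  moreover have "\<bar>m1y x\<bar> \<le> 8 / \<epsilon>" using t[OF yq(1) Zd(2)] e68 B unfolding m1y_def by linarith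
  moreover have "\<bar>m2x x\<bar> \<le> 8 / \<epsilon>" using t[OF yq(2) Zd(1)] e68 B unfolding m2x_def qq by linarith
  moreover have "\<bar>m2y x\<bar> \<le> 8 / \<epsilon>" using t[OF yq(2) Zd(2)] e68 unfolding m2y_def qq by simp
  moreover have m3: "\<bar>- 2 * max 0 (1 - Z x) * z\<bar> \<le> 8 / \<epsilon>" if "\<bar>z\<bar> \<le> 2 / \<epsilon>" for z
  proof -
    have "2 * max 0 (1 - Z x) * \<bar>z\<bar> \<le> 2 * 1 * (2 / \<epsilon>)" using Z that by (intro mult_mono) auto
    then show ?thesis using e68 by (simp add: abs_mult)
  qed
  moreover have "\<bar>m3x x\<bar> \<le> 8 / \<epsilon>" "\<bar>m3y x\<bar> \<le> 8 / \<epsilon>"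
    unfolding m3x_def m3y_def by (intro m3 Zd)+
  ultimately have "G x \<le> 64 / \<epsilon>\<^sup>2 + 64 / \<epsilon>\<^sup>2 + 64 / \<epsilon>\<^sup>2 + 64 / \<epsilon>\<^sup>2 + 64 / \<epsilon>\<^sup>2 + 64 / \<epsilon>\<^sup>2"
    unfolding G_def by (intro add_mono sq) auto
  then show "G x \<le> 384 / \<epsilon>\<^sup>2" by simp
qed

lemma m3_eq_0:
  assumes y: "\<bar>x $ 2\<bar> < 1" and f: "\<epsilon> \<le> norm (x - vtx)"
  shows "m3 x = 0"
proof -
  have "1 \<le> Z x"
  proof (cases "sg (x $ 2) \<le> tb x")
    case True
    then have "1 \<le> r x / \<epsilon>" using r_left[OF y True] f \<epsilon>_pos by simp
    then show ?thesis unfolding Z_eq by (rule one_le_power)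
  next
    case False
    then show ?thesis using r_ge_half(2)[of x] y by simp
  qed
  then show ?thesis by (simp add: m3_def)
qed

lemma abs_m3_le_1: "\<bar>m3 x\<bar> \<le> 1" and abs_m1_le_1: "\<bar>m1 x\<bar> \<le> 1" and abs_m2_le_1: "\<bar>m2 x\<bar> \<le> 1"
  using component_le_norm_cart[of "field x" 3] component_le_norm_cart[of "field x" 1] component_le_norm_cart[of "field x" 2]
  unfolding norm_field by (simp_all add: field_def)

lemma B_le: "0 \<le> B x" "B x \<le> 2 / \<epsilon>"
proof -
  have "0 \<le> Z x" by (simp add: Z_def)
  then have "sqrt (core_sq (Z x)) \<le> 2" using core_sq_bounds[of "Z x"] by (simp add: real_le_lsqrt)
  then show "0 \<le> B x" "B x \<le> 2 / \<epsilon>" unfolding B_def using \<epsilon>_pos core_sq_pos[of "Z x"] by (auto simp: divide_right_mono)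
qed

text \<open>With p the first component of \<open>stadium_normal\<close>, the normal component is B
  x2 (q - p). In the rotations near the caps q = p. Elsewhere q and p are bounded by multiples of 1
  - |x2|, through \<open>Q_le\<close> and the vanishing of \<open>sg\<close>, and 1 - |x2| is
  controlled by 1 - normal_sq there. The factor 4/\<epsilon> is harmless, as it enters only the
  constant of the integration by parts.\<close>

lemma tangency:
  assumes x: "x \<in> closure stadium"
  shows "\<bar>m1 x * stadium_normal x $ 1 + m2 x * stadium_normal x $ 2\<bar> \<le> 4 / \<epsilon> * (1 - normal_sq x)"
proof -
  let ?y = "x $ 2"
  define p where "p = stadium_normal x $ 1"
  have y: "\<bar>?y\<bar> \<le> 1" by (rule closure_stadium_bounds[OF x])
  have nx: "0 \<le> 1 - normal_sq x" using x by (simp add: closure_stadium)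
  have pd: "p = max 0 (x $ 1 - 1) - max 0 (- (x $ 1) - 1)" unfolding p_def by (rule stadium_normal_1)
  have n: "normal_sq x = p\<^sup>2 + ?y\<^sup>2" by (simp add: normal_sq_eq norm_2 p_def stadium_normal_2)
  have Q: "0 \<le> Q ?y" "Q ?y \<le> (1 - \<bar>?y\<bar>) / 2" using Q_nonneg[OF y] Q_le[OF y] by auto
  have sg0: "0 \<le> sg ?y" by (rule sg_nonneg[OF y])
  have sgl: "sg ?y \<le> (1 - \<bar>?y\<bar>) / 10"
  proof -
    have "\<delta> ^ 3 \<le> 1 / 20"
    proof -
      have "\<delta> ^ 3 \<le> \<delta> ^ 1" using \<delta>_pos \<delta>_le by (intro power_decreasing) auto
      then show ?thesis using \<delta>_le by simp
    qed
    moreover have "1 - ?y\<^sup>2 = (1 + \<bar>?y\<bar>) * (1 - \<bar>?y\<bar>)" by (simp add: power2_eq_square algebra_simps abs_mult_self_eq)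
    moreover have "\<dots> \<le> 2 * (1 - \<bar>?y\<bar>)" using y by (intro mult_right_mono) auto
    ultimately have "sg ?y \<le> 1 / 20 * (2 * (1 - \<bar>?y\<bar>))"
      unfolding sg_def using \<delta>_pos y by (intro mult_mono) (auto simp: abs_square_le_1)
    then show ?thesis by simp
  qed
  have one: "1 - \<bar>?y\<bar> \<le> 1 - ?y\<^sup>2"
    using mult_left_le[of "\<bar>?y\<bar>" "\<bar>?y\<bar>"] y by (simp add: power2_eq_square abs_mult_self_eq)
  have key: "\<bar>q x - p\<bar> \<le> 2 * (1 - normal_sq x)"
  proof -
    consider "sg ?y \<le> ta x" | "sg ?y \<le> tb x" | "active x" using region_cases by blast
    then show ?thesis
    proof cases
      case 1
      then have "x $ 1 \<ge> 1" using Q sg0 unfolding ta_def by linarith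
      then have "q x = p" using right_region(1)[OF y 1] by (simp add: pd max_def)
      then show ?thesis using nx by simp
    next
      case 2
      have q: "q x = x $ 1 + 1" by (rule left_region(1)[OF y 2])
      show ?thesis
      proof (cases "x $ 1 \<le> - 1")
        case True
        then have "q x = p" by (simp add: q pd max_def)
        then show ?thesis using nx by simp
      next
        case False
        have xQ: "x $ 1 + 1 \<le> Q ?y" using 2 sg0 unfolding tb_def by linarith
        moreover have "Q ?y \<le> 1" using Q(2) abs_ge_zero[of ?y] by (simp add: field_simps)
        ultimately have "x $ 1 < 1" by simp
        then have "p = 0" using False by (simp add: pd max_def)
        then show ?thesis using xQ Q one False by (simp add: n q)
      qed
    next
      case 3
      have sq35: "(c * (3 / 5))\<^sup>2 = 9 / 25 * (c * c)" for c :: real by (simp add: power2_eq_square)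
      have q: "\<bar>q x - Q ?y\<bar> \<le> sg ?y" by (rule active_region(1)[OF y 3])
      have a: "x $ 1 - 1 \<le> Q ?y + sg ?y" "- (x $ 1) - 1 \<le> sg ?y" using 3 Q unfolding active_def by linarith+
      \<comment> \<open>3/5 = 1/2 + 1/10, the bounds for Q and for the smoothing width.\<close>
      have p: "\<bar>p\<bar> \<le> (1 - \<bar>?y\<bar>) * (3 / 5)" using a Q sgl sg0 y unfolding pd by (auto simp: max_def abs_le_iff)
      define a where "a = 1 - \<bar>?y\<bar>"
      have a0: "0 \<le> a" "a \<le> 1" using y by (auto simp: a_def)
      have qp: "\<bar>q x - p\<bar> \<le> a * (6 / 5)" using p q Q sgl sg0 unfolding a_def by linarith
      have "p\<^sup>2 \<le> (a * (3 / 5))\<^sup>2" using p unfolding a_def by (metis abs_ge_zero power2_abs power_mono)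
      also have "\<dots> = 9 / 25 * (a * a)" by (rule sq35)
      also have "\<dots> \<le> 9 / 25 * (1 * a)" using a0 by (intro mult_left_mono mult_right_mono) auto
      finally have p2: "p\<^sup>2 \<le> 9 / 25 * a" by simp
      have "a \<le> 1 - ?y\<^sup>2" using one by (simp add: a_def)
      \<comment> \<open>1 - normal_sq \<ge> a - 9/25 a = 16/25 a, and 2 * 16/25 = 32/25 exceeds
        6/5.\<close>
      with p2 a0 have "a * (6 / 5) \<le> 2 * (1 - normal_sq x)" by (simp add: n field_simps)
      with qp show ?thesis by (rule order_trans)
    qed
  qed
  have "m1 x * stadium_normal x $ 1 + m2 x * stadium_normal x $ 2 = B x * (?y * (q x - p))"
    by (simp add: m1_def m2_def p_def stadium_normal_2 algebra_simps)
  also have "\<bar>\<dots>\<bar> \<le> 2 / \<epsilon> * (1 * (2 * (1 - normal_sq x)))"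
    unfolding abs_mult using B_le[of x] y key \<epsilon>_pos by (intro mult_mono) auto
  finally show ?thesis by simp
qed

end

section \<open>The energy of the field for fixed parameters\<close>

context landau
begin

lemma stadium_subset_strip: "stadium \<subseteq> strip"
  using stadium_bounds(2) by (auto simp: strip_def)

lemma C1_on_field: "C1_on stadium field"
  unfolding field_def[abs_def]
  by (rule C1_on_vector_3[OF has_grad_m(1) has_grad_m(2) has_grad_m(3)])
    (auto intro!: stadium_bounds(2) continuous_on_subset[OF _ stadium_subset_strip] continuous_strip_m)

lemma grad_sq_field: "x \<in> stadium \<Longrightarrow> grad_sq field x = G x"
  unfolding field_def[abs_def] G_def
  by (rule grad_sq_vector_3[OF has_grad_m]) (auto intro!: stadium_bounds(2))

lemma norm_vtx_le: "x \<in> stadium \<Longrightarrow> norm (x - vtx) \<le> 4"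
  using stadium_bounds[of x] norm_le_l1_cart[of "x - vtx"] by (simp add: sum_2 vtx_def)

lemma G_cases:
  assumes x: "x \<in> stadium"
  obtains "G x \<le> 800 / max (\<delta>\<^sup>2) ((x $ 2)\<^sup>2)" | "\<epsilon> \<le> norm (x - vtx)" "G x = 1 / (norm (x - vtx))\<^sup>2"
    | "norm (x - vtx) < \<epsilon>" "G x \<le> 384 / \<epsilon>\<^sup>2"
proof (cases "sg (x $ 2) \<le> tb x")
  case True
  note y = stadium_bounds(2)[OF x]
  from G_left_bound[OF y True] r_left[OF y True] show ?thesis
    using that(2,3) by (cases "\<epsilon> \<le> r x") auto
next
  case False
  from G_outer_bound[OF stadium_bounds(2)[OF x] False] show ?thesis by (rule that(1))
qed

text \<open>A qualitative bound for dominated convergence and integrability; it degenerates with the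
  parameters and does not enter the energy estimate.\<close>

lemma G_bounded: assumes x: "x \<in> stadium" shows "G x \<le> 800 / \<delta>\<^sup>2 + 385 / \<epsilon>\<^sup>2"
proof -
  have p: "0 \<le> 800 / \<delta>\<^sup>2" "0 \<le> 1 / \<epsilon>\<^sup>2" by auto
  have "385 / \<epsilon>\<^sup>2 = 385 * (1 / \<epsilon>\<^sup>2)" "384 / \<epsilon>\<^sup>2 = 384 * (1 / \<epsilon>\<^sup>2)" by simp_all
  note e = this
  from x show ?thesis
  proof (cases rule: G_cases)
    case 1
    have "800 / max (\<delta>\<^sup>2) ((x $ 2)\<^sup>2) \<le> 800 / \<delta>\<^sup>2"
      using \<delta>_pos max_sq_pos[of "x $ 2"] by (intro divide_left_mono) auto
    then show ?thesis using 1 p unfolding e by linarith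
  next
    case 2
    have "1 / (norm (x - vtx))\<^sup>2 \<le> 1 / \<epsilon>\<^sup>2"
      using 2 \<epsilon>_pos by (intro divide_left_mono power_mono mult_pos_pos zero_less_power) auto
    then show ?thesis using 2 p unfolding e by linarith
  next
    case 3
    then show ?thesis using p unfolding e by linarith
  qed
qed

lemma emeasure_ball_real2: "0 \<le> t \<Longrightarrow> emeasure lborel (ball (c::real^2) t) = ennreal (pi * t\<^sup>2)"
  by (simp add: emeasure_ball unit_ball_vol_2)

lemma nn_integral_wall:
  "(\<integral>\<^sup>+x. ennreal (800 / max (\<delta>\<^sup>2) ((x $ 2)\<^sup>2)) * (indicator {-2..2} (x $ 1) * indicator {-1..1} (x $ 2)) \<partial>(lborel :: (real^2) measure))
    \<le> ennreal (6400 * pi / \<delta>)"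
proof -
  let ?h = "\<lambda>y. ennreal (800 / max (\<delta>\<^sup>2) (y\<^sup>2))"
  have "(\<integral>\<^sup>+x. ennreal (800 / max (\<delta>\<^sup>2) ((x $ 2)\<^sup>2)) * (indicator {-2..2} (x $ 1) * indicator {-1..1} (x $ 2)) \<partial>(lborel :: (real^2) measure))
    = (\<integral>\<^sup>+y. \<integral>\<^sup>+(a::real). (?h y * indicator {-1..1} y) * indicator {-2..2} a \<partial>lborel \<partial>lborel)"
    by (subst nn_integral_real2') (auto simp: mult_ac intro!: nn_integral_cong)
  also have "\<dots> = (\<integral>\<^sup>+y. (?h y * indicator {-1..1} y) * 4 \<partial>lborel)"
    by (simp add: nn_integral_cmult_indicator)
  also have "\<dots> \<le> (\<integral>\<^sup>+y. ennreal (6400 / (\<delta>\<^sup>2 + y\<^sup>2)) * indicator {-1..1} y \<partial>lborel)"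
  proof (intro nn_integral_mono)
    fix y :: real
    \<comment> \<open>Replacing the maximum by half the sum gives an integrand with an arctan
      primitive, whose total variation is at most pi/\<delta> up to the constant; the factor 4 is
      the horizontal length.\<close>
    have "800 / max (\<delta>\<^sup>2) (y\<^sup>2) * 4 = 6400 / (2 * max (\<delta>\<^sup>2) (y\<^sup>2))" by simp
    also have "\<dots> \<le> 6400 / (\<delta>\<^sup>2 + y\<^sup>2)"
      using \<delta>_pos max_sq_pos[of y] by (intro divide_left_mono mult_pos_pos add_pos_nonneg) auto
    finally have le: "ennreal (800 / max (\<delta>\<^sup>2) (y\<^sup>2) * 4) \<le> ennreal (6400 / (\<delta>\<^sup>2 + y\<^sup>2))" by (rule ennreal_leI)
    have eq: "ennreal (800 / max (\<delta>\<^sup>2) (y\<^sup>2) * 4) = ?h y * 4"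
      using max_sq_pos[of y] by (subst ennreal_mult) auto
    show "?h y * indicator {-1..1} y * 4 \<le> ennreal (6400 / (\<delta>\<^sup>2 + y\<^sup>2)) * indicator {-1..1} y"
      using le[unfolded eq] by (simp add: indicator_def)
  qed
  also have "\<dots> = ennreal (6400 / \<delta> * arctan (1 / \<delta>) - 6400 / \<delta> * arctan (- 1 / \<delta>))"
  proof (rule nn_integral_FTC_Icc)
    fix y :: real
    have d: "\<delta>\<^sup>2 + y\<^sup>2 > 0" using \<delta>_pos by (intro add_pos_nonneg) auto
    have "((\<lambda>y. 6400 / \<delta> * arctan (y / \<delta>)) has_real_derivative 6400 / \<delta> * (inverse (1 + (y / \<delta>)\<^sup>2) * (1 / \<delta>))) (at y)"
      using \<delta>_pos by (auto intro!: derivative_eq_intros simp: power2_eq_square)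
    moreover have "6400 / \<delta> * (inverse (1 + (y / \<delta>)\<^sup>2) * (1 / \<delta>)) = 6400 / (\<delta>\<^sup>2 + y\<^sup>2)"
    proof -
      have "1 + (y / \<delta>)\<^sup>2 = (\<delta>\<^sup>2 + y\<^sup>2) / \<delta>\<^sup>2" using \<delta>_pos by (simp add: power_divide add_divide_distrib)
      then show ?thesis using \<delta>_pos d by (simp add: power2_eq_square)
    qed
    ultimately show "((\<lambda>y. 6400 / \<delta> * arctan (y / \<delta>)) has_real_derivative 6400 / (\<delta>\<^sup>2 + y\<^sup>2)) (at y)" by simp
    show "0 \<le> 6400 / (\<delta>\<^sup>2 + y\<^sup>2)" using d by simp
  qed auto
  also have "\<dots> \<le> ennreal (6400 * pi / \<delta>)"
  proof (rule ennreal_leI)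
    have "6400 / \<delta> * (arctan (1 / \<delta>) - arctan (- 1 / \<delta>)) \<le> 6400 / \<delta> * pi"
      using arctan_ubound[of "1 / \<delta>"] arctan_lbound[of "- 1 / \<delta>"] \<delta>_pos by (intro mult_left_mono) auto
    then show "6400 / \<delta> * arctan (1 / \<delta>) - 6400 / \<delta> * arctan (- 1 / \<delta>) \<le> 6400 * pi / \<delta>"
      by (simp add: right_diff_distrib)
  qed
  finally show ?thesis .
qed

text \<open>The three cases of \<open>G_cases\<close> are summed: the annulus about the vortex gives
  2 pi ln (4/\<epsilon>) + pi, the core 384 pi and the rest the wall term. The radius 4 covers the
  stadium as seen from (-1, 0).\<close>

lemma dirichlet_energy:
  "(\<integral>\<^sup>+x\<in>stadium. ennreal (grad_sq field x) \<partial>lborel) \<le> ennreal (2 * pi * ln (4 / \<epsilon>) + 385 * pi + 6400 * pi / \<delta>)"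
proof -
  let ?f1 = "\<lambda>x. ennreal (1 / (norm (x - vtx))\<^sup>2) * indicator {x. \<epsilon> \<le> norm (x - vtx) \<and> norm (x - vtx) \<le> 4} x"
  let ?f2 = "\<lambda>x. ennreal (384 / \<epsilon>\<^sup>2) * indicator (ball vtx \<epsilon>) x"
  let ?f3 = "\<lambda>x::real^2. ennreal (800 / max (\<delta>\<^sup>2) ((x $ 2)\<^sup>2)) * (indicator {-2..2} (x $ 1) * indicator {-1..1} (x $ 2))"
  have [measurable]: "ball vtx \<epsilon> \<in> sets borel" by simp
  have e4: "\<epsilon> \<le> 4" using \<epsilon>_le \<delta>_le by simp
  have "(\<integral>\<^sup>+x\<in>stadium. ennreal (grad_sq field x) \<partial>lborel) \<le> (\<integral>\<^sup>+x. ?f1 x + (?f2 x + ?f3 x) \<partial>lborel)"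
  proof (intro nn_integral_mono)
    fix x :: "real^2"
    show "ennreal (grad_sq field x) * indicator stadium x \<le> ?f1 x + (?f2 x + ?f3 x)"
    proof (cases "x \<in> stadium")
      case True
      have b: "x $ 1 \<in> {-2..2}" "x $ 2 \<in> {-1..1}" using stadium_bounds[OF True] by (auto simp: abs_le_iff)
      from True show ?thesis
      proof (cases rule: G_cases)
        case 1
        then have "ennreal (G x) \<le> ?f3 x" using b by (simp add: ennreal_leI)
        then show ?thesis using True grad_sq_field[OF True] by (simp add: add_increasing)
      next
        case 2
        then have "ennreal (G x) = ?f1 x" using norm_vtx_le[OF True] by simp
        then show ?thesis using True grad_sq_field[OF True] by (simp add: add_increasing2)
      next
        case 3
        then have "ennreal (G x) \<le> ?f2 x" by (simp add: ennreal_leI dist_norm norm_minus_commute)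
        then have "ennreal (G x) \<le> ?f2 x + ?f3 x" by (rule add_increasing2[rotated]) simp
        then show ?thesis using True grad_sq_field[OF True] by (simp add: add_increasing)
      qed
    qed simp
  qed
  also have "\<dots> = (\<integral>\<^sup>+x. ?f1 x \<partial>lborel) + (\<integral>\<^sup>+x. ?f2 x + ?f3 x \<partial>lborel)"
    by (rule nn_integral_add) measurable
  also have "(\<integral>\<^sup>+x. ?f2 x + ?f3 x \<partial>lborel) = (\<integral>\<^sup>+x. ?f2 x \<partial>lborel) + (\<integral>\<^sup>+x. ?f3 x \<partial>lborel)"
    by (rule nn_integral_add) measurable
  also have "(\<integral>\<^sup>+x. ?f2 x \<partial>lborel) = ennreal (384 * pi)"
    using \<epsilon>_pos by (simp add: nn_integral_cmult_indicator emeasure_ball_real2 ennreal_mult[symmetric])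
  also have "(\<integral>\<^sup>+x. ?f1 x \<partial>lborel) + (ennreal (384 * pi) + (\<integral>\<^sup>+x. ?f3 x \<partial>lborel)) \<le>
    ennreal (2 * pi * ln (4 / \<epsilon>) + pi) + (ennreal (384 * pi) + ennreal (6400 * pi / \<delta>))"
    by (intro add_mono order_refl nn_integral_wall nn_integral_inverse_square_annulus \<epsilon>_pos e4)
  also have "\<dots> = ennreal (2 * pi * ln (4 / \<epsilon>) + 385 * pi + 6400 * pi / \<delta>)"
  proof -
    have "0 \<le> ln (4 / \<epsilon>)" using e4 \<epsilon>_pos by simp
    then show ?thesis using \<delta>_pos by (simp add: ennreal_plus[symmetric] del: ennreal_plus)
  qed
  finally show ?thesis .
qed

lemma anisotropy_energy:
  "ennreal (1 / \<epsilon>\<^sup>2) * (\<integral>\<^sup>+x\<in>stadium. ennreal ((field x $ 3)\<^sup>2) \<partial>lborel) \<le> ennreal pi"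
proof -
  have "(\<integral>\<^sup>+x\<in>stadium. ennreal ((field x $ 3)\<^sup>2) \<partial>lborel) \<le> (\<integral>\<^sup>+x. indicator (ball vtx \<epsilon>) x \<partial>lborel)"
  proof (intro nn_integral_mono)
    fix x :: "real^2"
    show "ennreal ((field x $ 3)\<^sup>2) * indicator stadium x \<le> indicator (ball vtx \<epsilon>) x"
    proof (cases "x \<in> stadium \<and> norm (x - vtx) < \<epsilon>")
      case True
      have "(m3 x)\<^sup>2 \<le> 1" using abs_m3_le_1[of x] by (simp add: abs_square_le_1)
      with True show ?thesis by (simp add: field_def dist_norm norm_minus_commute)
    next
      case False
      then show ?thesis using m3_eq_0[of x] stadium_bounds(2)[of x] by (auto simp: indicator_def field_def)
    qed
  qed
  also have "\<dots> = ennreal (pi * \<epsilon>\<^sup>2)" using \<epsilon>_pos by (simp add: emeasure_ball_real2)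
  finally have "ennreal (1 / \<epsilon>\<^sup>2) * (\<integral>\<^sup>+x\<in>stadium. ennreal ((field x $ 3)\<^sup>2) \<partial>lborel) \<le> ennreal (1 / \<epsilon>\<^sup>2) * ennreal (pi * \<epsilon>\<^sup>2)"
    by (rule mult_left_mono) simp
  also have "\<dots> = ennreal pi" using \<epsilon>_pos by (subst ennreal_mult[symmetric]) auto
  finally show ?thesis .
qed

text \<open>The total variation of \<open>v\<close>, which rises from 0 to 1 and falls back.\<close>

lemma nn_integral_abs_v': "(\<integral>\<^sup>+y. ennreal \<bar>v' y\<bar> * indicator {-1..1} y \<partial>lborel) = 2"
proof -
  let ?h = "\<lambda>y. ennreal \<bar>v' y\<bar> * indicator {-1..1} y"
  have [measurable]: "v' \<in> borel_measurable borel" unfolding v'_def by measurable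
  have "(\<integral>\<^sup>+y. ?h y \<partial>lborel) = 2 * (\<integral>\<^sup>+y. ?h y * indicator {0..} y \<partial>lborel)"
    by (rule nn_integral_even) (auto simp: v'_odd indicator_def)
  also have "(\<integral>\<^sup>+y. ?h y * indicator {0..} y \<partial>lborel) = (\<integral>\<^sup>+y. ennreal (- v' y) * indicator {0..1} y \<partial>lborel)"
  proof (intro nn_integral_cong)
    fix y :: real
    have "\<bar>v' y\<bar> = - v' y" if "0 \<le> y" using that \<Lambda>_ge max_sq_pos[of y] by (simp add: v'_def)
    then show "?h y * indicator {0..} y = ennreal (- v' y) * indicator {0..1} y"
      by (auto simp: indicator_def)
  qed
  also have "\<dots> = ennreal (- v 1 - (- v 0))"
  proof (rule nn_integral_FTC_Icc[where F = "\<lambda>y. - v y"])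
    show "((\<lambda>y. - v y) has_real_derivative - v' y) (at y)" for y by (rule DERIV_minus[OF DERIV_v])
    show "0 \<le> - v' y" if "y \<in> {0..1}" for y using that \<Lambda>_ge max_sq_pos[of y] by (simp add: v'_def)
  qed auto
  also have "v 1 = 0" using \<delta>_le by (simp add: v_large)
  also have "v 0 = 1" by (simp add: v_def)
  finally show ?thesis by simp
qed

definition src :: "real^2 \<Rightarrow> real" where
  "src x = (if x \<in> stadium then F x else 0)"

lemma src_measurable [measurable]: "src \<in> borel_measurable borel"
  unfolding src_def F_def
  by (intro measurable_on_stadium continuous_intros continuous_on_subset[OF _ stadium_subset_strip] continuous_strip_m)

lemma square_le_imp_abs_le: "w\<^sup>2 \<le> c \<Longrightarrow> \<bar>w\<bar> \<le> 1 + c" for w c :: real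
  using zero_le_power2[of "\<bar>w\<bar> - 1"] by (simp add: power2_eq_square algebra_simps)

lemma m_derivative_bounds:
  assumes x: "x \<in> stadium"
  shows "\<bar>m1x x\<bar> \<le> 1 + (800 / \<delta>\<^sup>2 + 385 / \<epsilon>\<^sup>2)" "\<bar>m2y x\<bar> \<le> 1 + (800 / \<delta>\<^sup>2 + 385 / \<epsilon>\<^sup>2)"
proof -
  have "(m1x x)\<^sup>2 \<le> G x" "(m2y x)\<^sup>2 \<le> G x" by (simp_all add: G_def)
  then show "\<bar>m1x x\<bar> \<le> 1 + (800 / \<delta>\<^sup>2 + 385 / \<epsilon>\<^sup>2)" "\<bar>m2y x\<bar> \<le> 1 + (800 / \<delta>\<^sup>2 + 385 / \<epsilon>\<^sup>2)"
    using G_bounded[OF x] by (auto intro!: square_le_imp_abs_le)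
qed

text \<open>Tangency excludes surface charge, so the Fourier transform is that of the bounded
  function \<open>src\<close>. The constant \<open>K\<close> depends on the parameters but leaves no
  trace in the identity.\<close>

lemma fourier_field:
  "fourier_distr (distr_div (\<lambda>x. indicator stadium x *\<^sub>R inplane (field x))) \<xi> =
    (LINT x|lborel. cis (- (\<xi> \<bullet> x)) * complex_of_real (src x)) / (2 * pi)"
proof -
  define K where "K = 1 + (800 / \<delta>\<^sup>2 + 385 / \<epsilon>\<^sup>2) + 4 / \<epsilon>"
  have K: "1 \<le> K" "1 + (800 / \<delta>\<^sup>2 + 385 / \<epsilon>\<^sup>2) \<le> K" "4 / \<epsilon> \<le> K"
    using \<epsilon>_pos by (auto simp: K_def)
  have ip: "inplane (field x) = vector [m1 x, m2 x]" for x
    by (simp add: inplane_def field_def)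
  have "\<i> * (LINT x|lborel. cis (- (\<xi> \<bullet> x)) * complex_of_real (\<xi> \<bullet> (indicator stadium x *\<^sub>R vector [m1 x, m2 x])))
    = (LINT x|lborel. cis (- (\<xi> \<bullet> x)) * complex_of_real (if x \<in> stadium then m1x x + m2y x else 0))"
  proof (rule stadium_integration_by_parts[where K = K])
    fix x assume x: "x \<in> stadium"
    show "has_grad m1 (m1x x) (m1y x) x" "has_grad m2 (m2x x) (m2y x) x"
      using has_grad_m stadium_bounds(2)[OF x] by auto
    show "\<bar>m1 x\<bar> \<le> K" "\<bar>m2 x\<bar> \<le> K" using abs_m1_le_1[of x] abs_m2_le_1[of x] K by auto
    show "\<bar>m1x x\<bar> \<le> K" "\<bar>m2y x\<bar> \<le> K" using m_derivative_bounds[OF x] K by auto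
    have "x \<in> closure stadium" using x closure_subset by blast
    from tangency[OF this]
    have "\<bar>m1 x * stadium_normal x $ 1 + m2 x * stadium_normal x $ 2\<bar> \<le> 4 / \<epsilon> * (1 - normal_sq x)" .
    also have "\<dots> \<le> K * (1 - normal_sq x)" using K x by (intro mult_right_mono) (auto simp: stadium_iff)
    finally show "\<bar>m1 x * stadium_normal x $ 1 + m2 x * stadium_normal x $ 2\<bar> \<le> K * (1 - normal_sq x)" .
  qed (auto intro!: continuous_on_subset[OF _ stadium_subset_strip] continuous_strip_m)
  then show ?thesis unfolding fourier_distr_div ip src_def F_def by simp
qed

lemma src_bound: "\<bar>src x\<bar> \<le> indicator {x. \<bar>x $ 1 - Q (x $ 2)\<bar> \<le> 1 + \<delta> ^ 3} x * (fbd (x $ 2) * indicator {-1..1} (x $ 2))"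
proof (cases "x \<in> stadium")
  case True
  then have "\<bar>x $ 2\<bar> < 1" by (rule stadium_bounds(2))
  moreover from this have "x $ 2 \<in> {-1..1}" by auto
  ultimately show ?thesis using F_bound[of x] True by (simp add: src_def)
next
  case False
  have "0 < 1 - \<delta>\<^sup>2" using \<delta>_sq_le by simp
  then show ?thesis using False \<delta>_pos by (auto simp: src_def fbd_def indicator_def)
qed

text \<open>At height y the charge lives on an interval of length 2 (1 + \<delta>^3) centred at Q y,
  so the displacement by Q does not affect the mass. The other factor 2 is the total variation of
  v.\<close>

lemma nn_integral_src: "(\<integral>\<^sup>+x. ennreal \<bar>src x\<bar> \<partial>lborel) \<le> ennreal (4 * (1 + \<delta> ^ 3) * (1 / (1 - \<delta>\<^sup>2) ^ 3 + 16 * \<delta>))"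
proof -
  have [measurable]: "v' \<in> borel_measurable borel" unfolding v'_def by measurable
  have [measurable]: "Q \<in> borel_measurable borel" unfolding Q_def W_def v_def ell_def by measurable
  have [measurable]: "fbd \<in> borel_measurable borel" unfolding fbd_def by measurable
  let ?k = "1 / (1 - \<delta>\<^sup>2) ^ 3"
  have k: "0 < 1 - \<delta>\<^sup>2" using \<delta>_sq_le by simp
  have f0: "0 \<le> fbd y" for y unfolding fbd_def using k \<delta>_pos by simp
  have "(\<integral>\<^sup>+x. ennreal \<bar>src x\<bar> \<partial>lborel) \<le>
    (\<integral>\<^sup>+(x::real^2). indicator {x. \<bar>x $ 1 - Q (x $ 2)\<bar> \<le> 1 + \<delta> ^ 3} x * (ennreal (fbd (x $ 2)) * indicator {-1..1} (x $ 2)) \<partial>lborel)"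
  proof (intro nn_integral_mono)
    fix x
    have "ennreal \<bar>src x\<bar> \<le> ennreal (indicator {x. \<bar>x $ 1 - Q (x $ 2)\<bar> \<le> 1 + \<delta> ^ 3} x * (fbd (x $ 2) * indicator {-1..1} (x $ 2)))"
      by (rule ennreal_leI[OF src_bound])
    then show "ennreal \<bar>src x\<bar> \<le> indicator {x. \<bar>x $ 1 - Q (x $ 2)\<bar> \<le> 1 + \<delta> ^ 3} x * (ennreal (fbd (x $ 2)) * indicator {-1..1} (x $ 2))"
      by (auto simp: indicator_def)
  qed
  also have "\<dots> = (\<integral>\<^sup>+y. \<integral>\<^sup>+(a::real). (ennreal (fbd y) * indicator {-1..1} y) * indicator {Q y - (1 + \<delta> ^ 3)..Q y + (1 + \<delta> ^ 3)} a \<partial>lborel \<partial>lborel)"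
    by (subst nn_integral_real2') (auto simp: indicator_def abs_le_iff intro!: nn_integral_cong)
  also have "\<dots> = (\<integral>\<^sup>+y. (ennreal (fbd y) * indicator {-1..1} y) * ennreal (2 * (1 + \<delta> ^ 3)) \<partial>lborel)"
    using \<delta>_pos by (simp add: nn_integral_cmult_indicator)
  also have "\<dots> = (\<integral>\<^sup>+y. ennreal (fbd y) * indicator {-1..1} y \<partial>lborel) * ennreal (2 * (1 + \<delta> ^ 3))"
    by (rule nn_integral_multc) measurable
  also have "(\<integral>\<^sup>+y. ennreal (fbd y) * indicator {-1..1} y \<partial>lborel) =
     (\<integral>\<^sup>+y. ennreal ?k * (ennreal \<bar>v' y\<bar> * indicator {-1..1} y) + ennreal (16 * \<delta>) * indicator {-1..1} y \<partial>lborel)"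
    using k \<delta>_pos by (intro nn_integral_cong) (auto simp: fbd_def indicator_def ennreal_mult[symmetric])
  also have "\<dots> = ennreal ?k * 2 + ennreal (16 * \<delta>) * 2"
    by (subst nn_integral_add) (auto simp: nn_integral_cmult nn_integral_abs_v' nn_integral_cmult_indicator)
  also have "\<dots> = ennreal (2 * (?k + 16 * \<delta>))"
  proof -
    have "ennreal (2 * (?k + 16 * \<delta>)) = ennreal (?k * 2 + 16 * \<delta> * 2)" by (simp add: algebra_simps)
    also have "\<dots> = ennreal (?k * 2) + ennreal (16 * \<delta> * 2)" using k \<delta>_pos by (intro ennreal_plus) auto
    also have "\<dots> = ennreal ?k * ennreal 2 + ennreal (16 * \<delta>) * ennreal 2"
      using k \<delta>_pos by (intro arg_cong2[of _ _ _ _ "(+)"] ennreal_mult) auto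
    finally show ?thesis by (simp only: ennreal_numeral)
  qed
  also have "\<dots> * ennreal (2 * (1 + \<delta> ^ 3)) = ennreal (4 * (1 + \<delta> ^ 3) * (?k + 16 * \<delta>))"
  proof -
    have "2 * a * (2 * b) = 4 * b * a" for a b :: real by simp
    then show ?thesis using k \<delta>_pos by (subst ennreal_mult[symmetric]) (simp_all only: add_nonneg_nonneg, auto)
  qed
  finally show ?thesis .
qed

definition stray :: real where
  "stray = 2 * pi * amp * ((1 + \<delta> ^ 3) * (1 / (1 - \<delta>\<^sup>2) ^ 3 + 16 * \<delta>))"

text \<open>The unitary normalisation contributes 1/(4 pi^2), which turns the 2 pi^3 of the Coulomb
  bound into pi/2; with a mass close to 4 this is close to 2 pi \<open>amp\<close>.\<close>

lemma stray_energy: "Hmhalf_sq (distr_div (\<lambda>x. indicator stadium x *\<^sub>R inplane (field x))) \<le> ennreal stray"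
proof -
  let ?I = "\<lambda>\<xi>. ennreal (1 / norm \<xi> * (cmod (LINT x|lborel. cis (- (\<xi> \<bullet> x)) * complex_of_real (src x)))\<^sup>2)"
  let ?b = "4 * (1 + \<delta> ^ 3) * (1 / (1 - \<delta>\<^sup>2) ^ 3 + 16 * \<delta>)"
  have k: "0 < 1 - \<delta>\<^sup>2" using \<delta>_sq_le by simp
  have A: "0 \<le> amp" unfolding amp_def using k \<Lambda>_ge \<delta>_pos by simp
  have b: "\<bar>src x\<bar> \<le> 2 * (1 + (800 / \<delta>\<^sup>2 + 385 / \<epsilon>\<^sup>2))" for x
    using m_derivative_bounds[of x] by (auto simp: src_def F_def)
  have odd: "src (reflect2 x) = - src x" for x
  proof -
    have "normal_sq (reflect2 x) = normal_sq x" by (simp add: normal_sq_def reflect2_def)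
    then show ?thesis using F_odd[of x] stadium_bounds(2)[of x] by (auto simp: src_def stadium_iff)
  qed
  have dec: "\<bar>src x\<bar> \<le> amp / \<bar>x $ 2\<bar>" for x
  proof (cases "x $ 2 = 0")
    \<comment> \<open>On the axis the right side is 0 by division by zero, so the bound rests on
      oddness.\<close>
    case True
    then have "reflect2 x = x" by (simp add: reflect2_def vec_eq_iff forall_2)
    then show ?thesis using odd[of x] True by simp
  next
    case False
    show ?thesis
    proof (cases "x $ 2 \<in> {-1..1}")
      case True
      have f0: "0 \<le> fbd (x $ 2)" unfolding fbd_def using k \<delta>_pos by simp
      have "\<bar>src x\<bar> \<le> fbd (x $ 2)"
        using src_bound[of x] f0 True by (cases "\<bar>x $ 1 - Q (x $ 2)\<bar> \<le> 1 + \<delta> ^ 3") auto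
      also have "\<dots> \<le> amp / \<bar>x $ 2\<bar>" using True False by (intro fbd_le) auto
      finally show ?thesis .
    next
      case False
      then have "src x = 0" using src_bound[of x] by simp
      then show ?thesis using A by simp
    qed
  qed
  have i: "integrable lborel src"
    by (rule integrable_bounded_support[OF src_measurable _ bounded_stadium, where K = "2 * (1 + (800 / \<delta>\<^sup>2 + 385 / \<epsilon>\<^sup>2))"])
      (use b in \<open>simp, simp add: src_def\<close>)
  have "Hmhalf_sq (distr_div (\<lambda>x. indicator stadium x *\<^sub>R inplane (field x))) =
    (\<integral>\<^sup>+\<xi>. ennreal (1 / (4 * pi\<^sup>2)) * ?I \<xi> \<partial>lborel)"
    unfolding Hmhalf_sq_def fourier_field
    by (intro nn_integral_cong) (simp add: ennreal_mult[symmetric] norm_divide power_divide power_mult_distrib)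
  also have "\<dots> = ennreal (1 / (4 * pi\<^sup>2)) * (\<integral>\<^sup>+\<xi>. ?I \<xi> \<partial>lborel)"
    by (rule nn_integral_cmult) measurable
  also have "\<dots> \<le> ennreal (1 / (4 * pi\<^sup>2)) * (ennreal (2 * pi ^ 3 * amp) * ennreal ?b)"
    by (intro mult_left_mono order_trans[OF coulomb_energy_odd_le[OF i A odd dec]] nn_integral_src) auto
  also have "\<dots> = ennreal (1 / (4 * pi\<^sup>2) * (2 * pi ^ 3 * amp * ?b))"
    using A k \<delta>_pos by (subst (1 2) ennreal_mult) auto
  also have "1 / (4 * pi\<^sup>2) * (2 * pi ^ 3 * amp * ?b) = stray"
    by (simp add: stray_def power2_eq_square power3_eq_cube)
  finally show ?thesis .
qed

text \<open>On the boundary normal_sq = 1, so the bound in \<open>tangency\<close> becomes exact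
  tangency.\<close>

lemma field_trace:
  "\<exists>g. has_trace stadium_arclength stadium field g \<and> (AE x in stadium_arclength. inplane (g x) \<bullet> stadium_normal x = 0)"
proof (intro exI conjI)
  have "continuous_on (closure stadium) field"
    by (rule continuous_on_subset[OF continuous_field_closed]) (use closure_stadium_bounds in auto)
  then show "has_trace stadium_arclength stadium field (\<lambda>x. if x \<in> closure stadium then field x else 0)"
    by (rule stadium_has_trace[OF C1_on_field, where K = "800 / \<delta>\<^sup>2 + 385 / \<epsilon>\<^sup>2"])
      (use G_bounded grad_sq_field in auto)
  have [measurable]: "stadium_curve \<in> measurable (restrict_space lborel {0..<2 * pi + 4}) borel"
    using stadium_curve_measurable by (intro measurable_restrict_space1) auto
  have f: "AE x in stadium_arclength. x \<in> frontier stadium"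
    unfolding stadium_arclength_def
    by (subst AE_distr_iff) (auto intro!: AE_I2 stadium_curve_frontier simp: space_restrict_space)
  show "AE x in stadium_arclength. inplane (if x \<in> closure stadium then field x else 0) \<bullet> stadium_normal x = 0"
    using f
  proof eventually_elim
    case (elim x)
    then have x: "x \<in> closure stadium" and n: "normal_sq x = 1"
      using norm_stadium_normal[OF elim] by (auto simp: frontier_def normal_sq_eq)
    from tangency[OF x] n have "m1 x * stadium_normal x $ 1 + m2 x * stadium_normal x $ 2 = 0" by simp
    then show ?case using x by (simp add: inplane_def field_def inner_2)
  qed
qed

theorem energy_field_le:
  assumes \<eta>: "0 < \<eta>"
  shows "energy stadium \<epsilon> \<eta> field \<le> ennreal (2 * pi * ln (4 / \<epsilon>) + 386 * pi + 6400 * pi / \<delta> + stray / \<eta>)"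
proof -
  have k: "0 < 1 - \<delta>\<^sup>2" using \<delta>_sq_le by simp
  have s0: "0 \<le> stray" unfolding stray_def amp_def using k \<Lambda>_ge \<delta>_pos by simp
  have l0: "0 \<le> ln (4 / \<epsilon>)" using \<epsilon>_le \<delta>_le \<epsilon>_pos by simp
  have "energy stadium \<epsilon> \<eta> field \<le> ennreal (2 * pi * ln (4 / \<epsilon>) + 385 * pi + 6400 * pi / \<delta>) + ennreal pi + ennreal (1 / \<eta>) * ennreal stray"
    unfolding energy_def by (intro add_mono dirichlet_energy anisotropy_energy mult_left_mono stray_energy) auto
  also have "\<dots> = ennreal (2 * pi * ln (4 / \<epsilon>) + 386 * pi + 6400 * pi / \<delta> + stray / \<eta>)"
    using s0 l0 \<delta>_pos \<eta> by (simp add: ennreal_plus[symmetric] ennreal_mult[symmetric] del: ennreal_plus)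
  finally show ?thesis .
qed

end

section \<open>The choice of the wall width and the limit\<close>

definition wall_width :: "real \<Rightarrow> real" where
  "wall_width \<eta> = \<eta> * (ln \<eta>)\<^sup>2"

definition log_width :: "real \<Rightarrow> real" where
  "log_width \<eta> = 1 / 2 - ln (wall_width \<eta>)"

text \<open>Chosen so that the bound of \<open>energy_field_le\<close> takes the required form
  exactly once 2 pi |ln \<epsilon>| is split off. It tends to 0 because the wall term is of order
  1/|ln \<eta>|, while |ln \<eta>| / \<open>log_width \<eta>\<close> tends to 1.\<close>

definition remainder :: "real \<Rightarrow> real" where
  "remainder \<eta> = \<eta> * - ln \<eta> * (2 * pi * ln 4 + 386 * pi + 6400 * pi / wall_width \<eta>)
    - ln \<eta> * (2 * pi * (1 / (1 - (wall_width \<eta>)\<^sup>2) ^ 3 / log_width \<eta> + 16 * wall_width \<eta>)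
      * ((1 + wall_width \<eta> ^ 3) * (1 / (1 - (wall_width \<eta>)\<^sup>2) ^ 3 + 16 * wall_width \<eta>))) - 2 * pi"

lemma remainder_tendsto: "(remainder \<longlongrightarrow> 0) (at_right 0)"
  unfolding remainder_def[abs_def] log_width_def wall_width_def by real_asymp

lemma eventually_landau:
  "\<forall>\<^sub>F (\<epsilon>, \<eta>) in regime. landau (wall_width \<eta>) \<epsilon> (log_width \<eta>) \<and> 0 < \<eta> \<and> \<eta> < 1"
proof -
  have "eventually (\<lambda>\<eta>. wall_width \<eta> \<le> 1 / 100) (at_right 0)" unfolding wall_width_def by real_asymp
  moreover have "eventually (\<lambda>\<eta>. log_width \<eta> \<ge> 8) (at_right 0)" unfolding log_width_def wall_width_def by real_asymp
  moreover have "eventually (\<lambda>\<eta>. (ln \<eta>)\<^sup>2 \<ge> 2) (at_right (0::real))" by real_asymp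
  moreover have "eventually (\<lambda>\<eta>. \<eta> < 1) (at_right (0::real))" by real_asymp
  ultimately have "eventually (\<lambda>\<eta>. wall_width \<eta> \<le> 1 / 100 \<and> log_width \<eta> \<ge> 8 \<and> (ln \<eta>)\<^sup>2 \<ge> 2 \<and> \<eta> < 1) (at_right 0)"
    by eventually_elim auto
  then obtain d where d: "d > 0" "\<And>\<eta>. 0 < \<eta> \<Longrightarrow> \<eta> < d \<Longrightarrow> wall_width \<eta> \<le> 1 / 100 \<and> log_width \<eta> \<ge> 8 \<and> (ln \<eta>)\<^sup>2 \<ge> 2 \<and> \<eta> < 1"
    unfolding eventually_at_right_field by auto
  show ?thesis
    unfolding eventually_regime
  proof (intro exI[of _ "min d 1"] conjI allI impI)
    fix \<epsilon> \<eta> :: real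
    assume a: "0 < \<eta>" "\<eta> < min d 1" "0 < \<epsilon>" "\<epsilon> / \<eta> < min d 1"
    then have w: "wall_width \<eta> \<le> 1 / 100" "log_width \<eta> \<ge> 8" "(ln \<eta>)\<^sup>2 \<ge> 2" "\<eta> < 1" using d(2)[of \<eta>] by auto
    have "\<epsilon> < \<eta>" using a by (simp add: divide_less_eq)
    \<comment> \<open>With (ln \<eta>)^2 \<ge> 2 the wall width is at least 2 \<eta>, so \<epsilon>
      < \<eta> gives the required \<epsilon> \<le> \<delta>/2.\<close>
    moreover have "\<eta> * 2 \<le> wall_width \<eta>" unfolding wall_width_def using w a by (intro mult_left_mono) auto
    ultimately show "case (\<epsilon>, \<eta>) of (\<epsilon>, \<eta>) \<Rightarrow> landau (wall_width \<eta>) \<epsilon> (log_width \<eta>) \<and> 0 < \<eta> \<and> \<eta> < 1"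
      using w a by (auto simp: log_width_def intro!: landau.intro)
  qed (use d in auto)
qed

theorem theorem1:
  shows "\<exists>(m :: real \<Rightarrow> real \<Rightarrow> real^2 \<Rightarrow> real^3) (r :: real \<Rightarrow> real \<Rightarrow> real).
    ((\<lambda>(\<epsilon>, \<eta>). r \<epsilon> \<eta>) \<longlongrightarrow> 0) regime \<and>
    (\<forall>\<^sub>F (\<epsilon>, \<eta>) in regime.
       C1_on stadium (m \<epsilon> \<eta>) \<and>
       (\<forall>x\<in>stadium. m \<epsilon> \<eta> x \<in> sphere 0 1) \<and>
       (\<exists>g. has_trace stadium_arclength stadium (m \<epsilon> \<eta>) g \<and>
            (AE x in stadium_arclength. inplane (g x) \<bullet> stadium_normal x = 0)) \<and>
       energy stadium \<epsilon> \<eta> (m \<epsilon> \<eta>)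
         \<le> ennreal (2 * pi * \<bar>ln \<epsilon>\<bar> + (2 * pi + r \<epsilon> \<eta>) / (\<eta> * \<bar>ln \<eta>\<bar>)))"
proof (intro exI[of _ "\<lambda>\<epsilon> \<eta>. landau.field (wall_width \<eta>) \<epsilon> (log_width \<eta>)"] exI[of _ "\<lambda>\<epsilon> \<eta>. remainder \<eta>"] conjI)
  have "filterlim (\<lambda>(\<epsilon>, \<eta>). \<eta>) (at_right 0) regime"
    unfolding regime_def by (rule filterlim_mono[OF filterlim_filtercomap order_refl inf_le1])
  from filterlim_compose[OF remainder_tendsto this]
  show "((\<lambda>(\<epsilon>, \<eta>). remainder \<eta>) \<longlongrightarrow> 0) regime"
    by (simp add: case_prod_beta')
  show "\<forall>\<^sub>F (\<epsilon>, \<eta>) in regime.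
       C1_on stadium (landau.field (wall_width \<eta>) \<epsilon> (log_width \<eta>)) \<and>
       (\<forall>x\<in>stadium. landau.field (wall_width \<eta>) \<epsilon> (log_width \<eta>) x \<in> sphere 0 1) \<and>
       (\<exists>g. has_trace stadium_arclength stadium (landau.field (wall_width \<eta>) \<epsilon> (log_width \<eta>)) g \<and>
            (AE x in stadium_arclength. inplane (g x) \<bullet> stadium_normal x = 0)) \<and>
       energy stadium \<epsilon> \<eta> (landau.field (wall_width \<eta>) \<epsilon> (log_width \<eta>))
         \<le> ennreal (2 * pi * \<bar>ln \<epsilon>\<bar> + (2 * pi + remainder \<eta>) / (\<eta> * \<bar>ln \<eta>\<bar>))"
    using eventually_landau
  proof (rule eventually_mono)
    fix p :: "real \<times> real"
    obtain \<epsilon> \<eta> where p: "p = (\<epsilon>, \<eta>)" by (cases p)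
    let ?d = "wall_width \<eta>" and ?L = "log_width \<eta>"
    assume "case p of (\<epsilon>, \<eta>) \<Rightarrow> landau (wall_width \<eta>) \<epsilon> (log_width \<eta>) \<and> 0 < \<eta> \<and> \<eta> < 1"
    then have l: "landau ?d \<epsilon> ?L" and \<eta>: "0 < \<eta>" "\<eta> < 1" by (auto simp: p)
    interpret landau ?d \<epsilon> ?L by (rule l)
    have ln\<eta>: "ln \<eta> < 0" using \<eta> by simp
    \<comment> \<open>Hence |ln \<epsilon>| = -ln \<epsilon>, and the vortex energy 2 pi ln
      (4/\<epsilon>) exceeds 2 pi |ln \<epsilon>| only by a constant.\<close>
    have e1: "\<epsilon> < 1" using \<epsilon>_le \<delta>_le by linarith
    have "energy stadium \<epsilon> \<eta> field \<le> ennreal (2 * pi * ln (4 / \<epsilon>) + 386 * pi + 6400 * pi / ?d + stray / \<eta>)"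
      by (rule energy_field_le[OF \<eta>(1)])
    also have "2 * pi * ln (4 / \<epsilon>) + 386 * pi + 6400 * pi / ?d + stray / \<eta> =
      2 * pi * \<bar>ln \<epsilon>\<bar> + (2 * pi + remainder \<eta>) / (\<eta> * \<bar>ln \<eta>\<bar>)"
    proof -
      have "2 * pi + remainder \<eta> = (\<eta> * \<bar>ln \<eta>\<bar>) * (2 * pi * ln 4 + 386 * pi + 6400 * pi / ?d + stray / \<eta>)"
      proof -
        have "2 * pi + remainder \<eta> = \<eta> * - ln \<eta> * (2 * pi * ln 4 + 386 * pi + 6400 * pi / ?d) + - ln \<eta> * stray"
          unfolding remainder_def stray_def amp_def by simp
        then show ?thesis using ln\<eta> \<eta> by (simp add: distrib_left)
      qed
      moreover have "\<eta> * \<bar>ln \<eta>\<bar> \<noteq> 0" using ln\<eta> \<eta> by auto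
      ultimately have "(2 * pi + remainder \<eta>) / (\<eta> * \<bar>ln \<eta>\<bar>) = 2 * pi * ln 4 + 386 * pi + 6400 * pi / ?d + stray / \<eta>"
        by simp
      then show ?thesis using e1 \<epsilon>_pos by (simp add: ln_div algebra_simps)
    qed
    finally show "case p of (\<epsilon>, \<eta>) \<Rightarrow> C1_on stadium (landau.field (wall_width \<eta>) \<epsilon> (log_width \<eta>)) \<and>
       (\<forall>x\<in>stadium. landau.field (wall_width \<eta>) \<epsilon> (log_width \<eta>) x \<in> sphere 0 1) \<and>
       (\<exists>g. has_trace stadium_arclength stadium (landau.field (wall_width \<eta>) \<epsilon> (log_width \<eta>)) g \<and>
            (AE x in stadium_arclength. inplane (g x) \<bullet> stadium_normal x = 0)) \<and>
       energy stadium \<epsilon> \<eta> (landau.field (wall_width \<eta>) \<epsilon> (log_width \<eta>))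
         \<le> ennreal (2 * pi * \<bar>ln \<epsilon>\<bar> + (2 * pi + remainder \<eta>) / (\<eta> * \<bar>ln \<eta>\<bar>))"
      using C1_on_field norm_field field_trace by (simp add: p)
  qed
qed

end
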